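(* Let $M=(X,\mathrm{d},\mathfrak{m})$ be a metric measure space and let $v,w:X\to\mathbb{R}$ be bounded continuous functions. Let $M'=(X,\mathrm{d}',\mathfrak{m}')$ be obtained from $M$ by the conformal transformation $\mathrm{d}'=e^{w}\mathrm{d}$, $\mathfrak{m}'=e^{v}\mathfrak{m}$. Then $W^{1,2}(M)$ and $W^{1,2}(M')$ coincide as sets and $$|\mathrm{D}f|_{M'}=e^{-w}|\mathrm{D}f|_M\qquad \mathfrak{m}\text{-a.e.}$$ for every $f\in W^{1,2}(M)$. In particular, if $M$ is infinitesimally Hilbertian, then $M'$ is also infinitesimally Hilbertian.
   Context: Standing assumptions on metric measure spaces $M=(X,\mathrm{d},\mathfrak{m})$: $(X,\mathrm{d})$ is a complete separable geodesic space; $\mathfrak m$ is a Borel measure with $\operatorname{supp}\mathfrak{m}=X$ and $\mathfrak{m}(B_r(x_0))<c_1\exp(c_2r^2)$ for every $r>0$, for some $c_1,c_2\ge 0$, $x_0\in X$. Conformal transformation: $\mathfrak{m}'=e^v\mathfrak{m}$ and $\mathrm{d}'=e^w\mathrm{d}$ denotes the distance $$\mathrm{d}'(x,y)=\inf_\gamma\Big\{\int_0^1|\dot\gamma_t|e^{w(\gamma_t)}\,\mathrm{d}t:\ \gamma\in \mathrm{AC}([0,1],X),\ \gamma_0=x,\ \gamma_1=y\Big\},$$ where $\mathrm{AC}([0,1],X)$ is the set of absolutely continuous curves in $(X,\mathrm{d})$ and $|\dot\gamma_t|$ the metric speed with respect to $\mathrm{d}$. Sobolev space: $\mathrm{lip}(f)(x)=\limsup_{y\to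 x}|f(y)-f(x)|/\mathrm{d}(x,y)$ ($0$ if $x$ is isolated). A function $f\in L^2(X,\mathfrak m)$ belongs to $W^{1,2}(M)$ if there are Lipschitz $f_n\in L^2$ with $f_n\to f$ and $\mathrm{lip}(f_n)\to G$ in $L^2(X,\mathfrak{m})$ for some $G\in L^2$; the $\mathfrak m$-a.e. minimal such $G$ is the minimal weak upper gradient $|\mathrm{D}f|_M$. $W^{1,2}(M')$ and $|\mathrm{D}f|_{M'}$ are defined in the same way on $M'$. $M$ is infinitesimally Hilbertian if $W^{1,2}(M)$ with norm $\|f\|^2=\|f\|_{L^2}^2+\||\mathrm{D}f|\|_{L^2}^2$ is a Hilbert space. *)

theory Defs
  imports "HOL-Analysis.Analysis"
begin

section \<open>Metric measure spaces\<close>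

definition geodesic_metric :: "'a metric \<Rightarrow> bool" where
  "geodesic_metric M \<longleftrightarrow>
     (\<forall>x\<in>mspace M. \<forall>y\<in>mspace M. \<exists>\<gamma>::real \<Rightarrow> 'a.
        \<gamma> \<in> {0..1} \<rightarrow> mspace M \<and> \<gamma> 0 = x \<and> \<gamma> 1 = y \<and>
        (\<forall>s\<in>{0..1}. \<forall>t\<in>{0..1}. mdist M (\<gamma> s) (\<gamma> t) = \<bar>s - t\<bar> * mdist M x y))"

definition measure_support :: "'a metric \<Rightarrow> 'a measure \<Rightarrow> 'a set" where
  "measure_support M m =
     {x \<in> mspace M. \<forall>U. openin (mtopology_of M) U \<and> x \<in> U \<longrightarrow> emeasure m U > 0}"

locale metric_measure_space =
  fixes M :: "'a metric" and m :: "'a measure"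
  assumes complete: "mcomplete_of M"
    and separable: "separable_space (mtopology_of M)"
    and geodesic: "geodesic_metric M"
    and space_eq: "space m = mspace M"
    and sets_eq_borel: "sets m = sigma_sets (mspace M) {U. openin (mtopology_of M) U}"
    and full_support: "measure_support M m = mspace M"
    and growth: "\<exists>c1\<ge>0. \<exists>c2\<ge>0. \<exists>x0\<in>mspace M. \<forall>r>0.
        emeasure m (mball_of M x0 r) < ennreal (c1 * exp (c2 * r\<^sup>2))"


section \<open>Conformal transformation\<close>

definition ac_curve :: "'a metric \<Rightarrow> (real \<Rightarrow> 'a) \<Rightarrow> bool" where
  "ac_curve M \<gamma> \<longleftrightarrow> \<gamma> \<in> {0..1} \<rightarrow> mspace M \<and>
     (\<exists>g. set_integrable lebesgue {0..1} g \<and>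
        (\<forall>s t. 0 \<le> s \<and> s \<le> t \<and> t \<le> 1 \<longrightarrow>
           mdist M (\<gamma> s) (\<gamma> t) \<le> set_lebesgue_integral lebesgue {s..t} g))"

text \<open>For an absolutely continuous curve this limit exists at almost every \<open>t\<close>; the
  (unspecified) values elsewhere do not affect integrals.\<close>

definition metric_speed :: "'a metric \<Rightarrow> (real \<Rightarrow> 'a) \<Rightarrow> real \<Rightarrow> real" where
  "metric_speed M \<gamma> t =
     Lim (at t within {0..1}) (\<lambda>s. mdist M (\<gamma> s) (\<gamma> t) / \<bar>s - t\<bar>)"

definition conformal_dist :: "'a metric \<Rightarrow> ('a \<Rightarrow> real) \<Rightarrow> 'a \<Rightarrow> 'a \<Rightarrow> real" where
  "conformal_dist M w x y =
     Inf {set_lebesgue_integral lebesgue {0..1} (\<lambda>t. metric_speed M \<gamma> t * exp (w (\<gamma> t))) |\<gamma>.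
            ac_curve M \<gamma> \<and> \<gamma> 0 = x \<and> \<gamma> 1 = y}"

text \<open>The locale \<^locale>\<open>Metric_space\<close> requires symmetry and nonnegativity of the distance also
  off the carrier, hence the value 0 there. On a geodesic space with \<open>w\<close> bounded and continuous,
  \<^const>\<open>conformal_dist\<close> is a metric on the carrier, so that the constructor \<^const>\<open>metric\<close> is
  applied within its domain.\<close>

definition conformal_metric :: "'a metric \<Rightarrow> ('a \<Rightarrow> real) \<Rightarrow> 'a metric" where
  "conformal_metric M w =
     metric (mspace M,
       \<lambda>x y. if x \<in> mspace M \<and> y \<in> mspace M then conformal_dist M w x y else 0)"

definition conformal_measure :: "'a measure \<Rightarrow> ('a \<Rightarrow> real) \<Rightarrow> 'a measure" where
  "conformal_measure m v = density m (\<lambda>x. ennreal (exp (v x)))"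


section \<open>Sobolev space\<close>

text \<open>Elements of \<open>L\<^sup>2\<close> and \<open>W\<^sup>1\<^sup>,\<^sup>2\<close> are represented by measurable functions rather than by
  classes of functions agreeing almost everywhere. Membership in these spaces, convergence, the
  gradient (up to null sets) and the norm depend only on the class.\<close>

definition L2 :: "'a measure \<Rightarrow> ('a \<Rightarrow> real) set" where
  "L2 m = {f \<in> borel_measurable m. integrable m (\<lambda>x. (f x)\<^sup>2)}"

definition L2_tendsto :: "'a measure \<Rightarrow> (nat \<Rightarrow> 'a \<Rightarrow> real) \<Rightarrow> ('a \<Rightarrow> real) \<Rightarrow> bool" where
  "L2_tendsto m F f \<longleftrightarrow> (\<forall>n. F n \<in> L2 m) \<and> f \<in> L2 m \<and>
     (\<lambda>n. \<integral>x. (F n x - f x)\<^sup>2 \<partial>m) \<longlonglongrightarrow> 0"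

text \<open>The upper limit is taken in \<^typ>\<open>ereal\<close>; it is finite whenever \<open>f\<close> is Lipschitz, the only
  case in which \<open>local_lip\<close> is used.\<close>

definition local_lip :: "'a metric \<Rightarrow> ('a \<Rightarrow> real) \<Rightarrow> 'a \<Rightarrow> real" where
  "local_lip M f x =
     (if openin (mtopology_of M) {x} then 0
      else real_of_ereal
        (Limsup (atin (mtopology_of M) x) (\<lambda>y. ereal (\<bar>f y - f x\<bar> / mdist M x y))))"

definition lip_limit :: "'a metric \<Rightarrow> 'a measure \<Rightarrow> ('a \<Rightarrow> real) \<Rightarrow> ('a \<Rightarrow> real) \<Rightarrow> bool" where
  "lip_limit M m f G \<longleftrightarrow>
     (\<exists>F :: nat \<Rightarrow> 'a \<Rightarrow> real. (\<forall>n. Lipschitz_continuous_map M euclidean_metric (F n)) \<and>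
        L2_tendsto m F f \<and> L2_tendsto m (\<lambda>n. local_lip M (F n)) G)"

definition W12 :: "'a metric \<Rightarrow> 'a measure \<Rightarrow> ('a \<Rightarrow> real) set" where
  "W12 M m = {f \<in> L2 m. \<exists>G. lip_limit M m f G}"

definition is_min_weak_upper_gradient ::
  "'a metric \<Rightarrow> 'a measure \<Rightarrow> ('a \<Rightarrow> real) \<Rightarrow> ('a \<Rightarrow> real) \<Rightarrow> bool" where
  "is_min_weak_upper_gradient M m f G \<longleftrightarrow>
     lip_limit M m f G \<and> (\<forall>H. lip_limit M m f H \<longrightarrow> (AE x in m. G x \<le> H x))"

text \<open>A representative of the minimal weak upper gradient, which is unique up to null sets.\<close>

definition min_weak_upper_gradient ::
  "'a metric \<Rightarrow> 'a measure \<Rightarrow> ('a \<Rightarrow> real) \<Rightarrow> 'a \<Rightarrow> real" where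
  "min_weak_upper_gradient M m f = (SOME G. is_min_weak_upper_gradient M m f G)"

definition W12_norm :: "'a metric \<Rightarrow> 'a measure \<Rightarrow> ('a \<Rightarrow> real) \<Rightarrow> real" where
  "W12_norm M m f =
     sqrt ((\<integral>x. (f x)\<^sup>2 \<partial>m) + (\<integral>x. (min_weak_upper_gradient M m f x)\<^sup>2 \<partial>m))"

text \<open>A set \<open>V\<close> of functions with norm \<open>N\<close> is a Hilbert space after identifying \<open>f\<close> and \<open>g\<close>
  whenever \<open>N (f - g) = 0\<close>: it is a vector space, \<open>N\<close> is induced by an inner product, and \<open>V\<close> is
  complete. For \<open>N = W12_norm M m\<close> this identification is equality almost everywhere, as
  \<open>N\<close> dominates the \<open>L\<^sup>2\<close> norm. The inner product descends to classes by the
  Cauchy-Schwarz inequality, and it is positive definite there.\<close>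

definition hilbert_space_on ::
  "('a \<Rightarrow> real) set \<Rightarrow> (('a \<Rightarrow> real) \<Rightarrow> real) \<Rightarrow> bool" where
  "hilbert_space_on V N \<longleftrightarrow>
     (\<lambda>x. 0) \<in> V \<and>
     (\<forall>f\<in>V. \<forall>g\<in>V. (\<lambda>x. f x + g x) \<in> V) \<and>
     (\<forall>c. \<forall>f\<in>V. (\<lambda>x. c * f x) \<in> V) \<and>
     (\<exists>B :: ('a \<Rightarrow> real) \<Rightarrow> ('a \<Rightarrow> real) \<Rightarrow> real.
        (\<forall>f\<in>V. \<forall>g\<in>V. B f g = B g f) \<and>
        (\<forall>f\<in>V. \<forall>g\<in>V. \<forall>h\<in>V. B (\<lambda>x. f x + g x) h = B f h + B g h) \<and>
        (\<forall>c. \<forall>f\<in>V. \<forall>g\<in>V. B (\<lambda>x. c * f x) g = c * B f g) \<and>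
        (\<forall>f\<in>V. B f f \<ge> 0 \<and> N f = sqrt (B f f))) \<and>
     (\<forall>F :: nat \<Rightarrow> 'a \<Rightarrow> real.
        (\<forall>n. F n \<in> V) \<and>
        (\<forall>e>0. \<exists>K. \<forall>i\<ge>K. \<forall>j\<ge>K. N (\<lambda>x. F i x - F j x) < e) \<longrightarrow>
        (\<exists>f\<in>V. (\<lambda>n. N (\<lambda>x. F n x - f x)) \<longlonglongrightarrow> 0))"

definition infinitesimally_hilbertian :: "'a metric \<Rightarrow> 'a measure \<Rightarrow> bool" where
  "infinitesimally_hilbertian M m \<longleftrightarrow> hilbert_space_on (W12 M m) (W12_norm M m)"

end

theory Submission
  imports Defs
begin

text \<open>
  The conformal distance satisfies \<open>d'(x, y) / d(x, y) \<rightarrow> exp (w x)\<close> as \<open>y \<rightarrow> x\<close>, so the two metrics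
  have the same Lipschitz functions and \<open>lip' f = exp (- w) lip f\<close>. Multiplication by a bounded
  weight bounded away from 0 preserves \<open>L\<^sup>2\<close> convergence, hence limits of local slopes correspond to
  each other under \<open>G \<mapsto> exp (- w) G\<close>, and so do the a.e. minimal ones.

  A minimal gradient exists: a sequence of Lipschitz functions with asymptotically minimal slope norm
  has Cauchy slopes by the parallelogram identity in \<open>L\<^sup>2\<close>, and cutting off with Lipschitz functions
  shows that pointwise minima of admissible bounds are admissible.

  For the Hilbert property the parallelogram identity of the energy has to be localised. The pointwise
  defect of \<open>f, g\<close> does not change if both functions are composed with a sawtooth of small height: by
  locality this replaces them by \<open>\<plusminus>f\<close>, \<open>\<plusminus>g\<close> up to constants. The sawtooth functions are small, so multiplying
  them by a Lipschitz cutoff \<open>\<eta>\<close> multiplies the defect by \<open>\<eta>\<^sup>2\<close> up to a vanishing error, and the integrated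
  identity gives \<open>\<integral> \<eta>\<^sup>2 defect = 0\<close> for all \<open>\<eta>\<close>.
\<close>

section \<open>Square-integrable functions\<close>

text \<open>The squared norm of \<open>M'\<close> carries the weight \<open>exp v\<close> on
  \<open>f\<close> and \<open>exp (v - 2 * w)\<close> on its gradient. A parallelogram identity
  known only after integration against \<open>m\<close> says nothing about such weights, which is
  why it must be brought down to points. The Leibniz rule for inserting a weight \<eta> is available
  here only up to an error \<open>L * \<bar>h\<bar>\<close>, with \<open>L\<close> a Lipschitz
  constant of \<eta>. This error sees the size of \<open>h\<close> and not its gradient, so it
  disappears when \<open>h\<close> is shrunk at unchanged slope. For the distance the obstacle is
  that \<open>metric_speed\<close> is a limit that need not exist. Everything rests on three facts
  about an absolutely continuous curve: the limit exists almost everywhere, it bounds the increments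
  after integration, and it lies below every other such bound. Then curves inside a small ball see
  an almost constant weight, and curves leaving the ball are too long to compete. Gradients are
  defined by convergence of true slopes, a class in which minima are hard to form. Minimality is
  therefore proved among upper bounds of slopes, and the minimum is then realised by true
  slopes.\<close>

definition l2norm :: "'a measure \<Rightarrow> ('a \<Rightarrow> real) \<Rightarrow> real" where
  "l2norm m f = sqrt (\<integral>x. (f x)\<^sup>2 \<partial>m)"

lemma L2_measurable: "f \<in> L2 m \<Longrightarrow> f \<in> borel_measurable m"
  and L2_integrable: "f \<in> L2 m \<Longrightarrow> integrable m (\<lambda>x. (f x)\<^sup>2)"
  by (auto simp: L2_def)

lemma l2norm_nonneg [simp]: "0 \<le> l2norm m f"
  by (simp add: l2norm_def)

lemma l2norm_power2: "(l2norm m f)\<^sup>2 = (\<integral>x. (f x)\<^sup>2 \<partial>m)"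
  by (simp add: l2norm_def)

lemma l2norm_uminus [simp]: "l2norm m (\<lambda>x. - f x) = l2norm m f"
  by (simp add: l2norm_def)

lemma l2norm_minus_commute: "l2norm m (\<lambda>x. f x - g x) = l2norm m (\<lambda>x. g x - f x)"
  by (simp add: l2norm_def power2_commute)

lemma L2_bound:
  assumes g: "g \<in> L2 m" and f: "f \<in> borel_measurable m" and le: "AE x in m. \<bar>f x\<bar> \<le> \<bar>g x\<bar>"
  shows "f \<in> L2 m" "l2norm m f \<le> l2norm m g"
proof -
  have le2: "AE x in m. (f x)\<^sup>2 \<le> (g x)\<^sup>2"
    using le by eventually_elim (simp add: abs_le_square_iff)
  have "integrable m (\<lambda>x. (f x)\<^sup>2)"
    by (rule Bochner_Integration.integrable_bound[OF L2_integrable[OF g]]) (use f le2 in auto)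
  then show "f \<in> L2 m" using f by (simp add: L2_def)
  then show "l2norm m f \<le> l2norm m g"
    unfolding l2norm_def using g le2 by (auto intro!: integral_mono_AE simp: L2_def)
qed

lemma L2_cong_AE:
  assumes f: "f \<in> L2 m" and g: "g \<in> borel_measurable m" and eq: "AE x in m. f x = g x"
  shows "g \<in> L2 m" "l2norm m g = l2norm m f"
proof -
  show "g \<in> L2 m" by (rule L2_bound(1)[OF f g]) (use eq in eventually_elim, simp)
  have "(\<integral>x. (g x)\<^sup>2 \<partial>m) = (\<integral>x. (f x)\<^sup>2 \<partial>m)"
    by (rule integral_cong_AE) (use f g eq in \<open>auto simp: L2_def\<close>)
  then show "l2norm m g = l2norm m f" by (simp add: l2norm_def)
qed

lemma L2_cmult [intro]: "f \<in> L2 m \<Longrightarrow> (\<lambda>x. c * f x) \<in> L2 m"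
  by (auto simp: L2_def power_mult_distrib)

lemma l2norm_cmult: "l2norm m (\<lambda>x. c * f x) = \<bar>c\<bar> * l2norm m f"
  by (simp add: l2norm_def power_mult_distrib real_sqrt_mult)

lemma L2_zero [simp, intro]: "(\<lambda>x. 0) \<in> L2 m" by (simp add: L2_def)

lemma l2norm_zero [simp]: "l2norm m (\<lambda>x. 0) = 0" by (simp add: l2norm_def)

lemma L2_uminus [intro]: "f \<in> L2 m \<Longrightarrow> (\<lambda>x. - f x) \<in> L2 m"
  by (simp add: L2_def)

lemma L2_abs [intro]: "f \<in> L2 m \<Longrightarrow> (\<lambda>x. \<bar>f x\<bar>) \<in> L2 m"
  by (auto simp: L2_def)

lemma l2norm_abs [simp]: "l2norm m (\<lambda>x. \<bar>f x\<bar>) = l2norm m f"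
  by (simp add: l2norm_def)

lemma L2_mult_integrable:
  assumes f: "f \<in> L2 m" and g: "g \<in> L2 m"
  shows "integrable m (\<lambda>x. f x * g x)"
proof (rule Bochner_Integration.integrable_bound)
  show "integrable m (\<lambda>x. (f x)\<^sup>2 + (g x)\<^sup>2)" using f g by (auto simp: L2_def)
  have "\<bar>a * b\<bar> \<le> a\<^sup>2 + b\<^sup>2" for a b :: real
    using zero_le_power2[of "a + b"] zero_le_power2[of "a - b"] zero_le_power2[of a] zero_le_power2[of b]
    unfolding power2_sum power2_diff abs_le_iff by (auto simp: minus_le_iff; linarith)
  then show "AE x in m. norm (f x * g x) \<le> norm ((f x)\<^sup>2 + (g x)\<^sup>2)" by simp
qed (use f g in \<open>auto simp: L2_def\<close>)

lemma L2_add [intro]: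
  assumes f: "f \<in> L2 m" and g: "g \<in> L2 m"
  shows "(\<lambda>x. f x + g x) \<in> L2 m"
proof -
  have "integrable m (\<lambda>x. (f x)\<^sup>2 + (g x)\<^sup>2 + 2 * (f x * g x))"
    using f g L2_mult_integrable[OF f g] by (auto simp: L2_def)
  moreover have "(\<lambda>x. f x + g x) \<in> borel_measurable m" using f g by (auto simp: L2_def)
  ultimately show ?thesis by (simp add: L2_def power2_sum mult.assoc)
qed

lemma L2_diff [intro]: "f \<in> L2 m \<Longrightarrow> g \<in> L2 m \<Longrightarrow> (\<lambda>x. f x - g x) \<in> L2 m"
  using L2_add[of f m "\<lambda>x. - g x"] L2_uminus by auto

text \<open>Integrated Young inequality: the weights \<open>1 + s\<close> and
  \<open>1 + 1 / s\<close> with \<open>s = B / A\<close> turn the bound into exactly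
  \<open>(A + B)\<^sup>2\<close>.\<close>

lemma l2norm_triangle:
  assumes f: "f \<in> L2 m" and g: "g \<in> L2 m"
  shows "l2norm m (\<lambda>x. f x + g x) \<le> l2norm m f + l2norm m g"
proof (rule field_le_epsilon)
  fix e :: real assume e: "e > 0"
  \<comment> \<open>The added \<open>e / 2\<close> keeps both bounds positive, so that the optimal
    ratio \<open>B / A\<close> makes sense when a norm vanishes.\<close>
  define A where "A = l2norm m f + e / 2"
  define B where "B = l2norm m g + e / 2"
  have AB: "A > 0" "B > 0" "l2norm m f \<le> A" "l2norm m g \<le> B" using e by (auto simp: A_def B_def add_nonneg_pos)
  define s where "s = B / A"
  have s: "s > 0" using AB by (simp add: s_def)
  have pw: "(a + b)\<^sup>2 \<le> (1 + s) * a\<^sup>2 + (1 + 1 / s) * b\<^sup>2" for a b :: real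
  proof -
    have "0 \<le> (s * a - b)\<^sup>2 / s" using s by simp
    also have "\<dots> = s * a\<^sup>2 - 2 * a * b + b\<^sup>2 / s" using s by (simp add: power2_eq_square field_simps)
    finally show ?thesis by (simp add: power2_sum algebra_simps)
  qed
  have "(\<integral>x. (f x + g x)\<^sup>2 \<partial>m) \<le> (\<integral>x. (1 + s) * (f x)\<^sup>2 + (1 + 1 / s) * (g x)\<^sup>2 \<partial>m)"
    by (rule integral_mono) (use L2_add[OF f g] f g pw in \<open>auto simp: L2_def\<close>)
  also have "\<dots> = (1 + s) * (l2norm m f)\<^sup>2 + (1 + 1 / s) * (l2norm m g)\<^sup>2"
    using f g by (simp add: l2norm_power2 L2_def)
  also have "\<dots> \<le> (1 + s) * A\<^sup>2 + (1 + 1 / s) * B\<^sup>2"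
    using AB s by (intro add_mono mult_left_mono power_mono) auto
  also have "\<dots> = (A + B)\<^sup>2" using AB by (simp add: s_def power2_eq_square field_simps)
  finally have "l2norm m (\<lambda>x. f x + g x) \<le> A + B"
    unfolding l2norm_def by (rule real_le_lsqrt[rotated -1]) (use AB in auto)
  then show "l2norm m (\<lambda>x. f x + g x) \<le> l2norm m f + l2norm m g + e" by (simp add: A_def B_def)
qed

lemma l2norm_triangle_diff:
  assumes "f \<in> L2 m" "g \<in> L2 m" "h \<in> L2 m"
  shows "l2norm m (\<lambda>x. f x - h x) \<le> l2norm m (\<lambda>x. f x - g x) + l2norm m (\<lambda>x. g x - h x)"
  using l2norm_triangle[OF L2_diff[OF assms(1,2)] L2_diff[OF assms(2,3)]] by simp

lemma l2norm_diff_abs: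
  assumes "f \<in> L2 m" "g \<in> L2 m"
  shows "\<bar>l2norm m f - l2norm m g\<bar> \<le> l2norm m (\<lambda>x. f x - g x)"
  using l2norm_triangle[OF L2_diff[OF assms] assms(2)] l2norm_triangle[OF L2_diff[OF assms(2,1)] assms(1)]
  by (simp add: l2norm_minus_commute[of m g])

lemma l2norm_parallelogram:
  assumes "f \<in> L2 m" "g \<in> L2 m"
  shows "(l2norm m (\<lambda>x. f x + g x))\<^sup>2 + (l2norm m (\<lambda>x. f x - g x))\<^sup>2 = 2 * (l2norm m f)\<^sup>2 + 2 * (l2norm m g)\<^sup>2"
proof -
  have "(\<integral>x. (f x + g x)\<^sup>2 \<partial>m) + (\<integral>x. (f x - g x)\<^sup>2 \<partial>m) = (\<integral>x. (f x + g x)\<^sup>2 + (f x - g x)\<^sup>2 \<partial>m)"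
    using L2_add[OF assms] L2_diff[OF assms] by (simp add: L2_def)
  also have "\<dots> = (\<integral>x. 2 * (f x)\<^sup>2 + 2 * (g x)\<^sup>2 \<partial>m)"
    by (rule Bochner_Integration.integral_cong) (auto simp: power2_sum power2_diff)
  also have "\<dots> = 2 * (\<integral>x. (f x)\<^sup>2 \<partial>m) + 2 * (\<integral>x. (g x)\<^sup>2 \<partial>m)"
    using assms by (simp add: L2_def)
  finally show ?thesis by (simp add: l2norm_power2)
qed

lemma L2_tendsto_iff:
  "L2_tendsto m F f \<longleftrightarrow> (\<forall>n. F n \<in> L2 m) \<and> f \<in> L2 m \<and> (\<lambda>n. l2norm m (\<lambda>x. F n x - f x)) \<longlonglongrightarrow> 0"
proof -
  have "(\<lambda>n. \<integral>x. (F n x - f x)\<^sup>2 \<partial>m) \<longlonglongrightarrow> 0 \<longleftrightarrow> (\<lambda>n. l2norm m (\<lambda>x. F n x - f x)) \<longlonglongrightarrow> 0"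
  proof
    assume "(\<lambda>n. \<integral>x. (F n x - f x)\<^sup>2 \<partial>m) \<longlonglongrightarrow> 0"
    from tendsto_real_sqrt[OF this] show "(\<lambda>n. l2norm m (\<lambda>x. F n x - f x)) \<longlonglongrightarrow> 0" by (simp add: l2norm_def)
  next
    assume "(\<lambda>n. l2norm m (\<lambda>x. F n x - f x)) \<longlonglongrightarrow> 0"
    from tendsto_power[OF this, of 2] show "(\<lambda>n. \<integral>x. (F n x - f x)\<^sup>2 \<partial>m) \<longlonglongrightarrow> 0" by (simp add: l2norm_power2)
  qed
  then show ?thesis by (simp add: L2_tendsto_def)
qed

lemma L2_tendsto_AE_subseq:
  assumes "L2_tendsto m F f"
  obtains r :: "nat \<Rightarrow> nat" where "strict_mono r" "AE x in m. (\<lambda>n. F (r n) x) \<longlonglongrightarrow> f x"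
proof -
  have "integrable m (\<lambda>x. (F n x - f x)\<^sup>2)" for n
    using L2_diff[of "F n" m f] assms by (auto simp: L2_tendsto_def L2_def)
  then obtain r :: "nat \<Rightarrow> nat" where r: "strict_mono r" "AE x in m. (\<lambda>n. (F (r n) x - f x)\<^sup>2) \<longlonglongrightarrow> 0"
    using tendsto_L1_AE_subseq[of m "\<lambda>n x. (F n x - f x)\<^sup>2"] assms by (auto simp: L2_tendsto_def)
  have "AE x in m. (\<lambda>n. F (r n) x) \<longlonglongrightarrow> f x"
    using r(2)
  proof eventually_elim
    case (elim x)
    from tendsto_real_sqrt[OF this] have "(\<lambda>n. \<bar>F (r n) x - f x\<bar>) \<longlonglongrightarrow> 0" by simp
    then show ?case using LIM_zero_cancel tendsto_rabs_zero_iff by blast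
  qed
  with r(1) that show thesis by blast
qed

text \<open>Dominated convergence for squares; the dominating function is
  \<open>4 * (g x)\<^sup>2\<close> because the difference of two functions bounded by
  \<open>g\<close> is at most \<open>2 * g\<close>.\<close>

lemma L2_dominated:
  assumes F: "\<And>n. F n \<in> borel_measurable m" and f: "f \<in> borel_measurable m" and g: "g \<in> L2 m"
    and lim: "AE x in m. (\<lambda>n. F n x) \<longlonglongrightarrow> f x" and bd: "\<And>n. AE x in m. \<bar>F n x\<bar> \<le> g x"
  shows "L2_tendsto m F f"
proof -
  have bd': "AE x in m. \<bar>f x\<bar> \<le> g x"
  proof -
    have "AE x in m. \<forall>n. \<bar>F n x\<bar> \<le> g x" using bd by (simp add: AE_all_countable)
    with lim show ?thesis
    proof eventually_elim
      case (elim x)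
      then show ?case by (intro LIMSEQ_le_const2[OF tendsto_rabs[OF elim(1)]]) auto
    qed
  qed
  have FL: "F n \<in> L2 m" for n by (rule L2_bound[OF g F]) (use bd[of n] in eventually_elim, auto)
  have fL: "f \<in> L2 m" by (rule L2_bound[OF g f]) (use bd' in eventually_elim, auto)
  have "(\<lambda>n. \<integral>x. (F n x - f x)\<^sup>2 \<partial>m) \<longlonglongrightarrow> (\<integral>x. 0 \<partial>m)"
  proof (rule integral_dominated_convergence[where w = "\<lambda>x. 4 * (g x)\<^sup>2"])
    show "integrable m (\<lambda>x. 4 * (g x)\<^sup>2)" using g by (auto simp: L2_def)
    show "AE x in m. (\<lambda>n. (F n x - f x)\<^sup>2) \<longlonglongrightarrow> 0"
      using lim
    proof eventually_elim
      case (elim x)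
      from tendsto_power[OF LIM_zero[OF elim], of 2] show ?case by simp
    qed
    fix n
    show "AE x in m. norm ((F n x - f x)\<^sup>2) \<le> 4 * (g x)\<^sup>2"
      using bd[of n] bd'
    proof eventually_elim
      case (elim x)
      then have "\<bar>F n x - f x\<bar> \<le> 2 * g x" by linarith
      then have "(F n x - f x)\<^sup>2 \<le> (2 * g x)\<^sup>2" by (metis abs_le_square_iff abs_of_nonneg abs_ge_zero order_trans)
      then show ?case by (simp add: power_mult_distrib)
    qed
  qed (use F f in auto)
  then show ?thesis using FL fL by (simp add: L2_tendsto_def)
qed

lemma L2_tendsto_l2norm:
  assumes "L2_tendsto m F f"
  shows "(\<lambda>n. l2norm m (F n)) \<longlonglongrightarrow> l2norm m f"
proof (rule LIM_zero_cancel, rule Lim_null_comparison)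
  show "\<forall>\<^sub>F n in sequentially. norm (l2norm m (F n) - l2norm m f) \<le> l2norm m (\<lambda>x. F n x - f x)"
    using assms by (auto simp: L2_tendsto_iff intro!: always_eventually l2norm_diff_abs)
  show "(\<lambda>n. l2norm m (\<lambda>x. F n x - f x)) \<longlonglongrightarrow> 0" using assms by (simp add: L2_tendsto_iff)
qed

lemma L2_tendsto_add:
  assumes "L2_tendsto m F f" "L2_tendsto m G g"
  shows "L2_tendsto m (\<lambda>n x. F n x + G n x) (\<lambda>x. f x + g x)"
  unfolding L2_tendsto_iff
proof (intro conjI allI)
  have *: "F n \<in> L2 m" "G n \<in> L2 m" "f \<in> L2 m" "g \<in> L2 m" for n using assms by (auto simp: L2_tendsto_def)
  show "(\<lambda>x. F n x + G n x) \<in> L2 m" "(\<lambda>x. f x + g x) \<in> L2 m" for n using * by auto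
  show "(\<lambda>n. l2norm m (\<lambda>x. F n x + G n x - (f x + g x))) \<longlonglongrightarrow> 0"
  proof (rule Lim_null_comparison)
    have "l2norm m (\<lambda>x. F n x + G n x - (f x + g x)) \<le> l2norm m (\<lambda>x. F n x - f x) + l2norm m (\<lambda>x. G n x - g x)" for n
      using l2norm_triangle[OF L2_diff[OF *(1,3)] L2_diff[OF *(2,4)], of n n] by (simp add: algebra_simps)
    then show "\<forall>\<^sub>F n in sequentially. norm (l2norm m (\<lambda>x. F n x + G n x - (f x + g x)))
        \<le> l2norm m (\<lambda>x. F n x - f x) + l2norm m (\<lambda>x. G n x - g x)" by simp
    show "(\<lambda>n. l2norm m (\<lambda>x. F n x - f x) + l2norm m (\<lambda>x. G n x - g x)) \<longlonglongrightarrow> 0"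
      using assms by (intro tendsto_add_zero) (auto simp: L2_tendsto_iff)
  qed
qed

lemma L2_bounded_mult:
  assumes f: "f \<in> L2 m" and k: "k \<in> borel_measurable m" "\<And>x. x \<in> space m \<Longrightarrow> \<bar>k x\<bar> \<le> K"
  shows "(\<lambda>x. k x * f x) \<in> L2 m" "l2norm m (\<lambda>x. k x * f x) \<le> \<bar>K\<bar> * l2norm m f"
proof -
  have "AE x in m. \<bar>k x * f x\<bar> \<le> \<bar>K * f x\<bar>"
  proof (rule AE_I2)
    fix x assume "x \<in> space m"
    from k(2)[OF this] have "\<bar>k x\<bar> \<le> \<bar>K\<bar>" by linarith
    then show "\<bar>k x * f x\<bar> \<le> \<bar>K * f x\<bar>" by (simp add: abs_mult mult_right_mono)
  qed
  from L2_bound[OF L2_cmult[OF f, of K] _ this] k(1) L2_measurable[OF f]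
  show "(\<lambda>x. k x * f x) \<in> L2 m" "l2norm m (\<lambda>x. k x * f x) \<le> \<bar>K\<bar> * l2norm m f"
    by (auto simp: l2norm_cmult)
qed

lemma L2_tendsto_bounded_mult:
  assumes F: "L2_tendsto m F f" and k: "k \<in> borel_measurable m" "\<And>x. x \<in> space m \<Longrightarrow> \<bar>k x\<bar> \<le> K"
  shows "L2_tendsto m (\<lambda>n x. k x * F n x) (\<lambda>x. k x * f x)"
  unfolding L2_tendsto_iff
proof (intro conjI allI)
  have *: "F n \<in> L2 m" "f \<in> L2 m" for n using F by (auto simp: L2_tendsto_def)
  show "(\<lambda>x. k x * F n x) \<in> L2 m" "(\<lambda>x. k x * f x) \<in> L2 m" for n using L2_bounded_mult(1)[OF _ k] * by auto
  show "(\<lambda>n. l2norm m (\<lambda>x. k x * F n x - k x * f x)) \<longlonglongrightarrow> 0"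
  proof (rule Lim_null_comparison)
    show "\<forall>\<^sub>F n in sequentially. norm (l2norm m (\<lambda>x. k x * F n x - k x * f x)) \<le> \<bar>K\<bar> * l2norm m (\<lambda>x. F n x - f x)"
      using L2_bounded_mult(2)[OF L2_diff[OF *] k] by (simp add: right_diff_distrib)
    show "(\<lambda>n. \<bar>K\<bar> * l2norm m (\<lambda>x. F n x - f x)) \<longlonglongrightarrow> 0"
      using F tendsto_mult_right_zero by (auto simp: L2_tendsto_iff)
  qed
qed

lemma L2_tendsto_cmult: "L2_tendsto m F f \<Longrightarrow> L2_tendsto m (\<lambda>n x. c * F n x) (\<lambda>x. c * f x)"
  by (rule L2_tendsto_bounded_mult) auto

lemma L2_tendsto_abs:
  assumes F: "L2_tendsto m F f"
  shows "L2_tendsto m (\<lambda>n x. \<bar>F n x\<bar>) (\<lambda>x. \<bar>f x\<bar>)"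
  unfolding L2_tendsto_iff
proof (intro conjI allI)
  have *: "F n \<in> L2 m" "f \<in> L2 m" for n using F by (auto simp: L2_tendsto_def)
  then show **: "(\<lambda>x. \<bar>F n x\<bar>) \<in> L2 m" "(\<lambda>x. \<bar>f x\<bar>) \<in> L2 m" for n by auto
  show "(\<lambda>n. l2norm m (\<lambda>x. \<bar>F n x\<bar> - \<bar>f x\<bar>)) \<longlonglongrightarrow> 0"
  proof (rule Lim_null_comparison)
    have "l2norm m (\<lambda>x. \<bar>F n x\<bar> - \<bar>f x\<bar>) \<le> l2norm m (\<lambda>x. F n x - f x)" for n
      by (rule L2_bound(2)[OF L2_diff[OF *]]) (use L2_measurable[OF L2_diff[OF **]] in \<open>auto intro!: AE_I2\<close>)
    then show "\<forall>\<^sub>F n in sequentially. norm (l2norm m (\<lambda>x. \<bar>F n x\<bar> - \<bar>f x\<bar>)) \<le> l2norm m (\<lambda>x. F n x - f x)" by simp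
  qed (use F in \<open>simp add: L2_tendsto_iff\<close>)
qed

lemma L2_tendsto_cong:
  assumes "L2_tendsto m F f" "\<And>n x. x \<in> space m \<Longrightarrow> F n x = G n x" "\<And>x. x \<in> space m \<Longrightarrow> f x = g x"
  shows "L2_tendsto m G g"
proof -
  have "F n \<in> L2 m \<longleftrightarrow> G n \<in> L2 m" for n
    unfolding L2_def using assms(2) by (simp cong: measurable_cong Bochner_Integration.integrable_cong)
  moreover have "f \<in> L2 m \<longleftrightarrow> g \<in> L2 m"
    unfolding L2_def using assms(3) by (simp cong: measurable_cong Bochner_Integration.integrable_cong)
  moreover have "(\<integral>x. (F n x - f x)\<^sup>2 \<partial>m) = (\<integral>x. (G n x - g x)\<^sup>2 \<partial>m)" for n
    by (rule Bochner_Integration.integral_cong) (use assms in auto)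
  ultimately show ?thesis using assms(1) by (simp add: L2_tendsto_def)
qed

text \<open>Riesz-Fischer: a fast Cauchy subsequence converges almost everywhere because the sum of
  its increments is square integrable, and Fatou's lemma upgrades this to norm convergence of the
  whole sequence.\<close>

lemma L2_complete:
  assumes F: "\<And>n. F n \<in> L2 m"
    and Cauchy: "\<And>e. e > 0 \<Longrightarrow> \<exists>N. \<forall>i\<ge>N. \<forall>j\<ge>N. l2norm m (\<lambda>x. F i x - F j x) < e"
  obtains f where "L2_tendsto m F f"
proof -
  have Fm: "F n \<in> borel_measurable m" for n using F[of n] by (simp add: L2_def)
  have "\<exists>N. \<forall>i\<ge>N. \<forall>j\<ge>N. l2norm m (\<lambda>x. F i x - F j x) < (1/2)^n" for n :: nat
    by (rule Cauchy) simp
  then obtain N where N: "\<And>n i j. i \<ge> N n \<Longrightarrow> j \<ge> N n \<Longrightarrow> l2norm m (\<lambda>x. F i x - F j x) < (1/2)^n"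
    by metis
  \<comment> \<open>The maximum makes \<open>r k\<close> admissible for every threshold
    \<open>N n\<close> with \<open>n \<le> k\<close>, so consecutive terms can be compared; the
    summand \<open>n\<close> gives \<open>r n \<ge> n\<close>, used when Fatou's lemma is applied
    along \<open>r\<close>.\<close>
  define r where "r n = Max (N ` {..n}) + n" for n
  have rN: "r k \<ge> N n" if "n \<le> k" for n k
  proof -
    have "N n \<le> Max (N ` {..k})" using that by (intro Max_ge) auto
    then show ?thesis by (simp add: r_def)
  qed
  define D where "D n x = \<bar>F (r (Suc n)) x - F (r n) x\<bar>" for n x
  have DL: "D n \<in> L2 m" for n unfolding D_def[abs_def] by (intro L2_abs L2_diff F)
  have Dn: "l2norm m (D n) \<le> (1/2)^n" for n
    using N[of n "r (Suc n)" "r n"] rN[of n n] rN[of n "Suc n"] by (simp add: D_def[abs_def])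
  define S where "S n x = (\<Sum>k<n. D k x)" for n x
  \<comment> \<open>The exact geometric sum is carried along, since the mere bound 2 would not
    survive the induction.\<close>
  have SL: "S n \<in> L2 m \<and> l2norm m (S n) \<le> 2 - 2 * (1/2)^n" for n
  proof (induction n)
    case (Suc n)
    have eq: "S (Suc n) = (\<lambda>x. S n x + D n x)" by (auto simp: S_def)
    show ?case unfolding eq
      using Suc DL[of n] Dn[of n] l2norm_triangle[of "S n" m "D n"] by auto
  qed (simp add: S_def[abs_def])
  have Smono: "S n x \<le> S (Suc n) x" for n x by (simp add: S_def D_def)
  have S0: "0 \<le> S n x" for n x by (auto simp: S_def D_def intro!: sum_nonneg)
  have "(\<integral>\<^sup>+x. (SUP n. ennreal ((S n x)\<^sup>2)) \<partial>m) = (SUP n. \<integral>\<^sup>+x. ennreal ((S n x)\<^sup>2) \<partial>m)"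
  proof (rule nn_integral_monotone_convergence_SUP)
    show "incseq (\<lambda>n x. ennreal ((S n x)\<^sup>2))"
      by (rule incseq_SucI) (auto simp: le_fun_def intro!: ennreal_leI power_mono Smono S0)
    show "(\<lambda>x. ennreal ((S n x)\<^sup>2)) \<in> borel_measurable m" for n
      using SL[of n] by (auto simp: L2_def)
  qed
  also have "\<dots> \<le> 4"
  proof (rule SUP_least)
    fix n
    have "(\<integral>\<^sup>+x. ennreal ((S n x)\<^sup>2) \<partial>m) = ennreal ((l2norm m (S n))\<^sup>2)"
      using SL[of n] unfolding l2norm_power2 by (intro nn_integral_eq_integral) (auto simp: L2_def)
    also have "\<dots> \<le> ennreal (2\<^sup>2)"
      using SL[of n] by (intro ennreal_leI power_mono) (auto intro: order_trans)
    finally show "(\<integral>\<^sup>+x. ennreal ((S n x)\<^sup>2) \<partial>m) \<le> 4" by simp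
  qed
  finally have "(\<integral>\<^sup>+x. (SUP n. ennreal ((S n x)\<^sup>2)) \<partial>m) \<noteq> \<infinity>" by (auto simp: top_unique)
  moreover have "S n \<in> borel_measurable m" for n using SL[of n] by (auto simp: L2_def)
  ultimately have "AE x in m. (SUP n. ennreal ((S n x)\<^sup>2)) \<noteq> \<infinity>"
    by (intro nn_integral_PInf_AE borel_measurable_SUP) auto
  then have conv: "AE x in m. convergent (\<lambda>n. F (r n) x)"
  proof eventually_elim
    case (elim x)
    then obtain B where B: "(SUP n. ennreal ((S n x)\<^sup>2)) = ennreal B" "B \<ge> 0"
      by (cases "SUP n. ennreal ((S n x)\<^sup>2)") auto
    have "(S n x)\<^sup>2 \<le> B" for n
      using SUP_upper[of n UNIV "\<lambda>n. ennreal ((S n x)\<^sup>2)"] B by simp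
    then have "S n x \<le> sqrt B" for n using S0[of n x] by (simp add: real_le_rsqrt)
    then have "summable (\<lambda>n. D n x)"
      by (intro summableI_nonneg_bounded[of _ "sqrt B"]) (auto simp: D_def S_def)
    then have "summable (\<lambda>n. F (r (Suc n)) x - F (r n) x)"
      unfolding D_def by (rule summable_rabs_cancel)
    then have "convergent (\<lambda>n. F (r n) x - F (r 0) x)"
      by (simp add: summable_iff_convergent sum_lessThan_telescope[of "\<lambda>n. F (r n) x"])
    then show ?case by (simp add: convergent_diff_const_right_iff)
  qed
  \<comment> \<open>The default value 0 off the convergence set makes \<open>f\<close> a limit of
    measurable functions on a measurable set.\<close>
  define f where "f x = (if convergent (\<lambda>n. F (r n) x) then lim (\<lambda>n. F (r n) x) else 0)" for x
  have fm: "f \<in> borel_measurable m"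
  proof -
    have [measurable]: "F n \<in> borel_measurable m" for n using F[of n] by (simp add: L2_def)
    have "f = (\<lambda>x. if Cauchy (\<lambda>n. F (r n) x) then lim (\<lambda>n. F (r n) x) else 0)"
      by (simp add: f_def[abs_def] Cauchy_convergent_iff)
    then show ?thesis by simp
  qed
  have flim: "AE x in m. (\<lambda>n. F (r n) x) \<longlonglongrightarrow> f x"
    using conv by eventually_elim (auto simp: f_def convergent_LIMSEQ_iff)
  \<comment> \<open>Fatou's lemma along the subsequence; it is stated with nonnegative integrals
    because integrability of \<open>F i - f\<close> is only a consequence.\<close>
  have est: "(\<integral>\<^sup>+x. ennreal ((F i x - f x)\<^sup>2) \<partial>m) \<le> ennreal (e\<^sup>2)"
    if e: "e > 0" and K: "\<And>i j. i \<ge> K \<Longrightarrow> j \<ge> K \<Longrightarrow> l2norm m (\<lambda>x. F i x - F j x) < e" and i: "i \<ge> K" for e K i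
  proof -
    have "(\<integral>\<^sup>+x. ennreal ((F i x - f x)\<^sup>2) \<partial>m) = (\<integral>\<^sup>+x. liminf (\<lambda>n. ennreal ((F i x - F (r n) x)\<^sup>2)) \<partial>m)"
    proof (rule nn_integral_cong_AE, use flim in eventually_elim)
      case (elim x)
      have "(\<lambda>n. ennreal ((F i x - F (r n) x)\<^sup>2)) \<longlonglongrightarrow> ennreal ((F i x - f x)\<^sup>2)"
        by (intro tendsto_intros elim)
      from lim_imp_Liminf[OF sequentially_bot this] show ?case by (rule sym)
    qed
    also have "\<dots> \<le> liminf (\<lambda>n. \<integral>\<^sup>+x. ennreal ((F i x - F (r n) x)\<^sup>2) \<partial>m)"
      by (rule nn_integral_liminf) (use Fm in auto)
    also have "\<dots> \<le> limsup (\<lambda>n. \<integral>\<^sup>+x. ennreal ((F i x - F (r n) x)\<^sup>2) \<partial>m)"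
      by (rule Liminf_le_Limsup) simp
    also have "\<dots> \<le> ennreal (e\<^sup>2)"
    proof (rule Limsup_bounded)
      show "\<forall>\<^sub>F n in sequentially. (\<integral>\<^sup>+x. ennreal ((F i x - F (r n) x)\<^sup>2) \<partial>m) \<le> ennreal (e\<^sup>2)"
        using eventually_ge_at_top[of K]
      proof eventually_elim
        case (elim n)
        have "r n \<ge> K" using elim by (simp add: r_def)
        then have "l2norm m (\<lambda>x. F i x - F (r n) x) \<le> e" using K[OF i] by (simp add: less_imp_le)
        then have "(\<integral>x. (F i x - F (r n) x)\<^sup>2 \<partial>m) \<le> e\<^sup>2"
          unfolding l2norm_power2[symmetric] by (intro power_mono) auto
        moreover have "(\<integral>\<^sup>+x. ennreal ((F i x - F (r n) x)\<^sup>2) \<partial>m) = ennreal (\<integral>x. (F i x - F (r n) x)\<^sup>2 \<partial>m)"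
          using L2_diff[OF F F, of i "r n"] by (intro nn_integral_eq_integral) (auto simp: L2_def)
        ultimately show ?case by (simp add: ennreal_leI)
      qed
    qed
    finally show ?thesis .
  qed
  have FfL: "(\<lambda>x. F i x - f x) \<in> L2 m \<and> l2norm m (\<lambda>x. F i x - f x) \<le> e"
    if "e > 0" and "\<And>i j. i \<ge> K \<Longrightarrow> j \<ge> K \<Longrightarrow> l2norm m (\<lambda>x. F i x - F j x) < e" and "i \<ge> K" for e K i
  proof -
    have e: "(\<integral>\<^sup>+x. ennreal ((F i x - f x)\<^sup>2) \<partial>m) \<le> ennreal (e\<^sup>2)" by (rule est[OF that])
    have m: "(\<lambda>x. F i x - f x) \<in> borel_measurable m" using F[of i] fm by (auto simp: L2_def)
    have i: "integrable m (\<lambda>x. (F i x - f x)\<^sup>2)"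
      by (rule integrableI_nonneg) (use m e in \<open>auto simp: le_less_trans\<close>)
    have "ennreal (\<integral>x. (F i x - f x)\<^sup>2 \<partial>m) \<le> ennreal (e\<^sup>2)"
      using e nn_integral_eq_integral[OF i] by simp
    then have "(\<integral>x. (F i x - f x)\<^sup>2 \<partial>m) \<le> e\<^sup>2" by simp
    then have "l2norm m (\<lambda>x. F i x - f x) \<le> e"
      unfolding l2norm_def using \<open>e > 0\<close> by (simp add: real_le_lsqrt)
    with m i show ?thesis by (simp add: L2_def)
  qed
  have fL: "f \<in> L2 m"
  proof -
    obtain K where "\<And>i j. i \<ge> K \<Longrightarrow> j \<ge> K \<Longrightarrow> l2norm m (\<lambda>x. F i x - F j x) < 1" using Cauchy[of 1] by auto
    from FfL[OF _ this, of K] have "(\<lambda>x. F K x - f x) \<in> L2 m" by auto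
    from L2_diff[OF F[of K] this] show ?thesis by simp
  qed
  have "(\<lambda>n. l2norm m (\<lambda>x. F n x - f x)) \<longlonglongrightarrow> 0"
  proof (rule LIMSEQ_I)
    fix e :: real assume e: "e > 0"
    obtain K where K: "\<And>i j. i \<ge> K \<Longrightarrow> j \<ge> K \<Longrightarrow> l2norm m (\<lambda>x. F i x - F j x) < e / 2"
      using Cauchy[of "e / 2"] e by auto
    show "\<exists>no. \<forall>n\<ge>no. norm (l2norm m (\<lambda>x. F n x - f x) - 0) < e"
    proof (intro exI allI impI)
      fix n assume "n \<ge> K"
      with FfL[OF _ K, of n] e have "l2norm m (\<lambda>x. F n x - f x) \<le> e / 2" by auto
      then show "norm (l2norm m (\<lambda>x. F n x - f x) - 0) < e" using e by simp
    qed
  qed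
  with F fL that show thesis by (auto simp: L2_tendsto_iff)
qed

lemma L2_tendsto_subseq:
  assumes "L2_tendsto m F f" "strict_mono r"
  shows "L2_tendsto m (\<lambda>n. F (r n)) f"
  using assms LIMSEQ_subseq_LIMSEQ[of "\<lambda>n. \<integral>x. (F n x - f x)\<^sup>2 \<partial>m" 0 r]
  by (auto simp: L2_tendsto_def comp_def)

lemma nonexpansive_measurable:
  fixes \<psi> :: "real \<Rightarrow> real"
  assumes "\<And>s t. \<bar>\<psi> s - \<psi> t\<bar> \<le> \<bar>s - t\<bar>"
  shows "\<psi> \<in> borel_measurable borel"
proof (rule borel_measurable_continuous_onI)
  show "continuous_on UNIV \<psi>"
    unfolding continuous_on_iff dist_real_def using assms by (meson le_less_trans)
qed

lemma L2_nonexpansive: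
  fixes \<psi> :: "real \<Rightarrow> real"
  assumes \<psi>: "\<And>s t. \<bar>\<psi> s - \<psi> t\<bar> \<le> \<bar>s - t\<bar>" "\<psi> 0 = 0" and f: "f \<in> L2 m"
  shows "(\<lambda>x. \<psi> (f x)) \<in> L2 m"
proof (rule L2_bound(1)[OF f])
  show "(\<lambda>x. \<psi> (f x)) \<in> borel_measurable m"
    using measurable_compose[OF L2_measurable[OF f] nonexpansive_measurable[OF \<psi>(1)]] .
  have "\<bar>\<psi> (f x)\<bar> \<le> \<bar>f x\<bar>" for x using \<psi>(1)[of "f x" 0] \<psi>(2) by simp
  then show "AE x in m. \<bar>\<psi> (f x)\<bar> \<le> \<bar>f x\<bar>" by (rule AE_I2)
qed

lemma L2_tendsto_nonexpansive:
  fixes \<psi> :: "real \<Rightarrow> real"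
  assumes \<psi>: "\<And>s t. \<bar>\<psi> s - \<psi> t\<bar> \<le> \<bar>s - t\<bar>" "\<psi> 0 = 0" and F: "L2_tendsto m F f"
  shows "L2_tendsto m (\<lambda>n x. \<psi> (F n x)) (\<lambda>x. \<psi> (f x))"
  unfolding L2_tendsto_iff
proof (intro conjI allI)
  have FL: "F n \<in> L2 m" "f \<in> L2 m" for n using F by (auto simp: L2_tendsto_def)
  show L: "(\<lambda>x. \<psi> (F n x)) \<in> L2 m" "(\<lambda>x. \<psi> (f x)) \<in> L2 m" for n
    by (rule L2_nonexpansive[OF \<psi> FL(1)], rule L2_nonexpansive[OF \<psi> FL(2)])
  show "(\<lambda>n. l2norm m (\<lambda>x. \<psi> (F n x) - \<psi> (f x))) \<longlonglongrightarrow> 0"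
  proof (rule Lim_null_comparison)
    have "l2norm m (\<lambda>x. \<psi> (F n x) - \<psi> (f x)) \<le> l2norm m (\<lambda>x. F n x - f x)" for n
      by (rule L2_bound(2)[OF L2_diff[OF FL] L2_measurable[OF L2_diff[OF L]] AE_I2]) (rule \<psi>(1))
    then show "\<forall>\<^sub>F n in sequentially. norm (l2norm m (\<lambda>x. \<psi> (F n x) - \<psi> (f x))) \<le> l2norm m (\<lambda>x. F n x - f x)"
      by simp
    show "(\<lambda>n. l2norm m (\<lambda>x. F n x - f x)) \<longlonglongrightarrow> 0" using F by (simp add: L2_tendsto_iff)
  qed
qed

section \<open>Local slopes and relaxed gradients\<close>

abbreviation Lip :: "'a metric \<Rightarrow> ('a \<Rightarrow> real) \<Rightarrow> bool" where
  "Lip M \<equiv> Lipschitz_continuous_map M euclidean_metric"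

lemma Lip_iff: "Lip M f \<longleftrightarrow> (\<exists>B. \<forall>x\<in>mspace M. \<forall>y\<in>mspace M. \<bar>f x - f y\<bar> \<le> B * mdist M x y)"
  by (simp add: Lipschitz_continuous_map_def dist_real_def)

lemma LipI: "(\<And>x y. x \<in> mspace M \<Longrightarrow> y \<in> mspace M \<Longrightarrow> \<bar>f x - f y\<bar> \<le> B * mdist M x y) \<Longrightarrow> Lip M f"
  unfolding Lip_iff by blast

lemma LipE:
  assumes "Lip M f"
  obtains B where "B > 0" "\<And>x y. x \<in> mspace M \<Longrightarrow> y \<in> mspace M \<Longrightarrow> \<bar>f x - f y\<bar> \<le> B * mdist M x y"
  using assms by (auto simp: Lipschitz_continuous_map_pos dist_real_def)

lemma Lip_const [simp]: "Lip M (\<lambda>x. c)" by (rule LipI[of _ _ 0]) simp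

lemma Lip_cmult:
  assumes "Lip M f" shows "Lip M (\<lambda>x. c * f x)"
proof -
  obtain B where B: "B > 0" "\<And>x y. x \<in> mspace M \<Longrightarrow> y \<in> mspace M \<Longrightarrow> \<bar>f x - f y\<bar> \<le> B * mdist M x y"
    using assms by (rule LipE) blast
  show ?thesis
  proof (rule LipI)
    fix x y assume "x \<in> mspace M" "y \<in> mspace M"
    from mult_left_mono[OF B(2)[OF this], of "\<bar>c\<bar>"]
    show "\<bar>c * f x - c * f y\<bar> \<le> (\<bar>c\<bar> * B) * mdist M x y"
      by (simp add: abs_mult[symmetric] right_diff_distrib mult.assoc)
  qed
qed

lemma Lip_add:
  assumes "Lip M f" "Lip M g" shows "Lip M (\<lambda>x. f x + g x)"
proof -
  obtain B where B: "B > 0" "\<And>x y. x \<in> mspace M \<Longrightarrow> y \<in> mspace M \<Longrightarrow> \<bar>f x - f y\<bar> \<le> B * mdist M x y"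
    using assms(1) by (rule LipE) blast
  obtain C where C: "C > 0" "\<And>x y. x \<in> mspace M \<Longrightarrow> y \<in> mspace M \<Longrightarrow> \<bar>g x - g y\<bar> \<le> C * mdist M x y"
    using assms(2) by (rule LipE) blast
  show ?thesis
  proof (rule LipI)
    fix x y assume "x \<in> mspace M" "y \<in> mspace M"
    from B(2)[OF this] C(2)[OF this]
    show "\<bar>f x + g x - (f y + g y)\<bar> \<le> (B + C) * mdist M x y" by (simp add: distrib_right)
  qed
qed

lemma Lip_compose:
  assumes f: "Lip M f" and \<psi>: "\<And>s t. \<bar>\<psi> s - \<psi> t\<bar> \<le> \<bar>s - t\<bar>"
  shows "Lip M (\<lambda>x. \<psi> (f x) :: real)"
  using f \<psi> unfolding Lip_iff by (meson order_trans)

lemma Lip_mult: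
  assumes f: "Lip M f" "\<And>x. x \<in> mspace M \<Longrightarrow> \<bar>f x\<bar> \<le> K" and g: "Lip M g" "\<And>x. x \<in> mspace M \<Longrightarrow> \<bar>g x\<bar> \<le> K'"
  shows "Lip M (\<lambda>x. f x * g x)"
proof -
  obtain B where B: "B > 0" "\<And>x y. x \<in> mspace M \<Longrightarrow> y \<in> mspace M \<Longrightarrow> \<bar>f x - f y\<bar> \<le> B * mdist M x y"
    using f(1) by (rule LipE) blast
  obtain C where C: "C > 0" "\<And>x y. x \<in> mspace M \<Longrightarrow> y \<in> mspace M \<Longrightarrow> \<bar>g x - g y\<bar> \<le> C * mdist M x y"
    using g(1) by (rule LipE) blast
  show ?thesis
  proof (rule LipI)
    fix x y assume xy: "x \<in> mspace M" "y \<in> mspace M"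
    have "f x * g x - f y * g y = f x * (g x - g y) + g y * (f x - f y)" by (simp add: algebra_simps)
    then have "\<bar>f x * g x - f y * g y\<bar> \<le> \<bar>f x\<bar> * \<bar>g x - g y\<bar> + \<bar>g y\<bar> * \<bar>f x - f y\<bar>"
      by (metis abs_mult abs_triangle_ineq)
    also have "\<dots> \<le> K * (C * mdist M x y) + K' * (B * mdist M x y)"
    proof -
      have "0 \<le> K" "0 \<le> K'" using f(2)[OF xy(1)] g(2)[OF xy(2)] by linarith+
      then show ?thesis using f(2)[OF xy(1)] g(2)[OF xy(2)] B(2)[OF xy] C(2)[OF xy] by (intro add_mono mult_mono) auto
    qed
    finally show "\<bar>f x * g x - f y * g y\<bar> \<le> (K * C + K' * B) * mdist M x y" by (simp add: algebra_simps)
  qed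
qed

lemma eventually_atin_mtopology_of:
  assumes "x \<in> mspace M"
  shows "eventually P (atin (mtopology_of M) x) \<longleftrightarrow>
     (\<exists>r>0. \<forall>y\<in>mspace M. 0 < mdist M x y \<and> mdist M x y < r \<longrightarrow> P y)"
proof -
  have "mdist M y x = mdist M x y" for y by (rule mdist_commute)
  then show ?thesis
    unfolding mtopology_of_def Metric_space.eventually_atin_metric[OF Metric_space_mspace_mdist]
    using assms by (simp only: Ball_def) blast
qed

lemma openin_mtopology_of_iff:
  "openin (mtopology_of N) U \<longleftrightarrow> U \<subseteq> mspace N \<and> (\<forall>x\<in>U. \<exists>r>0. \<forall>y\<in>mspace N. mdist N x y < r \<longrightarrow> y \<in> U)"
proof -
  have "mball_of N x r \<subseteq> U \<longleftrightarrow> (\<forall>y\<in>mspace N. mdist N x y < r \<longrightarrow> y \<in> U)" if "x \<in> mspace N" for x r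
    using that by auto
  then show ?thesis
    by (auto simp: mtopology_of_def Metric_space.openin_mtopology[OF Metric_space_mspace_mdist] mball_of_def subset_iff)
qed

lemma atin_mtopology_of_nontrivial:
  assumes "x \<in> mspace M" "\<not> openin (mtopology_of M) {x}"
  shows "atin (mtopology_of M) x \<noteq> bot"
proof
  assume "atin (mtopology_of M) x = bot"
  then obtain r where r: "r > 0" "\<forall>y\<in>mspace M. \<not> (0 < mdist M x y \<and> mdist M x y < r)"
    using eventually_atin_mtopology_of[OF assms(1), of "\<lambda>_. False"] by auto
  have "y = x" if "y \<in> mspace M" "mdist M x y < r" for y
    using r(2) that mdist_zero[of x M y] assms(1) mdist_nonneg[of M x y] by (auto simp: less_le)
  then have "openin (mtopology_of M) {x}"
    unfolding openin_mtopology_of_iff using r(1) assms(1) by auto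
  with assms(2) show False by contradiction
qed

lemma local_lip_nonneg:
  assumes "x \<in> mspace M" shows "0 \<le> local_lip M f x"
proof (cases "openin (mtopology_of M) {x}")
  case False
  have "0 \<le> Limsup (atin (mtopology_of M) x) (\<lambda>y. ereal (\<bar>f y - f x\<bar> / mdist M x y))"
    by (rule le_Limsup) (use atin_mtopology_of_nontrivial[OF assms False] in auto)
  then show ?thesis using False by (simp add: local_lip_def real_of_ereal_pos)
qed (simp add: local_lip_def)

text \<open>At an isolated point the slope is 0 by definition, and there \<open>0 \<le> K\<close> is
  what gives the bound.\<close>

lemma local_lip_le:
  assumes x: "x \<in> mspace M" and K: "0 \<le> K" and r: "r > 0"
    and le: "\<And>y. y \<in> mspace M \<Longrightarrow> mdist M x y < r \<Longrightarrow> \<bar>f y - f x\<bar> \<le> K * mdist M x y"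
  shows "local_lip M f x \<le> K"
proof (cases "openin (mtopology_of M) {x}")
  case False
  let ?L = "Limsup (atin (mtopology_of M) x) (\<lambda>y. ereal (\<bar>f y - f x\<bar> / mdist M x y))"
  have "?L \<le> ereal K"
  proof (rule Limsup_bounded)
    show "\<forall>\<^sub>F y in atin (mtopology_of M) x. ereal (\<bar>f y - f x\<bar> / mdist M x y) \<le> ereal K"
      unfolding eventually_atin_mtopology_of[OF x]
      using r le by (intro exI[of _ r]) (auto simp: divide_le_eq)
  qed
  moreover have "0 \<le> ?L"
    by (rule le_Limsup) (use atin_mtopology_of_nontrivial[OF x False] in auto)
  ultimately show ?thesis using False by (cases ?L) (auto simp: local_lip_def)
qed (simp add: local_lip_def K)

text \<open>Converse of \<open>local_lip_le\<close>. The Lipschitz hypothesis keeps the upper limit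
  finite: an infinite one would be turned into 0 by \<open>real_of_ereal\<close>, and a small slope
  would then carry no information.\<close>

lemma local_lip_less:
  assumes x: "x \<in> mspace M" and f: "Lip M f" and K: "local_lip M f x < K"
  obtains r where "r > 0" "\<And>y. y \<in> mspace M \<Longrightarrow> mdist M x y < r \<Longrightarrow> \<bar>f y - f x\<bar> \<le> K * mdist M x y"
proof (cases "openin (mtopology_of M) {x}")
  case True
  then obtain r where r: "r > 0" "\<forall>y\<in>mspace M. mdist M x y < r \<longrightarrow> y = x"
    unfolding openin_mtopology_of_iff by auto
  have "mdist M x x = 0" using x by simp
  have "\<bar>f y - f x\<bar> \<le> K * mdist M x y" if "y \<in> mspace M" "mdist M x y < r" for y
  proof -
    have "y = x" using r(2) that by blast
    then show ?thesis using \<open>mdist M x x = 0\<close> by simp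
  qed
  with r(1) that show thesis by blast
next
  case False
  obtain B where B: "B > 0" "\<And>y z. y \<in> mspace M \<Longrightarrow> z \<in> mspace M \<Longrightarrow> \<bar>f y - f z\<bar> \<le> B * mdist M y z"
    using f by (rule LipE) blast
  let ?L = "Limsup (atin (mtopology_of M) x) (\<lambda>y. ereal (\<bar>f y - f x\<bar> / mdist M x y))"
  have "0 \<le> ?L"
    by (rule le_Limsup) (use atin_mtopology_of_nontrivial[OF x False] in auto)
  moreover have "?L \<le> ereal B"
  proof (rule Limsup_bounded)
    show "\<forall>\<^sub>F y in atin (mtopology_of M) x. ereal (\<bar>f y - f x\<bar> / mdist M x y) \<le> ereal B"
      unfolding eventually_atin_mtopology_of[OF x]
      using B x by (intro exI[of _ 1]) (auto simp: divide_le_eq mdist_commute)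
  qed
  ultimately have "?L < ereal K" using K False by (cases ?L) (auto simp: local_lip_def)
  from Limsup_lessD[OF this] obtain r where r: "r > 0"
    "\<And>y. y \<in> mspace M \<Longrightarrow> 0 < mdist M x y \<Longrightarrow> mdist M x y < r \<Longrightarrow> \<bar>f y - f x\<bar> / mdist M x y < K"
    unfolding eventually_atin_mtopology_of[OF x] by auto
  show thesis
  proof (rule that[OF r(1)])
    fix y assume y: "y \<in> mspace M" "mdist M x y < r"
    show "\<bar>f y - f x\<bar> \<le> K * mdist M x y"
    proof (cases "y = x")
      case True
      have "mdist M x x = 0" using x by simp
      then show ?thesis using True by simp
    next
      case False
      then have "0 < mdist M x y" using mdist_zero[OF x y(1)] mdist_nonneg[of M x y] by (auto simp: less_le)
      then show ?thesis using r(2)[OF y(1) _ y(2)] by (simp add: divide_less_eq less_imp_le)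
    qed
  qed
qed

lemma local_lip_le_eps:
  assumes x: "x \<in> mspace M" and u: "0 \<le> u"
    and le: "\<And>e. e > 0 \<Longrightarrow> \<exists>r>0. \<forall>y\<in>mspace M. mdist M x y < r \<longrightarrow> \<bar>f y - f x\<bar> \<le> (u + e) * mdist M x y"
  shows "local_lip M f x \<le> u"
proof (rule field_le_epsilon)
  fix e :: real assume e: "e > 0"
  then obtain r where "r > 0" "\<forall>y\<in>mspace M. mdist M x y < r \<longrightarrow> \<bar>f y - f x\<bar> \<le> (u + e) * mdist M x y" using le by blast
  then show "local_lip M f x \<le> u + e" using u e by (intro local_lip_le[OF x]) auto
qed

lemma local_lip_compose_le:
  assumes x: "x \<in> mspace M" and f: "Lip M f" and \<psi>: "\<And>s t. \<bar>\<psi> s - \<psi> t\<bar> \<le> \<bar>s - t\<bar>"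
  shows "local_lip M (\<lambda>x. \<psi> (f x)) x \<le> local_lip M f x"
proof (rule local_lip_le_eps[OF x local_lip_nonneg[OF x]])
  fix e :: real assume "e > 0"
  then obtain r where "r > 0" "\<And>y. y \<in> mspace M \<Longrightarrow> mdist M x y < r \<Longrightarrow> \<bar>f y - f x\<bar> \<le> (local_lip M f x + e) * mdist M x y"
    using local_lip_less[OF x f, of "local_lip M f x + e"] by auto
  then show "\<exists>r>0. \<forall>y\<in>mspace M. mdist M x y < r \<longrightarrow> \<bar>\<psi> (f y) - \<psi> (f x)\<bar> \<le> (local_lip M f x + e) * mdist M x y"
    using \<psi> by (meson order_trans)
qed

lemma local_lip_cmult_le:
  assumes x: "x \<in> mspace M" and f: "Lip M f"
  shows "local_lip M (\<lambda>x. c * f x) x \<le> \<bar>c\<bar> * local_lip M f x"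
proof (rule local_lip_le_eps[OF x])
  show "0 \<le> \<bar>c\<bar> * local_lip M f x" using local_lip_nonneg[OF x] by simp
  fix e :: real assume e: "e > 0"
  define d where "d = e / (\<bar>c\<bar> + 1)"
  have d: "d > 0" "\<bar>c\<bar> * d \<le> e" using e by (auto simp: d_def field_simps)
  obtain r where r: "r > 0" "\<And>y. y \<in> mspace M \<Longrightarrow> mdist M x y < r \<Longrightarrow> \<bar>f y - f x\<bar> \<le> (local_lip M f x + d) * mdist M x y"
    using local_lip_less[OF x f, of "local_lip M f x + d"] d by auto
  have "\<bar>c * f y - c * f x\<bar> \<le> (\<bar>c\<bar> * local_lip M f x + e) * mdist M x y" if "y \<in> mspace M" "mdist M x y < r" for y
  proof -
    have "\<bar>c * f y - c * f x\<bar> = \<bar>c\<bar> * \<bar>f y - f x\<bar>" by (simp add: abs_mult[symmetric] right_diff_distrib)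
    also have "\<dots> \<le> \<bar>c\<bar> * ((local_lip M f x + d) * mdist M x y)" by (rule mult_left_mono[OF r(2)[OF that]]) simp
    also have "\<dots> = (\<bar>c\<bar> * local_lip M f x + \<bar>c\<bar> * d) * mdist M x y" by (simp add: algebra_simps)
    also have "\<dots> \<le> (\<bar>c\<bar> * local_lip M f x + e) * mdist M x y" using d by (intro mult_right_mono) auto
    finally show ?thesis .
  qed
  then show "\<exists>r>0. \<forall>y\<in>mspace M. mdist M x y < r \<longrightarrow> \<bar>c * f y - c * f x\<bar> \<le> (\<bar>c\<bar> * local_lip M f x + e) * mdist M x y"
    using r(1) by blast
qed

lemma local_lip_add_le:
  assumes x: "x \<in> mspace M" and f: "Lip M f" and g: "Lip M g"
  shows "local_lip M (\<lambda>x. f x + g x) x \<le> local_lip M f x + local_lip M g x"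
proof (rule local_lip_le_eps[OF x])
  show "0 \<le> local_lip M f x + local_lip M g x" using local_lip_nonneg[OF x, of f] local_lip_nonneg[OF x, of g] by simp
  fix e :: real assume e: "e > 0"
  obtain r where r: "r > 0" "\<And>y. y \<in> mspace M \<Longrightarrow> mdist M x y < r \<Longrightarrow> \<bar>f y - f x\<bar> \<le> (local_lip M f x + e/2) * mdist M x y"
    using local_lip_less[OF x f, of "local_lip M f x + e/2"] e by auto
  obtain s where s: "s > 0" "\<And>y. y \<in> mspace M \<Longrightarrow> mdist M x y < s \<Longrightarrow> \<bar>g y - g x\<bar> \<le> (local_lip M g x + e/2) * mdist M x y"
    using local_lip_less[OF x g, of "local_lip M g x + e/2"] e by auto
  have "\<bar>f y + g y - (f x + g x)\<bar> \<le> (local_lip M f x + local_lip M g x + e) * mdist M x y"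
    if "y \<in> mspace M" "mdist M x y < min r s" for y
    using r(2)[of y] s(2)[of y] that by (simp add: algebra_simps)
  then show "\<exists>r>0. \<forall>y\<in>mspace M. mdist M x y < r \<longrightarrow> \<bar>f y + g y - (f x + g x)\<bar> \<le> (local_lip M f x + local_lip M g x + e) * mdist M x y"
    using r(1) s(1) by (intro exI[of _ "min r s"]) auto
qed

text \<open>The increment splits into \<open>\<eta> y * (f y - f x)\<close>,
  \<open>(1 - \<eta> y) * (g y - g x)\<close> and
  \<open>(\<eta> y - \<eta> x) * (f x - g x)\<close>. The last part is the price of the cutoff; it
  sees only the distance between \<open>f\<close> and \<open>g\<close>, which vanishes in the limit
  when both approximate the same function.\<close>

lemma local_lip_convex_le:
  assumes x: "x \<in> mspace M" and f: "Lip M f" and g: "Lip M g"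
    and \<eta>: "\<And>y. y \<in> mspace M \<Longrightarrow> 0 \<le> \<eta> y" "\<And>y. y \<in> mspace M \<Longrightarrow> \<eta> y \<le> 1"
    and L: "\<And>y z. y \<in> mspace M \<Longrightarrow> z \<in> mspace M \<Longrightarrow> \<bar>\<eta> y - \<eta> z\<bar> \<le> L * mdist M y z" "L > 0"
  shows "local_lip M (\<lambda>x. \<eta> x * f x + (1 - \<eta> x) * g x) x
    \<le> \<eta> x * local_lip M f x + (1 - \<eta> x) * local_lip M g x + L * \<bar>f x - g x\<bar>"
proof (rule local_lip_le_eps[OF x])
  let ?a = "local_lip M f x" and ?b = "local_lip M g x"
  have ab: "0 \<le> ?a" "0 \<le> ?b" using local_lip_nonneg[OF x] by auto
  show "0 \<le> \<eta> x * ?a + (1 - \<eta> x) * ?b + L * \<bar>f x - g x\<bar>" using ab \<eta>[OF x] L(2) by auto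
  fix e :: real assume e: "e > 0"
  obtain r where r: "r > 0" "\<And>y. y \<in> mspace M \<Longrightarrow> mdist M x y < r \<Longrightarrow> \<bar>f y - f x\<bar> \<le> (?a + e/4) * mdist M x y"
    using local_lip_less[OF x f, of "?a + e/4"] e by auto
  obtain s where s: "s > 0" "\<And>y. y \<in> mspace M \<Longrightarrow> mdist M x y < s \<Longrightarrow> \<bar>g y - g x\<bar> \<le> (?b + e/4) * mdist M x y"
    using local_lip_less[OF x g, of "?b + e/4"] e by auto
  \<comment> \<open>Within radius \<open>t\<close> the weights \<eta> vary by at most
    \<open>L * t\<close>, so replacing \<open>\<eta> y\<close> by \<open>\<eta> x\<close> costs at
    most \<open>e / 2\<close>; the \<open>+ 1\<close> keeps the denominator positive when both
    slopes vanish.\<close>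
  define t where "t = e / (2 * (L * (?a + ?b + 1)))"
  have t: "t > 0" using e L(2) ab unfolding t_def by (intro divide_pos_pos mult_pos_pos) auto
  have "\<bar>(\<eta> y * f y + (1 - \<eta> y) * g y) - (\<eta> x * f x + (1 - \<eta> x) * g x)\<bar>
      \<le> (\<eta> x * ?a + (1 - \<eta> x) * ?b + L * \<bar>f x - g x\<bar> + e) * mdist M x y"
    if y: "y \<in> mspace M" "mdist M x y < min (min r s) t" for y
  proof -
    let ?d = "mdist M x y"
    have c: "\<bar>\<eta> y - \<eta> x\<bar> \<le> L * ?d" using L(1)[OF x y(1)] by (simp add: abs_minus_commute)
    have "(\<eta> y * f y + (1 - \<eta> y) * g y) - (\<eta> x * f x + (1 - \<eta> x) * g x)
       = \<eta> y * (f y - f x) + (1 - \<eta> y) * (g y - g x) + (\<eta> y - \<eta> x) * (f x - g x)"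
      by (simp add: algebra_simps)
    also have "\<bar>\<dots>\<bar> \<le> \<bar>\<eta> y * (f y - f x)\<bar> + \<bar>(1 - \<eta> y) * (g y - g x)\<bar> + \<bar>(\<eta> y - \<eta> x) * (f x - g x)\<bar>"
      by linarith
    also have "\<dots> = \<eta> y * \<bar>f y - f x\<bar> + (1 - \<eta> y) * \<bar>g y - g x\<bar> + \<bar>\<eta> y - \<eta> x\<bar> * \<bar>f x - g x\<bar>"
      using \<eta>[OF y(1)] by (simp add: abs_mult)
    also have "\<dots> \<le> \<eta> y * ((?a + e/4) * ?d) + (1 - \<eta> y) * ((?b + e/4) * ?d) + (L * ?d) * \<bar>f x - g x\<bar>"
      using \<eta>[OF y(1)] r(2)[of y] s(2)[of y] y c by (intro add_mono mult_left_mono mult_right_mono) auto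
    also have "\<dots> = (\<eta> y * ?a + (1 - \<eta> y) * ?b + e/4 + L * \<bar>f x - g x\<bar>) * ?d"
      by (simp add: field_simps)
    also have "\<dots> \<le> (\<eta> x * ?a + (1 - \<eta> x) * ?b + L * \<bar>f x - g x\<bar> + e) * ?d"
    proof (rule mult_right_mono)
      have "\<eta> y * ?a + (1 - \<eta> y) * ?b - (\<eta> x * ?a + (1 - \<eta> x) * ?b) = (\<eta> y - \<eta> x) * (?a - ?b)"
        by (simp add: algebra_simps)
      also have "\<dots> \<le> \<bar>\<eta> y - \<eta> x\<bar> * \<bar>?a - ?b\<bar>" by (metis abs_ge_self abs_mult)
      also have "\<dots> \<le> (L * t) * (?a + ?b + 1)"
      proof (rule mult_mono)
        show "\<bar>\<eta> y - \<eta> x\<bar> \<le> L * t" using c y(2) L(2) by (smt (verit) mult_left_mono)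
      qed (use ab L(2) t in auto)
      also have "\<dots> = e / 2"
      proof -
        have "?a + ?b + 1 \<noteq> 0" "L \<noteq> 0" using ab L(2) by linarith+
        then show ?thesis unfolding t_def by (simp add: divide_simps)
      qed
      finally show "\<eta> y * ?a + (1 - \<eta> y) * ?b + e/4 + L * \<bar>f x - g x\<bar> \<le> \<eta> x * ?a + (1 - \<eta> x) * ?b + L * \<bar>f x - g x\<bar> + e"
        using e by simp
    qed simp
    finally show ?thesis .
  qed
  then show "\<exists>r>0. \<forall>y\<in>mspace M. mdist M x y < r \<longrightarrow> \<bar>(\<eta> y * f y + (1 - \<eta> y) * g y) - (\<eta> x * f x + (1 - \<eta> x) * g x)\<bar>
      \<le> (\<eta> x * ?a + (1 - \<eta> x) * ?b + L * \<bar>f x - g x\<bar> + e) * mdist M x y"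
    using r(1) s(1) t by (intro exI[of _ "min (min r s) t"]) auto
qed

text \<open>Where \<open>f x\<close> is within \<open>d\<close> of \<open>c\<close> the composition
  is locally constant, so the slope there is 0. The factor is a continuous majorant of the indicator
  of \<open>\<bar>f x - c\<bar> \<ge> d\<close>; continuity is what allows it to pass to almost
  everywhere limits of \<open>f\<close>.\<close>

lemma local_lip_flat_le:
  assumes x: "x \<in> mspace M" and f: "Lip M f" and \<psi>: "\<And>s t. \<bar>\<psi> s - \<psi> t\<bar> \<le> \<bar>s - t\<bar>"
    and flat: "\<And>s t. \<bar>s - c\<bar> < d \<Longrightarrow> \<bar>t - c\<bar> < d \<Longrightarrow> \<psi> s = \<psi> t" and d: "d > 0"
  shows "local_lip M (\<lambda>x. \<psi> (f x)) x \<le> min 1 (\<bar>f x - c\<bar> / d) * local_lip M f x"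
proof (cases "\<bar>f x - c\<bar> < d")
  case False
  then have "min 1 (\<bar>f x - c\<bar> / d) = 1" using d by (simp add: min_def)
  then show ?thesis using local_lip_compose_le[OF x f \<psi>] by simp
next
  case True
  obtain B where B: "B > 0" "\<And>y z. y \<in> mspace M \<Longrightarrow> z \<in> mspace M \<Longrightarrow> \<bar>f y - f z\<bar> \<le> B * mdist M y z"
    using f by (rule LipE) blast
  have "local_lip M (\<lambda>x. \<psi> (f x)) x \<le> 0"
  proof (rule local_lip_le[OF x])
    \<comment> \<open>Within this radius the Lipschitz constant \<open>B\<close> keeps
      \<open>f y\<close> inside the interval on which \<psi> is constant.\<close>
    show "0 < (d - \<bar>f x - c\<bar>) / B" using True B by simp
    fix y assume y: "y \<in> mspace M" "mdist M x y < (d - \<bar>f x - c\<bar>) / B"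
    then have "B * mdist M x y < d - \<bar>f x - c\<bar>" using B by (simp add: field_simps)
    then have "\<bar>f y - c\<bar> < d" using B(2)[OF x y(1)] by linarith
    then show "\<bar>\<psi> (f y) - \<psi> (f x)\<bar> \<le> 0 * mdist M x y" using flat[OF True, of "f y"] by simp
  qed simp
  also have "0 \<le> min 1 (\<bar>f x - c\<bar> / d) * local_lip M f x"
    using local_lip_nonneg[OF x, of f] d by auto
  finally show ?thesis .
qed

lemma LIMSEQ_norm_0_inverse:
  assumes "\<And>n. (a n :: real) < 1 / real (Suc n)" "\<And>n. 0 \<le> a n"
  shows "a \<longlonglongrightarrow> 0"
  by (rule real_tendsto_sandwich[OF _ _ tendsto_const LIMSEQ_Suc[OF lim_1_over_n]])
     (use assms in \<open>auto intro!: always_eventually less_imp_le\<close>)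

section \<open>Measurability of slopes and Lipschitz approximation of indicators\<close>

locale borel_metric_measure =
  fixes M :: "'a metric" and m :: "'a measure"
  assumes space_eq: "space m = mspace M"
    and sets_eq_borel: "sets m = sigma_sets (mspace M) {U. openin (mtopology_of M) U}"
begin

lemma open_sets: "openin (mtopology_of M) U \<Longrightarrow> U \<in> sets m"
  unfolding sets_eq_borel by blast

lemma continuous_measurable:
  assumes "continuous_map (mtopology_of M) euclideanreal f"
  shows "f \<in> borel_measurable m"
proof (rule borel_measurableI)
  fix S :: "real set" assume "open S"
  then have "openin (mtopology_of M) {x \<in> mspace M. f x \<in> S}"
    using openin_continuous_map_preimage[OF assms, of S] by simp
  moreover have "f -` S \<inter> space m = {x \<in> mspace M. f x \<in> S}" by (auto simp: space_eq)
  ultimately show "f -` S \<inter> space m \<in> sets m" using open_sets by simp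
qed

lemma Lip_measurable:
  assumes "Lip M f" shows "f \<in> borel_measurable m"
  using continuous_measurable[of f] Lipschitz_continuous_imp_continuous_map[OF assms] by simp

text \<open>The set where the slope is below \<open>a\<close> is a countable union of closed sets
  \<open>C q n\<close>, on which the difference quotients up to distance
  \<open>1 / real (Suc n)\<close> are at most the rational number \<open>q < a\<close>.\<close>

lemma local_lip_measurable:
  assumes f: "Lip M f"
  shows "local_lip M f \<in> borel_measurable m"
  unfolding borel_measurable_iff_less
proof
  fix a :: real
  define C where "C q n = {x \<in> mspace M. \<forall>y\<in>mspace M. mdist M x y < 1 / real (Suc n) \<longrightarrow> \<bar>f y - f x\<bar> \<le> q * mdist M x y}" for q n
  obtain B where B: "B > 0" "\<And>y z. y \<in> mspace M \<Longrightarrow> z \<in> mspace M \<Longrightarrow> \<bar>f y - f z\<bar> \<le> B * mdist M y z"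
    using f by (rule LipE) blast
  have Cm: "C q n \<in> sets m" if q: "0 \<le> q" for q n
  proof -
    have "openin (mtopology_of M) (mspace M - C q n)"
      unfolding openin_mtopology_of_iff
    proof (intro conjI ballI)
      fix x assume x: "x \<in> mspace M - C q n"
      then obtain y where y: "y \<in> mspace M" "mdist M x y < 1 / real (Suc n)" "\<bar>f y - f x\<bar> > q * mdist M x y"
        by (auto simp: C_def not_le)
      \<comment> \<open>The point \<open>y\<close> that violates the bound at \<open>x\<close> must
        still violate it at \<open>z\<close>. The first entry keeps \<open>y\<close> close enough to
        \<open>z\<close>; the second absorbs the change of both sides, at most \<open>B + q\<close>
        times the distance from \<open>x\<close> to \<open>z\<close>.\<close>
      define r where "r = min (1 / real (Suc n) - mdist M x y) ((\<bar>f y - f x\<bar> - q * mdist M x y) / (B + q))"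
      have "r > 0" using y B(1) q by (simp add: r_def)
      moreover have "z \<in> mspace M - C q n" if z: "z \<in> mspace M" "mdist M x z < r" for z
      proof -
        have d: "mdist M z y \<le> mdist M x z + mdist M x y"
          using mdist_triangle[of z M x y] z x y by (simp add: mdist_commute)
        have "(B + q) * mdist M x z < \<bar>f y - f x\<bar> - q * mdist M x y"
          using z(2) B(1) q by (simp add: r_def pos_less_divide_eq mult.commute)
        moreover have "\<bar>f x - f z\<bar> \<le> B * mdist M x z" using B(2)[of x z] x z by simp
        moreover have "q * mdist M z y \<le> q * mdist M x z + q * mdist M x y"
          using mult_left_mono[OF d q] by (simp add: distrib_left)
        ultimately have "q * mdist M z y < \<bar>f y - f z\<bar>" unfolding distrib_right by linarith
        moreover have "mdist M z y < 1 / real (Suc n)" using d z(2) by (simp add: r_def)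
        ultimately show ?thesis using z y by (force simp: C_def)
      qed
      ultimately show "\<exists>r>0. \<forall>z\<in>mspace M. mdist M x z < r \<longrightarrow> z \<in> mspace M - C q n" by blast
    qed auto
    from sets.compl_sets[OF open_sets[OF this]] have "mspace M - (mspace M - C q n) \<in> sets m" by (simp add: space_eq)
    moreover have "mspace M - (mspace M - C q n) = C q n" by (auto simp: C_def)
    ultimately show ?thesis by simp
  qed
  have "{x \<in> space m. local_lip M f x < a} = (\<Union>q\<in>\<rat> \<inter> {0..<a}. \<Union>n. C q n)"
  proof (intro set_eqI iffI)
    fix x assume "x \<in> {x \<in> space m. local_lip M f x < a}"
    then have x: "x \<in> mspace M" "local_lip M f x < a" by (auto simp: space_eq)
    obtain q where q: "q \<in> \<rat>" "local_lip M f x < q" "q < a" using Rats_dense_in_real[OF x(2)] by blast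
    obtain r where r: "r > 0" "\<And>y. y \<in> mspace M \<Longrightarrow> mdist M x y < r \<Longrightarrow> \<bar>f y - f x\<bar> \<le> q * mdist M x y"
      using local_lip_less[OF x(1) f q(2)] by blast
    obtain n where "1 / real (Suc n) < r" using nat_approx_posE[OF r(1)] by blast
    then have "x \<in> C q n" using r(2) x(1) by (auto simp: C_def)
    moreover have "0 \<le> q" using local_lip_nonneg[OF x(1), of f] q(2) by simp
    ultimately show "x \<in> (\<Union>q\<in>\<rat> \<inter> {0..<a}. \<Union>n. C q n)" using q by auto
  next
    fix x assume "x \<in> (\<Union>q\<in>\<rat> \<inter> {0..<a}. \<Union>n. C q n)"
    then obtain q n where q: "0 \<le> q" "q < a" "x \<in> C q n" by auto
    then have "local_lip M f x \<le> q" by (intro local_lip_le[of x M q "1 / real (Suc n)"]) (auto simp: C_def)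
    then show "x \<in> {x \<in> space m. local_lip M f x < a}" using q by (auto simp: C_def space_eq)
  qed
  moreover have "(\<Union>q\<in>\<rat> \<inter> {0..<a}. \<Union>n. C q n) \<in> sets m"
    by (intro sets.countable_UN'' sets.countable_UN countable_Int1 countable_rat image_subsetI) (use Cm in auto)
  ultimately show "{x \<in> space m. local_lip M f x < a} \<in> sets m" by simp
qed

lemma local_lip_L2:
  assumes f: "Lip M f" and u: "u \<in> L2 m" "\<And>x. x \<in> mspace M \<Longrightarrow> local_lip M f x \<le> u x"
  shows "local_lip M f \<in> L2 m" "l2norm m (local_lip M f) \<le> l2norm m u"
proof -
  have "AE x in m. \<bar>local_lip M f x\<bar> \<le> \<bar>u x\<bar>"
    using u(2) local_lip_nonneg[of _ M f] by (intro AE_I2) (force simp: space_eq)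
  from L2_bound[OF u(1) local_lip_measurable[OF f] this]
  show "local_lip M f \<in> L2 m" "l2norm m (local_lip M f) \<le> l2norm m u" by auto
qed

lemma Lip_truncate:
  assumes f: "Lip M f" "f \<in> L2 m" and e: "e > 0"
  obtains g T where "Lip M g" "g \<in> L2 m" "l2norm m (\<lambda>x. g x - f x) < e" "\<And>x. \<bar>g x\<bar> \<le> T"
    "\<And>x. x \<in> mspace M \<Longrightarrow> local_lip M g x \<le> local_lip M f x"
proof -
  define g where "g n x = max (- real n) (min (real n) (f x))" for n x
  have one: "\<bar>max (- real n) (min (real n) s) - max (- real n) (min (real n) t)\<bar> \<le> \<bar>s - t\<bar>" for n s t
    by (auto simp: max_def min_def)
  have gL: "Lip M (g n)" for n unfolding g_def[abs_def] by (rule Lip_compose[OF f(1) one])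
  have "L2_tendsto m g f"
  proof (rule L2_dominated)
    show "AE x in m. (\<lambda>n. g n x) \<longlonglongrightarrow> f x"
    proof (rule AE_I2, rule tendsto_eventually)
      fix x
      obtain n0 where n0: "\<bar>f x\<bar> < real n0" using reals_Archimedean2 by blast
      show "\<forall>\<^sub>F n in sequentially. g n x = f x"
        using eventually_ge_at_top[of n0]
      proof eventually_elim
        case (elim n)
        then have "real n0 \<le> real n" by simp
        with n0 show ?case by (auto simp: g_def max_def min_def)
      qed
    qed
    show "AE x in m. \<bar>g n x\<bar> \<le> \<bar>f x\<bar>" for n by (rule AE_I2) (auto simp: g_def)
  qed (use f gL Lip_measurable in auto)
  then have "(\<lambda>n. l2norm m (\<lambda>x. g n x - f x)) \<longlonglongrightarrow> 0" and gL2: "g n \<in> L2 m" for n by (auto simp: L2_tendsto_iff)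
  from order_tendstoD(2)[OF this(1) e] obtain n where "l2norm m (\<lambda>x. g n x - f x) < e"
    by (auto simp: eventually_sequentially)
  moreover have "\<bar>g n x\<bar> \<le> real n" for x by (auto simp: g_def)
  moreover have "local_lip M (g n) x \<le> local_lip M f x" if "x \<in> mspace M" for x
    unfolding g_def[abs_def] by (rule local_lip_compose_le[OF that f(1) one])
  ultimately show thesis using that gL gL2 by blast
qed

lemma Lip_approx_indicator_open:
  assumes U: "openin (mtopology_of M) U" and g: "g \<in> L2 m" and e: "e > 0"
  shows "\<exists>\<eta>. Lip M \<eta> \<and> (\<forall>x. 0 \<le> \<eta> x \<and> \<eta> x \<le> 1) \<and> l2norm m (\<lambda>x. \<eta> x * g x - indicator U x * g x) < e"
\<comment> \<open>The case of an empty complement is separate because the distance to it is an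
  infimum over the empty set.\<close>
proof (cases "U = mspace M")
  case True
  have "(\<integral>x. (1 * g x - indicator U x * g x)\<^sup>2 \<partial>m) = (\<integral>x. 0 \<partial>m)"
    by (rule Bochner_Integration.integral_cong) (auto simp: True space_eq)
  then have "l2norm m (\<lambda>x. 1 * g x - indicator U x * g x) = 0" by (simp add: l2norm_def)
  then show ?thesis using e by (intro exI[of _ "\<lambda>x. 1"]) auto
next
  case False
  define Z where "Z = mspace M - U"
  have sub: "U \<subseteq> mspace M" using openin_subset[OF U] by simp
  have Z: "Z \<noteq> {}" "Z \<subseteq> mspace M" using False sub by (auto simp: Z_def)
  define d where "d x = Inf (mdist M x ` Z)" for x
  have bdd: "bdd_below (mdist M x ` Z)" for x by (intro bdd_belowI[of _ 0]) auto
  have d0: "0 \<le> d x" for x unfolding d_def by (rule cInf_greatest) (use Z in auto)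
  have dle: "d x \<le> d y + mdist M x y" if xy: "x \<in> mspace M" "y \<in> mspace M" for x y
  proof -
    have "d x - mdist M x y \<le> d y"
      unfolding d_def[of y]
    proof (rule cInf_greatest)
      fix r assume "r \<in> mdist M y ` Z"
      then obtain z where z: "z \<in> Z" "r = mdist M y z" by auto
      have "d x \<le> mdist M x z" unfolding d_def by (rule cInf_lower[OF _ bdd]) (use z in auto)
      also have "\<dots> \<le> mdist M x y + r" using mdist_triangle[of x M y z] xy z Z by auto
      finally show "d x - mdist M x y \<le> r" by simp
    qed (use Z in auto)
    then show ?thesis by simp
  qed
  have dU: "0 < d x" if x: "x \<in> U" for x
  proof -
    obtain r where r: "r > 0" "\<And>y. y \<in> mspace M \<Longrightarrow> mdist M x y < r \<Longrightarrow> y \<in> U"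
      using U x unfolding openin_mtopology_of_iff by meson
    have "r \<le> d x" unfolding d_def
      by (rule cInf_greatest) (use Z r(2) in \<open>force simp: Z_def\<close>)+
    with r show ?thesis by simp
  qed
  have dZ: "d x = 0" if x: "x \<in> Z" for x
  proof -
    have "d x \<le> mdist M x x" unfolding d_def by (rule cInf_lower[OF _ bdd]) (use x in auto)
    also have "mdist M x x = 0" using x Z by auto
    finally show ?thesis using d0[of x] by simp
  qed
  \<comment> \<open>Steepening cutoffs of the distance to the complement, increasing to the
    indicator of \<open>U\<close>.\<close>
  define h where "h n x = min 1 (real n * d x)" for n x
  have hL: "Lip M (h n)" for n
  proof (rule LipI)
    fix x y assume xy: "x \<in> mspace M" "y \<in> mspace M"
    have "\<bar>d x - d y\<bar> \<le> mdist M x y" using dle[OF xy] dle[OF xy(2,1)] by (simp add: mdist_commute)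
    then have "\<bar>real n * d x - real n * d y\<bar> \<le> real n * mdist M x y"
      by (simp add: right_diff_distrib[symmetric] abs_mult mult_left_mono)
    then show "\<bar>h n x - h n y\<bar> \<le> real n * mdist M x y" unfolding h_def by (auto simp: min_def)
  qed
  have "L2_tendsto m (\<lambda>n x. h n x * g x) (\<lambda>x. indicator U x * g x)"
  proof (rule L2_dominated)
    show "(\<lambda>x. h n x * g x) \<in> borel_measurable m" for n
      using Lip_measurable[OF hL] L2_measurable[OF g] by auto
    show "(\<lambda>x. indicator U x * g x) \<in> borel_measurable m"
      using open_sets[OF U] L2_measurable[OF g] by auto
    show "(\<lambda>x. \<bar>g x\<bar>) \<in> L2 m" using g by auto
    show "AE x in m. \<bar>h n x * g x\<bar> \<le> \<bar>g x\<bar>" for n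
      using d0 by (intro AE_I2) (auto simp: h_def abs_mult intro!: mult_left_le_one_le)
    show "AE x in m. (\<lambda>n. h n x * g x) \<longlonglongrightarrow> indicator U x * g x"
    proof (rule AE_I2, intro tendsto_mult tendsto_const)
      fix x assume x: "x \<in> space m"
      show "(\<lambda>n. h n x) \<longlonglongrightarrow> indicator U x"
      proof (cases "x \<in> U")
        case True
        obtain n0 where n0: "1 < real n0 * d x" using ex_less_of_nat_mult[OF dU[OF True]] by blast
        have "\<forall>\<^sub>F n in sequentially. h n x = indicator U x"
          using eventually_ge_at_top[of n0]
        proof eventually_elim
          case (elim n)
          then have "real n0 * d x \<le> real n * d x" using d0[of x] by (intro mult_right_mono) auto
          then show ?case using n0 True by (simp add: h_def)
        qed
        then show ?thesis by (rule tendsto_eventually)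
      next
        case False
        then have "d x = 0" using x dZ by (simp add: Z_def space_eq)
        then show ?thesis using False by (simp add: h_def)
      qed
    qed
  qed
  then have "(\<lambda>n. l2norm m (\<lambda>x. h n x * g x - indicator U x * g x)) \<longlonglongrightarrow> 0" by (simp add: L2_tendsto_iff)
  from order_tendstoD(2)[OF this e] obtain n where "l2norm m (\<lambda>x. h n x * g x - indicator U x * g x) < e"
    by (auto simp: eventually_sequentially)
  then show ?thesis using hL d0 by (intro exI[of _ "h n"]) (auto simp: h_def)
qed

text \<open>The measure with density \<open>g\<^sup>2\<close> is finite, so approximability is a
  property of sets that passes through the generation of the Borel sets: complements use
  \<open>1 - \<eta>\<close>, finite unions use maxima, and countable unions follow by dominated
  convergence.\<close>

lemma Lip_approx_indicator:
  assumes A: "A \<in> sets m" and g: "g \<in> L2 m" and e: "e > 0"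
  obtains \<eta> where "Lip M \<eta>" "\<And>x. 0 \<le> \<eta> x" "\<And>x. \<eta> x \<le> 1" "l2norm m (\<lambda>x. \<eta> x * g x - indicator A x * g x) < e"
proof -
  define P where "P A e \<longleftrightarrow> (\<exists>\<eta>. Lip M \<eta> \<and> (\<forall>x. 0 \<le> \<eta> x \<and> \<eta> x \<le> 1) \<and> l2norm m (\<lambda>x. \<eta> x * g x - indicator A x * g x) < e)" for A e
  have L2i: "(\<lambda>x. indicator A x * g x) \<in> L2 m" if "A \<in> sets m" for A
    by (rule L2_bounded_mult(1)[OF g, of _ 1]) (use that in \<open>auto simp: indicator_def\<close>)
  have L2e: "(\<lambda>x. \<eta> x * g x) \<in> L2 m" if "Lip M \<eta>" "\<forall>x. 0 \<le> \<eta> x \<and> \<eta> x \<le> 1" for \<eta>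
    by (rule L2_bounded_mult(1)[OF g, of _ 1]) (use that Lip_measurable in auto)
  have PUn: "P (A \<union> B) (e + e')" if A: "A \<in> sets m" "P A e" and B: "B \<in> sets m" "P B e'" for A B e e'
  proof -
    obtain \<eta> where \<eta>: "Lip M \<eta>" "\<forall>x. 0 \<le> \<eta> x \<and> \<eta> x \<le> 1" "l2norm m (\<lambda>x. \<eta> x * g x - indicator A x * g x) < e"
      using A by (auto simp: P_def)
    obtain \<theta> where \<theta>: "Lip M \<theta>" "\<forall>x. 0 \<le> \<theta> x \<and> \<theta> x \<le> 1" "l2norm m (\<lambda>x. \<theta> x * g x - indicator B x * g x) < e'"
      using B by (auto simp: P_def)
    let ?h = "\<lambda>x. max (\<eta> x) (\<theta> x)"
    obtain K where K: "K > 0" "\<And>x y. x \<in> mspace M \<Longrightarrow> y \<in> mspace M \<Longrightarrow> \<bar>\<eta> x - \<eta> y\<bar> \<le> K * mdist M x y"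
      using \<eta>(1) by (rule LipE) blast
    obtain K' where K': "K' > 0" "\<And>x y. x \<in> mspace M \<Longrightarrow> y \<in> mspace M \<Longrightarrow> \<bar>\<theta> x - \<theta> y\<bar> \<le> K' * mdist M x y"
      using \<theta>(1) by (rule LipE) blast
    have hL: "Lip M ?h"
    proof (rule LipI)
      fix x y assume xy: "x \<in> mspace M" "y \<in> mspace M"
      have "0 \<le> K * mdist M x y" "0 \<le> K' * mdist M x y" using K K' by auto
      then show "\<bar>?h x - ?h y\<bar> \<le> (K + K') * mdist M x y"
        unfolding distrib_right using K(2)[OF xy] K'(2)[OF xy] by (auto simp: max_def)
    qed
    have h01: "\<forall>x. 0 \<le> ?h x \<and> ?h x \<le> 1" using \<eta>(2) \<theta>(2) by (auto simp: max_def)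
    let ?a = "\<lambda>x. \<bar>\<eta> x * g x - indicator A x * g x\<bar>" and ?b = "\<lambda>x. \<bar>\<theta> x * g x - indicator B x * g x\<bar>"
    have ab: "?a \<in> L2 m" "?b \<in> L2 m"
      by (intro L2_abs L2_diff L2i L2e A(1) B(1) \<eta>(1,2) \<theta>(1,2))+
    have "l2norm m (\<lambda>x. ?h x * g x - indicator (A \<union> B) x * g x) \<le> l2norm m (\<lambda>x. ?a x + ?b x)"
    proof (rule L2_bound(2)[OF L2_add[OF ab]])
      show "(\<lambda>x. ?h x * g x - indicator (A \<union> B) x * g x) \<in> borel_measurable m"
        using L2_measurable[OF L2_diff[OF L2e[OF hL h01] L2i[of "A \<union> B"]]] A B by auto
      have "\<bar>?h x * g x - indicator (A \<union> B) x * g x\<bar> \<le> ?a x + ?b x" for x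
      proof -
        \<comment> \<open>The error of the maximum for a union is at most the sum of the two errors,
          because both cutoffs take values between 0 and 1.\<close>
        have "\<bar>?h x - indicator (A \<union> B) x\<bar> \<le> \<bar>\<eta> x - indicator A x\<bar> + \<bar>\<theta> x - indicator B x\<bar>"
          using \<eta>(2)[rule_format, of x] \<theta>(2)[rule_format, of x] by (auto simp: indicator_def max_def)
        from mult_right_mono[OF this, of "\<bar>g x\<bar>"] show ?thesis
          by (simp add: distrib_right abs_mult[symmetric] left_diff_distrib)
      qed
      then show "AE x in m. \<bar>?h x * g x - indicator (A \<union> B) x * g x\<bar> \<le> \<bar>?a x + ?b x\<bar>" by (auto intro!: AE_I2)
    qed
    also have "\<dots> \<le> l2norm m ?a + l2norm m ?b" by (rule l2norm_triangle[OF ab])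
    also have "\<dots> < e + e'" using \<eta>(3) \<theta>(3) by simp
    finally show ?thesis unfolding P_def using hL h01 by blast
  qed
  have fin: "(\<forall>e>0. P (\<Union>i<n. B i) e) \<and> (\<Union>i<n. B i) \<in> sets m"
    if "\<And>i. B i \<in> sets m" "\<And>i e. e > 0 \<Longrightarrow> P (B i) e" for B :: "nat \<Rightarrow> 'a set" and n
  proof (induction n)
    case 0
    have "P {} e" if "e > 0" for e
      unfolding P_def using that by (intro exI[of _ "\<lambda>x. 0"]) auto
    then show ?case by simp
  next
    case (Suc n)
    have "P (\<Union>i<Suc n. B i) e" if "e > 0" for e
    proof -
      have "P ((\<Union>i<n. B i) \<union> B n) (e/2 + e/2)"
        by (rule PUn) (use Suc that \<open>\<And>i. B i \<in> sets m\<close> \<open>\<And>i e. e > 0 \<Longrightarrow> P (B i) e\<close> in auto)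
      then show ?thesis by (simp add: lessThan_Suc Un_commute)
    qed
    then show ?case using that(1) by auto
  qed
  have "A \<in> sigma_sets (mspace M) {U. openin (mtopology_of M) U}" using A sets_eq_borel by simp
  then have "\<forall>e>0. P A e"
  proof (induction rule: sigma_sets.induct)
    case (Basic U)
    then show ?case unfolding P_def using Lip_approx_indicator_open[OF _ g] by auto
  next
    case Empty
    show ?case unfolding P_def by (auto intro!: exI[of _ "\<lambda>x. 0"])
  next
    case (Compl A)
    show ?case
    proof (intro allI impI)
      fix e :: real assume "e > 0"
      with Compl obtain \<eta> where \<eta>: "Lip M \<eta>" "\<forall>x. 0 \<le> \<eta> x \<and> \<eta> x \<le> 1" "l2norm m (\<lambda>x. \<eta> x * g x - indicator A x * g x) < e"
        by (auto simp: P_def)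
      have "(\<integral>x. ((1 - \<eta> x) * g x - indicator (mspace M - A) x * g x)\<^sup>2 \<partial>m) = (\<integral>x. (\<eta> x * g x - indicator A x * g x)\<^sup>2 \<partial>m)"
        by (rule Bochner_Integration.integral_cong) (auto simp: space_eq indicator_def power2_eq_square algebra_simps)
      then have "l2norm m (\<lambda>x. (1 - \<eta> x) * g x - indicator (mspace M - A) x * g x) < e" using \<eta>(3) by (simp add: l2norm_def)
      moreover have "Lip M (\<lambda>x. 1 - \<eta> x)" using Lip_add[OF Lip_const Lip_cmult[OF \<eta>(1), of "-1"], of 1] by simp
      ultimately show "P (mspace M - A) e" unfolding P_def using \<eta>(2) by (intro exI[of _ "\<lambda>x. 1 - \<eta> x"]) auto
    qed
  next
    case (Union B)
    have Bm: "B i \<in> sets m" for i using Union(1) sets_eq_borel by simp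
    note f = fin[of B, OF Bm]
    show ?case
    proof (intro allI impI)
      fix e :: real assume e: "e > 0"
      have "L2_tendsto m (\<lambda>n x. indicator (\<Union>i<n. B i) x * g x) (\<lambda>x. indicator (\<Union>i. B i) x * g x)"
      proof (rule L2_dominated)
        show "(\<lambda>x. \<bar>g x\<bar>) \<in> L2 m" using g by auto
        show "(\<lambda>x. indicator (\<Union>i<n. B i) x * g x) \<in> borel_measurable m" for n
          by (intro L2_measurable[OF L2i] sets.finite_UN) (use Bm in auto)
        show "(\<lambda>x. indicator (\<Union>i. B i) x * g x) \<in> borel_measurable m"
          by (intro L2_measurable[OF L2i] sets.countable_UN) (use Bm in auto)
        show "AE x in m. \<bar>indicator (\<Union>i<n. B i) x * g x\<bar> \<le> \<bar>g x\<bar>" for n by (auto simp: indicator_def)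
        show "AE x in m. (\<lambda>n. indicator (\<Union>i<n. B i) x * g x) \<longlonglongrightarrow> indicator (\<Union>i. B i) x * g x"
        proof (rule AE_I2, rule tendsto_mult[OF _ tendsto_const], rule tendsto_eventually)
          fix x
          show "\<forall>\<^sub>F n in sequentially. indicator (\<Union>i<n. B i) x = (indicator (\<Union>i. B i) x :: real)"
          proof (cases "x \<in> (\<Union>i. B i)")
            case True
            then obtain j where j: "x \<in> B j" by blast
            show ?thesis using eventually_gt_at_top[of j] by eventually_elim (use j in \<open>auto simp: indicator_def\<close>)
          qed (auto simp: indicator_def)
        qed
      qed
      then have "(\<lambda>n. l2norm m (\<lambda>x. indicator (\<Union>i<n. B i) x * g x - indicator (\<Union>i. B i) x * g x)) \<longlonglongrightarrow> 0" by (simp add: L2_tendsto_iff)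
      from order_tendstoD(2)[OF this, of "e/2"] e obtain n where
        n: "l2norm m (\<lambda>x. indicator (\<Union>i<n. B i) x * g x - indicator (\<Union>i. B i) x * g x) < e / 2"
        by (auto simp: eventually_sequentially)
      have "P (\<Union>i<n. B i) (e/2)" using f[of n] Union(2) e by auto
      then obtain \<eta> where \<eta>: "Lip M \<eta>" "\<forall>x. 0 \<le> \<eta> x \<and> \<eta> x \<le> 1" "l2norm m (\<lambda>x. \<eta> x * g x - indicator (\<Union>i<n. B i) x * g x) < e / 2"
        by (auto simp: P_def)
      have "l2norm m (\<lambda>x. \<eta> x * g x - indicator (\<Union>i. B i) x * g x) < e"
        using l2norm_triangle_diff[OF L2e[OF \<eta>(1,2)] L2i[of "\<Union>i<n. B i"] L2i[of "\<Union>i. B i"]] \<eta>(3) n Bm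
        by (auto intro: le_less_trans)
      then show "P (\<Union>i. B i) e" unfolding P_def using \<eta> by blast
    qed
  qed
  with e have "P A e" by blast
  then show thesis unfolding P_def using that by blast
qed

text \<open>Requiring only upper bounds of the slopes to converge makes the set of admissible \<open>H\<close> closed
  under pointwise minima.\<close>

definition relaxed :: "('a \<Rightarrow> real) \<Rightarrow> ('a \<Rightarrow> real) \<Rightarrow> bool" where
  "relaxed f H \<longleftrightarrow> f \<in> L2 m \<and> H \<in> L2 m \<and>
     (\<forall>e>0. \<exists>F u. Lip M F \<and> F \<in> L2 m \<and> u \<in> L2 m \<and> (\<forall>x\<in>mspace M. local_lip M F x \<le> u x) \<and>
        l2norm m (\<lambda>x. F x - f x) < e \<and> l2norm m (\<lambda>x. u x - H x) < e)"

section \<open>Relaxed gradients and existence of a minimal one\<close>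

lemma relaxedI:
  assumes F: "\<And>n. Lip M (F n)" "L2_tendsto m F f" and u: "L2_tendsto m u H"
    and le: "\<And>n x. x \<in> mspace M \<Longrightarrow> local_lip M (F n) x \<le> u n x"
  shows "relaxed f H"
  unfolding relaxed_def
proof (intro conjI allI impI)
  fix e :: real assume e: "e > 0"
  have "(\<lambda>n. l2norm m (\<lambda>x. F n x - f x)) \<longlonglongrightarrow> 0" "(\<lambda>n. l2norm m (\<lambda>x. u n x - H x)) \<longlonglongrightarrow> 0"
    using F u by (auto simp: L2_tendsto_iff)
  then have "\<forall>\<^sub>F n in sequentially. l2norm m (\<lambda>x. F n x - f x) < e \<and> l2norm m (\<lambda>x. u n x - H x) < e"
    using e by (intro eventually_conj order_tendstoD(2))
  then obtain n where "l2norm m (\<lambda>x. F n x - f x) < e" "l2norm m (\<lambda>x. u n x - H x) < e"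
    by (auto simp: eventually_sequentially)
  then show "\<exists>F u. Lip M F \<and> F \<in> L2 m \<and> u \<in> L2 m \<and> (\<forall>x\<in>mspace M. local_lip M F x \<le> u x) \<and>
        l2norm m (\<lambda>x. F x - f x) < e \<and> l2norm m (\<lambda>x. u x - H x) < e"
    using F u le by (intro exI[of _ "F n"] exI[of _ "u n"]) (auto simp: L2_tendsto_def)
qed (use F u in \<open>auto simp: L2_tendsto_def\<close>)

lemma relaxedE:
  assumes "relaxed f H"
  obtains F u where "\<And>n. Lip M (F n)" "L2_tendsto m F f" "L2_tendsto m u H"
    "\<And>n x. x \<in> mspace M \<Longrightarrow> local_lip M (F n) x \<le> u n x"
proof -
  define P where "P n F u \<longleftrightarrow> Lip M F \<and> F \<in> L2 m \<and> u \<in> L2 m \<and> (\<forall>x\<in>mspace M. local_lip M F x \<le> u x) \<and>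
        l2norm m (\<lambda>x. F x - f x) < 1 / real (Suc n) \<and> l2norm m (\<lambda>x. u x - H x) < 1 / real (Suc n)" for n F u
  have fH: "f \<in> L2 m" "H \<in> L2 m" using assms by (auto simp: relaxed_def)
  have "\<forall>n. \<exists>F u. P n F u" using assms unfolding relaxed_def P_def by simp
  then obtain F u where "\<And>n. P n (F n) (u n)" by metis
  note * = this[unfolded P_def]
  have F: "Lip M (F n)" "F n \<in> L2 m" "u n \<in> L2 m"
    "l2norm m (\<lambda>x. F n x - f x) < 1 / real (Suc n)" "l2norm m (\<lambda>x. u n x - H x) < 1 / real (Suc n)" for n
    using *[of n] by blast+
  have le: "local_lip M (F n) x \<le> u n x" if "x \<in> mspace M" for n x using *[of n] that by blast
  have "L2_tendsto m F f" "L2_tendsto m u H"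
    using F(2,3) fH LIMSEQ_norm_0_inverse[OF F(4)] LIMSEQ_norm_0_inverse[OF F(5)] by (simp_all add: L2_tendsto_iff)
  from that[OF F(1) this le] show thesis .
qed

text \<open>Because \<open>relaxed\<close> asks for approximation within every \<open>e\<close>
  rather than for a sequence, the diagonal argument reduces to the triangle inequality.\<close>

lemma relaxed_closed:
  assumes fk: "L2_tendsto m f g" and Hk: "L2_tendsto m H K" and r: "\<And>n. relaxed (f n) (H n)"
  shows "relaxed g K"
  unfolding relaxed_def
proof (intro conjI allI impI)
  show L2: "g \<in> L2 m" "K \<in> L2 m" using fk Hk by (auto simp: L2_tendsto_def)
  fix e :: real assume e: "e > 0"
  have "(\<lambda>n. l2norm m (\<lambda>x. f n x - g x)) \<longlonglongrightarrow> 0" "(\<lambda>n. l2norm m (\<lambda>x. H n x - K x)) \<longlonglongrightarrow> 0"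
    using fk Hk by (auto simp: L2_tendsto_iff)
  then have "\<forall>\<^sub>F n in sequentially. l2norm m (\<lambda>x. f n x - g x) < e/2 \<and> l2norm m (\<lambda>x. H n x - K x) < e/2"
    using e by (intro eventually_conj order_tendstoD(2)) auto
  then obtain n where n: "l2norm m (\<lambda>x. f n x - g x) < e/2" "l2norm m (\<lambda>x. H n x - K x) < e/2"
    by (auto simp: eventually_sequentially)
  obtain F u where F: "Lip M F" "F \<in> L2 m" "u \<in> L2 m" "\<forall>x\<in>mspace M. local_lip M F x \<le> u x"
        "l2norm m (\<lambda>x. F x - f n x) < e/2" "l2norm m (\<lambda>x. u x - H n x) < e/2"
    using r[of n] e unfolding relaxed_def by (meson half_gt_zero)
  have "l2norm m (\<lambda>x. F x - g x) < e" "l2norm m (\<lambda>x. u x - K x) < e"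
    using l2norm_triangle_diff[of F m "f n" g] l2norm_triangle_diff[of u m "H n" K] F n L2 r[of n]
    by (auto simp: relaxed_def)
  with F show "\<exists>F u. Lip M F \<and> F \<in> L2 m \<and> u \<in> L2 m \<and> (\<forall>x\<in>mspace M. local_lip M F x \<le> u x) \<and>
        l2norm m (\<lambda>x. F x - g x) < e \<and> l2norm m (\<lambda>x. u x - K x) < e" by blast
qed

lemma lip_limit_imp_relaxed: "lip_limit M m f G \<Longrightarrow> relaxed f G"
  unfolding lip_limit_def by (auto intro: relaxedI)

lemma relaxed_nonneg_AE:
  assumes "relaxed f H" shows "AE x in m. 0 \<le> H x"
proof -
  obtain F u where F: "\<And>n. Lip M (F n)" "L2_tendsto m F f" "L2_tendsto m u H"
    "\<And>n x. x \<in> mspace M \<Longrightarrow> local_lip M (F n) x \<le> u n x" using relaxedE[OF assms] by blast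
  obtain r :: "nat \<Rightarrow> nat" where "AE x in m. (\<lambda>n. u (r n) x) \<longlonglongrightarrow> H x" using L2_tendsto_AE_subseq[OF F(3)] by blast
  then show ?thesis
    using AE_space
  proof eventually_elim
    case (elim x)
    then have "0 \<le> u (r n) x" for n
      using F(4)[of x "r n"] local_lip_nonneg[of x M "F (r n)"] by (simp add: space_eq)
    then show ?case using elim(1) by (intro LIMSEQ_le_const[OF elim(1)]) auto
  qed
qed

lemma relaxed_truncated:
  assumes "relaxed f H"
  obtains F u T where "\<And>n. Lip M (F n)" "L2_tendsto m F f" "L2_tendsto m u H"
    "\<And>n x. x \<in> mspace M \<Longrightarrow> local_lip M (F n) x \<le> u n x" "\<And>n x. \<bar>F n x\<bar> \<le> T n"
proof -
  obtain F u where F: "\<And>n. Lip M (F n)" "L2_tendsto m F f" "L2_tendsto m u H"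
    "\<And>n x. x \<in> mspace M \<Longrightarrow> local_lip M (F n) x \<le> u n x" using relaxedE[OF assms] by blast
  have FL: "F n \<in> L2 m" "f \<in> L2 m" for n using F(2) by (auto simp: L2_tendsto_def)
  define P where "P n g \<longleftrightarrow> Lip M g \<and> g \<in> L2 m \<and> l2norm m (\<lambda>x. g x - F n x) < 1 / real (Suc n) \<and> (\<exists>T. \<forall>x. \<bar>g x\<bar> \<le> T) \<and>
    (\<forall>x\<in>mspace M. local_lip M g x \<le> local_lip M (F n) x)" for n g
  have "\<exists>g. P n g" for n
  proof (rule Lip_truncate[OF F(1)[of n] FL(1)[of n]])
    show "0 < 1 / real (Suc n)" by simp
    fix g T
    assume "Lip M g" "g \<in> L2 m" "l2norm m (\<lambda>x. g x - F n x) < 1 / real (Suc n)" "\<And>x. \<bar>g x\<bar> \<le> T"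
      "\<And>x. x \<in> mspace M \<Longrightarrow> local_lip M g x \<le> local_lip M (F n) x"
    then show ?thesis unfolding P_def by (intro exI[of _ g] conjI exI[of _ T]) auto
  qed
  then obtain G where "\<And>n. P n (G n)" by metis
  then have G: "\<And>n. Lip M (G n)" "\<And>n. G n \<in> L2 m" "\<And>n. l2norm m (\<lambda>x. G n x - F n x) < 1 / real (Suc n)"
    "\<And>n. \<exists>T. \<forall>x. \<bar>G n x\<bar> \<le> T" "\<And>n x. x \<in> mspace M \<Longrightarrow> local_lip M (G n) x \<le> local_lip M (F n) x"
    unfolding P_def by simp_all
  have "L2_tendsto m (\<lambda>n x. G n x - F n x) (\<lambda>x. 0)"
    using L2_diff[OF G(2) FL(1)] LIMSEQ_norm_0_inverse[OF G(3)] by (simp add: L2_tendsto_iff)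
  from L2_tendsto_add[OF this F(2)] have "L2_tendsto m G f" by simp
  moreover have "local_lip M (G n) x \<le> u n x" if "x \<in> mspace M" for n x
    using G(5)[OF that] F(4)[OF that] by (rule order_trans)
  moreover obtain T where "\<And>n x. \<bar>G n x\<bar> \<le> T n" using G(4) by metis
  ultimately show thesis by (intro that[of G u T] G(1) F(3))
qed

lemma bounded_Lip_mult:
  assumes "Lip M \<eta>" "\<And>x. 0 \<le> \<eta> x" "\<And>x. \<eta> x \<le> 1" and "Lip M F" "\<And>x. \<bar>F x\<bar> \<le> T"
  shows "Lip M (\<lambda>x. \<eta> x * F x)"
  by (rule Lip_mult[of M \<eta> 1 F T]) (use assms in auto)

text \<open>Approximations \<open>F n\<close> and \<open>G n\<close> belonging to the two bounds are
  glued by \<eta>. Both tend to the same \<open>f\<close>, so the error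
  \<open>L * \<bar>F n x - G n x\<bar>\<close> of \<open>local_lip_convex_le\<close> tends to 0 in
  the norm.\<close>

lemma relaxed_convex:
  assumes H: "relaxed f H" and K: "relaxed f K"
    and \<eta>: "Lip M \<eta>" "\<And>x. 0 \<le> \<eta> x" "\<And>x. \<eta> x \<le> 1"
  shows "relaxed f (\<lambda>x. \<eta> x * H x + (1 - \<eta> x) * K x)"
proof -
  obtain F u T where F: "\<And>n. Lip M (F n)" "L2_tendsto m F f" "L2_tendsto m u H"
    "\<And>n x. x \<in> mspace M \<Longrightarrow> local_lip M (F n) x \<le> u n x" "\<And>n x. \<bar>F n x\<bar> \<le> T n"
    by (rule relaxed_truncated[OF H]) (rule that)
  obtain G v T' where G: "\<And>n. Lip M (G n)" "L2_tendsto m G f" "L2_tendsto m v K"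
    "\<And>n x. x \<in> mspace M \<Longrightarrow> local_lip M (G n) x \<le> v n x" "\<And>n x. \<bar>G n x\<bar> \<le> T' n"
    by (rule relaxed_truncated[OF K]) (rule that)
  obtain L where L: "L > 0" "\<And>x y. x \<in> mspace M \<Longrightarrow> y \<in> mspace M \<Longrightarrow> \<bar>\<eta> x - \<eta> y\<bar> \<le> L * mdist M x y"
    using \<eta>(1) by (rule LipE) blast
  have c: "0 \<le> 1 - \<eta> x" "1 - \<eta> x \<le> 1" for x using \<eta>(2,3)[of x] by simp_all
  have "Lip M (\<lambda>x. 1 + (-1) * \<eta> x)" by (rule Lip_add[OF Lip_const Lip_cmult[OF \<eta>(1)]])
  then have cL: "Lip M (\<lambda>x. 1 - \<eta> x)" by simp
  have ab: "\<bar>\<eta> x\<bar> \<le> 1" "\<bar>1 - \<eta> x\<bar> \<le> 1" for x using \<eta>(2,3)[of x] by simp_all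
  have b1: "L2_tendsto m (\<lambda>n x. \<eta> x * A n x) (\<lambda>x. \<eta> x * B x)" if "L2_tendsto m A B" for A B
    by (rule L2_tendsto_bounded_mult[OF that Lip_measurable[OF \<eta>(1)] ab(1)])
  have b2: "L2_tendsto m (\<lambda>n x. (1 - \<eta> x) * A n x) (\<lambda>x. (1 - \<eta> x) * B x)" if "L2_tendsto m A B" for A B
    by (rule L2_tendsto_bounded_mult[OF that Lip_measurable[OF cL] ab(2)])
  show ?thesis
  proof (rule relaxedI[where F = "\<lambda>n x. \<eta> x * F n x + (1 - \<eta> x) * G n x"
        and u = "\<lambda>n x. \<eta> x * u n x + (1 - \<eta> x) * v n x + L * \<bar>F n x - G n x\<bar>"])
    show "Lip M (\<lambda>x. \<eta> x * F n x + (1 - \<eta> x) * G n x)" for n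
      by (rule Lip_add[OF bounded_Lip_mult[OF \<eta> F(1,5)] bounded_Lip_mult[OF cL c G(1,5)]])
    show "L2_tendsto m (\<lambda>n x. \<eta> x * F n x + (1 - \<eta> x) * G n x) f"
      by (rule L2_tendsto_cong[OF L2_tendsto_add[OF b1[OF F(2)] b2[OF G(2)]]]) (simp_all add: left_diff_distrib)
    have "L2_tendsto m (\<lambda>n x. L * \<bar>F n x + (- 1) * G n x\<bar>) (\<lambda>x. L * \<bar>f x + (- 1) * f x\<bar>)"
      by (intro L2_tendsto_cmult L2_tendsto_abs L2_tendsto_add F G)
    note lim = L2_tendsto_add[OF L2_tendsto_add[OF b1[OF F(3)] b2[OF G(3)]] this]
    show "L2_tendsto m (\<lambda>n x. \<eta> x * u n x + (1 - \<eta> x) * v n x + L * \<bar>F n x - G n x\<bar>) (\<lambda>x. \<eta> x * H x + (1 - \<eta> x) * K x)"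
      by (rule L2_tendsto_cong[OF lim]) simp_all
    fix n x assume x: "x \<in> mspace M"
    have "local_lip M (\<lambda>x. \<eta> x * F n x + (1 - \<eta> x) * G n x) x
        \<le> \<eta> x * local_lip M (F n) x + (1 - \<eta> x) * local_lip M (G n) x + L * \<bar>F n x - G n x\<bar>"
      by (rule local_lip_convex_le[OF x F(1) G(1) \<eta>(2,3) L(2,1)])
    moreover have "\<eta> x * local_lip M (F n) x + (1 - \<eta> x) * local_lip M (G n) x + L * \<bar>F n x - G n x\<bar>
        \<le> \<eta> x * u n x + (1 - \<eta> x) * v n x + L * \<bar>F n x - G n x\<bar>"
      by (rule add_right_mono[OF add_mono[OF mult_left_mono[OF F(4)[OF x] \<eta>(2)] mult_left_mono[OF G(4)[OF x] c(1)]]])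
    ultimately show "local_lip M (\<lambda>x. \<eta> x * F n x + (1 - \<eta> x) * G n x) x \<le> \<eta> x * u n x + (1 - \<eta> x) * v n x + L * \<bar>F n x - G n x\<bar>"
      by (rule order_trans)
  qed
qed

lemma Lip_approx_indicator_seq:
  assumes A: "A \<in> sets m" and g: "g \<in> L2 m"
  obtains \<eta> :: "nat \<Rightarrow> 'a \<Rightarrow> real" where "\<And>n. Lip M (\<eta> n)" "\<And>n x. 0 \<le> \<eta> n x" "\<And>n x. \<eta> n x \<le> 1"
    "L2_tendsto m (\<lambda>n x. \<eta> n x * g x) (\<lambda>x. indicator A x * g x)"
proof -
  define P where "P n \<eta> \<longleftrightarrow> Lip M \<eta> \<and> (\<forall>x. 0 \<le> \<eta> x) \<and> (\<forall>x. \<eta> x \<le> 1) \<and>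
    l2norm m (\<lambda>x. \<eta> x * g x - indicator A x * g x) < 1 / real (Suc n)" for n \<eta>
  have ex: "\<exists>\<eta>. P n \<eta>" for n
  proof -
    have pos: "0 < 1 / real (Suc n)" by simp
    obtain \<eta> where \<eta>: "Lip M \<eta>" "\<And>x. 0 \<le> \<eta> x" "\<And>x. \<eta> x \<le> 1"
      "l2norm m (\<lambda>x. \<eta> x * g x - indicator A x * g x) < 1 / real (Suc n)"
      by (rule Lip_approx_indicator[OF A g pos]) (rule that)
    have "P n \<eta>" unfolding P_def by (intro conjI allI \<eta>)
    then show ?thesis by blast
  qed
  define \<eta> where "\<eta> n = (SOME \<eta>. P n \<eta>)" for n
  have P: "P n (\<eta> n)" for n unfolding \<eta>_def using ex[of n] by (rule someI_ex)
  have \<eta>: "Lip M (\<eta> n)" "0 \<le> \<eta> n x" "\<eta> n x \<le> 1" "l2norm m (\<lambda>x. \<eta> n x * g x - indicator A x * g x) < 1 / real (Suc n)" for n x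
    using P[of n] by (simp_all only: P_def)
  show thesis
  proof (rule that[OF \<eta>(1,2,3)])
    show "L2_tendsto m (\<lambda>n x. \<eta> n x * g x) (\<lambda>x. indicator A x * g x)"
      unfolding L2_tendsto_iff
    proof (intro conjI allI)
      show "(\<lambda>x. \<eta> n x * g x) \<in> L2 m" for n
      proof (rule L2_bounded_mult(1)[OF g Lip_measurable[OF \<eta>(1)]])
        show "\<bar>\<eta> n x\<bar> \<le> 1" for x using \<eta>(2,3)[where n = n and x = x] by simp
      qed
      show "(\<lambda>x. indicator A x * g x) \<in> L2 m"
        by (rule L2_bounded_mult(1)[OF g, of _ 1]) (use A in \<open>auto simp: indicator_def\<close>)
      show "(\<lambda>n. l2norm m (\<lambda>x. \<eta> n x * g x - indicator A x * g x)) \<longlonglongrightarrow> 0"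
        by (rule LIMSEQ_norm_0_inverse[OF \<eta>(4)]) (rule l2norm_nonneg)
    qed
  qed
qed

text \<open>The minimum is \<open>K\<close> plus \<open>H - K\<close> restricted to the set where
  \<open>H \<le> K\<close>. Replacing the indicator of this set by Lipschitz cutoffs gives convex
  combinations, and closedness finishes.\<close>

lemma relaxed_min:
  assumes H: "relaxed f H" and K: "relaxed f K"
  shows "relaxed f (\<lambda>x. min (H x) (K x))"
proof -
  have L2: "H \<in> L2 m" "K \<in> L2 m" "f \<in> L2 m" using H K by (auto simp: relaxed_def)
  have const: "L2_tendsto m (\<lambda>n. h) h" if "h \<in> L2 m" for h using that by (simp add: L2_tendsto_iff)
  define A where "A = {x \<in> space m. H x \<le> K x}"
  have A: "A \<in> sets m"
    unfolding A_def using L2_measurable[OF L2(1)] L2_measurable[OF L2(2)] by (rule borel_measurable_le)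
  obtain \<eta> where \<eta>: "\<And>n. Lip M (\<eta> n)" "\<And>n x. 0 \<le> \<eta> n x" "\<And>n x. \<eta> n x \<le> 1"
    and lim: "L2_tendsto m (\<lambda>n x. \<eta> n x * (H x - K x)) (\<lambda>x. indicator A x * (H x - K x))"
    by (rule Lip_approx_indicator_seq[OF A L2_diff[OF L2(1,2)]]) (rule that)
  have eq: "K x + \<eta> n x * (H x - K x) = \<eta> n x * H x + (1 - \<eta> n x) * K x" for n x by (simp add: algebra_simps)
  have r: "relaxed f (\<lambda>x. K x + \<eta> n x * (H x - K x))" for n
    unfolding eq by (rule relaxed_convex[OF H K \<eta>])
  have "L2_tendsto m (\<lambda>n x. K x + \<eta> n x * (H x - K x)) (\<lambda>x. min (H x) (K x))"
  proof (rule L2_tendsto_cong[OF L2_tendsto_add[OF const[OF L2(2)] lim]])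
    show "K x + indicator A x * (H x - K x) = min (H x) (K x)" if "x \<in> space m" for x
      using that by (simp add: A_def min_def indicator_def)
  qed (rule refl)
  from relaxed_closed[OF const[OF L2(3)] this r] show ?thesis .
qed

text \<open>The conclusion is deliberately asymmetric: \<open>G\<close> is a limit of true slopes,
  yet minimal among all relaxed bounds. Hence minimality in either class is the same thing, and the
  calculus may be carried out with upper bounds only.\<close>

lemma ex_min_gradient:
  assumes "relaxed f H0"
  obtains G where "lip_limit M m f G" "\<And>H. relaxed f H \<Longrightarrow> AE x in m. G x \<le> H x"
proof -
  have fL: "f \<in> L2 m" using assms by (simp add: relaxed_def)
  \<comment> \<open>Slope norms of Lipschitz functions near \<open>f\<close>. Their infima
    \<open>a n\<close> increase with \<open>n\<close>, and the limit \<open>N\<close> is a lower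
    bound for the norm of every relaxed bound.\<close>
  define S where "S n = {l2norm m (local_lip M F) |F. Lip M F \<and> F \<in> L2 m \<and> local_lip M F \<in> L2 m \<and> l2norm m (\<lambda>x. F x - f x) < 1 / real (Suc n)}" for n
  define a where "a n = Inf (S n)" for n
  have ne: "\<exists>s\<in>S n. s \<le> l2norm m H + e" if H: "relaxed f H" and e: "e > 0" for n H e
  proof -
    have "min e (1 / real (Suc n)) > 0" using e by simp
    with H obtain F u where F: "Lip M F" "F \<in> L2 m" "u \<in> L2 m" "\<forall>x\<in>mspace M. local_lip M F x \<le> u x"
      "l2norm m (\<lambda>x. F x - f x) < min e (1 / real (Suc n))" "l2norm m (\<lambda>x. u x - H x) < min e (1 / real (Suc n))"
      unfolding relaxed_def by blast
    have l: "local_lip M F \<in> L2 m" "l2norm m (local_lip M F) \<le> l2norm m u"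
      using local_lip_L2[OF F(1,3)] F(4) by auto
    have "l2norm m u \<le> l2norm m H + e"
      using l2norm_diff_abs[OF F(3), of H] H F(6) by (auto simp: relaxed_def)
    with l F show ?thesis unfolding S_def by (intro bexI[of _ "l2norm m (local_lip M F)"]) auto
  qed
  have bdd: "bdd_below (S n)" for n by (rule bdd_belowI[of _ 0]) (auto simp: S_def)
  have Sne: "S n \<noteq> {}" for n using ne[OF assms, of 1 n] by auto
  have aH: "a n \<le> l2norm m H" if rH: "relaxed f H" for n H
  proof (rule field_le_epsilon)
    fix e :: real assume "e > 0"
    then obtain s where "s \<in> S n" "s \<le> l2norm m H + e" using ne[OF rH] by blast
    then show "a n \<le> l2norm m H + e" unfolding a_def using cInf_lower[OF _ bdd] by (meson order_trans)
  qed
  have Ssub: "S (Suc n) \<subseteq> S n" for n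
  proof -
    have "1 / real (Suc (Suc n)) \<le> 1 / real (Suc n)" by (simp add: frac_le)
    then show ?thesis unfolding S_def by (blast intro: less_le_trans)
  qed
  have inc: "incseq a" unfolding a_def by (rule incseq_SucI) (rule cInf_superset_mono[OF Sne bdd Ssub])
  have bda: "bdd_above (range a)" using aH[OF assms] by (auto intro!: bdd_aboveI2)
  define N where "N = (SUP n. a n)"
  have aN: "a \<longlonglongrightarrow> N" unfolding N_def by (rule LIMSEQ_incseq_SUP[OF bda inc])
  have aleN: "a n \<le> N" for n unfolding N_def by (rule cSUP_upper[OF _ bda]) simp
  have NH: "N \<le> l2norm m H" if "relaxed f H" for H unfolding N_def by (rule cSUP_least) (use aH[OF that] in auto)
  have "\<exists>F. Lip M F \<and> F \<in> L2 m \<and> local_lip M F \<in> L2 m \<and> l2norm m (\<lambda>x. F x - f x) < 1 / real (Suc n)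
      \<and> l2norm m (local_lip M F) < N + 1 / real (Suc n)" for n
  proof -
    have "Inf (S n) < N + 1 / real (Suc n)" using aleN[of n] unfolding a_def by (smt (verit) divide_pos_pos of_nat_0_less_iff zero_less_Suc)
    from cInf_lessD[OF Sne this] show ?thesis by (auto simp: S_def)
  qed
  then obtain F where F: "\<And>n. Lip M (F n)" "\<And>n. F n \<in> L2 m" "\<And>n. local_lip M (F n) \<in> L2 m"
    "\<And>n. l2norm m (\<lambda>x. F n x - f x) < 1 / real (Suc n)" "\<And>n. l2norm m (local_lip M (F n)) < N + 1 / real (Suc n)"
    by metis
  have Ff: "L2_tendsto m F f" using F(2,4) fL LIMSEQ_norm_0_inverse[OF F(4)] by (simp add: L2_tendsto_iff)
  have a0: "0 \<le> a n" for n unfolding a_def by (rule cInf_greatest[OF Sne]) (auto simp: S_def)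
  then have N0: "0 \<le> N" using aleN[of 0] by (meson order_trans)
  have mono1: "1 / real (Suc i) \<le> 1 / real (Suc n)" if "n \<le> i" for i n using that by (simp add: frac_le)
  \<comment> \<open>The midpoint of \<open>F i\<close> and \<open>F j\<close> is still within
    \<open>1 / real (Suc n)\<close> of \<open>f\<close>, so its slope has norm at least
    \<open>a n\<close>, while this slope is at most the mean of the two slopes. The parallelogram
    identity then bounds the difference of the slopes.\<close>
  have est: "(l2norm m (\<lambda>x. local_lip M (F i) x - local_lip M (F j) x))\<^sup>2 \<le> 4 * (N + 1 / real (Suc n))\<^sup>2 - 4 * (a n)\<^sup>2"
    if ij: "i \<ge> n" "j \<ge> n" for i j n
  proof -
    let ?K = "\<lambda>x. 1/2 * (F i x + F j x)"
    have KL: "Lip M ?K" by (intro Lip_cmult Lip_add F)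
    have K2: "?K \<in> L2 m" by (intro L2_cmult L2_add F)
    let ?u = "\<lambda>x. 1/2 * (local_lip M (F i) x + local_lip M (F j) x)"
    have uL: "?u \<in> L2 m" by (intro L2_cmult L2_add F)
    have le: "local_lip M ?K x \<le> ?u x" if x: "x \<in> mspace M" for x
    proof -
      have "local_lip M ?K x \<le> \<bar>1/2\<bar> * local_lip M (\<lambda>x. F i x + F j x) x"
        by (rule local_lip_cmult_le[OF x Lip_add[OF F(1) F(1)]])
      also have "\<dots> \<le> ?u x" using local_lip_add_le[OF x F(1) F(1), of i j] by simp
      finally show ?thesis .
    qed
    have "l2norm m (\<lambda>x. ?K x - f x) = l2norm m (\<lambda>x. 1/2 * ((F i x - f x) + (F j x - f x)))"
      by (rule arg_cong[where f="l2norm m"]) (simp add: fun_eq_iff algebra_simps)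
    also have "\<dots> \<le> 1/2 * (l2norm m (\<lambda>x. F i x - f x) + l2norm m (\<lambda>x. F j x - f x))"
      unfolding l2norm_cmult using l2norm_triangle[OF L2_diff[OF F(2) fL] L2_diff[OF F(2) fL], of i j] by simp
    also have "\<dots> < 1 / real (Suc n)"
      using add_strict_mono[OF less_le_trans[OF F(4) mono1[OF ij(1)]] less_le_trans[OF F(4) mono1[OF ij(2)]]]
      by (simp del: of_nat_Suc)
    finally have "l2norm m (local_lip M ?K) \<in> S n"
      unfolding S_def using KL K2 local_lip_L2(1)[OF KL uL le] by blast
    then have "a n \<le> l2norm m (local_lip M ?K)" unfolding a_def by (rule cInf_lower[OF _ bdd])
    also have "\<dots> \<le> l2norm m ?u" by (rule local_lip_L2(2)[OF KL uL le])
    also have "\<dots> = 1/2 * l2norm m (\<lambda>x. local_lip M (F i) x + local_lip M (F j) x)" unfolding l2norm_cmult by simp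
    finally have "2 * a n \<le> l2norm m (\<lambda>x. local_lip M (F i) x + local_lip M (F j) x)" by simp
    from power_mono[OF this, of 2] have "4 * (a n)\<^sup>2 \<le> (l2norm m (\<lambda>x. local_lip M (F i) x + local_lip M (F j) x))\<^sup>2"
      using a0[of n] by (simp add: power_mult_distrib)
    moreover have "(l2norm m (local_lip M (F i)))\<^sup>2 \<le> (N + 1 / real (Suc n))\<^sup>2" "(l2norm m (local_lip M (F j)))\<^sup>2 \<le> (N + 1 / real (Suc n))\<^sup>2"
      using F(5)[of i] F(5)[of j] mono1[OF ij(1)] mono1[OF ij(2)] by (intro power_mono; simp)+
    ultimately show ?thesis using l2norm_parallelogram[OF F(3) F(3), of i j] by linarith
  qed
  have b0: "(\<lambda>n. 4 * (N + 1 / real (Suc n))\<^sup>2 - 4 * (a n)\<^sup>2) \<longlonglongrightarrow> 4 * (N + 0)\<^sup>2 - 4 * N\<^sup>2"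
    by (intro tendsto_intros aN LIMSEQ_Suc[OF lim_1_over_n])
  obtain G where G: "L2_tendsto m (\<lambda>n. local_lip M (F n)) G"
  proof (rule L2_complete[of "\<lambda>n. local_lip M (F n)" m])
    show "local_lip M (F n) \<in> L2 m" for n by (rule F(3))
    fix e :: real assume e: "e > 0"
    have "4 * (N + 0)\<^sup>2 - 4 * N\<^sup>2 < e\<^sup>2" using e by simp
    from order_tendstoD(2)[OF b0 this] obtain n where n: "4 * (N + 1 / real (Suc n))\<^sup>2 - 4 * (a n)\<^sup>2 < e\<^sup>2"
      by (auto simp: eventually_sequentially)
    have "l2norm m (\<lambda>x. local_lip M (F i) x - local_lip M (F j) x) < e" if "i \<ge> n" "j \<ge> n" for i j
      by (rule power2_less_imp_less[OF le_less_trans[OF est[OF that] n]]) (use e in simp)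
    then show "\<exists>N. \<forall>i\<ge>N. \<forall>j\<ge>N. l2norm m (\<lambda>x. local_lip M (F i) x - local_lip M (F j) x) < e" by blast
  qed
  have lim: "lip_limit M m f G" unfolding lip_limit_def using F(1) Ff G by blast
  have rG: "relaxed f G" by (rule lip_limit_imp_relaxed[OF lim])
  have "l2norm m G \<le> N + 0"
    by (rule LIMSEQ_le[OF L2_tendsto_l2norm[OF G] tendsto_add[OF tendsto_const LIMSEQ_Suc[OF lim_1_over_n]]])
       (use F(5) less_imp_le in blast)
  then have GN: "l2norm m G \<le> N" by simp
  \<comment> \<open>The minimum of \<open>G\<close> and \<open>H\<close> is again relaxed, so its
    norm is at least \<open>N\<close>, hence at least that of \<open>G\<close>. Lying below
    \<open>G\<close>, it must equal \<open>G\<close> almost everywhere.\<close>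
  have "AE x in m. G x \<le> H x" if H: "relaxed f H" for H
  proof -
    let ?K = "\<lambda>x. min (G x) (H x)"
    have rK: "relaxed f ?K" by (rule relaxed_min[OF rG H])
    have L2: "?K \<in> L2 m" "G \<in> L2 m" using rK rG by (auto simp: relaxed_def)
    have "(l2norm m G)\<^sup>2 \<le> (l2norm m ?K)\<^sup>2" using GN NH[OF rK] by (intro power_mono) auto
    then have le: "(\<integral>x. (G x)\<^sup>2 \<partial>m) \<le> (\<integral>x. (?K x)\<^sup>2 \<partial>m)" by (simp add: l2norm_power2)
    have pw: "AE x in m. (?K x)\<^sup>2 \<le> (G x)\<^sup>2"
      using relaxed_nonneg_AE[OF H] relaxed_nonneg_AE[OF rG] by eventually_elim (auto intro!: power_mono)
    have "(\<integral>x. (G x)\<^sup>2 - (?K x)\<^sup>2 \<partial>m) = 0"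
      using le integral_mono_AE[OF _ _ pw] L2 by (simp add: L2_def)
    moreover have "AE x in m. 0 \<le> (G x)\<^sup>2 - (?K x)\<^sup>2" using pw by eventually_elim simp
    moreover have "integrable m (\<lambda>x. (G x)\<^sup>2 - (?K x)\<^sup>2)" using L2 by (simp add: L2_def)
    ultimately have "AE x in m. (G x)\<^sup>2 - (?K x)\<^sup>2 = 0" by (simp add: integral_nonneg_eq_0_iff_AE)
    then show ?thesis
      using relaxed_nonneg_AE[OF H] relaxed_nonneg_AE[OF rG]
    proof eventually_elim
      case (elim x)
      then have "(G x)\<^sup>2 = (?K x)\<^sup>2" by simp
      then have "G x = ?K x" using elim by (auto simp: power2_eq_iff_nonneg)
      then show ?case by simp
    qed
  qed
  with lim that show thesis by blast
qed

end

section \<open>Calculus of minimal weak upper gradients\<close>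

context borel_metric_measure
begin

lemma relaxed_cmult:
  assumes "relaxed f H" shows "relaxed (\<lambda>x. c * f x) (\<lambda>x. \<bar>c\<bar> * H x)"
proof -
  obtain F u where F: "\<And>n. Lip M (F n)" "L2_tendsto m F f" "L2_tendsto m u H"
    "\<And>n x. x \<in> mspace M \<Longrightarrow> local_lip M (F n) x \<le> u n x" using relaxedE[OF assms] by blast
  show ?thesis
  proof (rule relaxedI[OF Lip_cmult[OF F(1)] L2_tendsto_cmult[OF F(2)] L2_tendsto_cmult[OF F(3)]])
    fix n x assume x: "x \<in> mspace M"
    show "local_lip M (\<lambda>x. c * F n x) x \<le> \<bar>c\<bar> * u n x"
      by (rule order_trans[OF local_lip_cmult_le[OF x F(1)] mult_left_mono[OF F(4)[OF x] abs_ge_zero]])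
  qed
qed

lemma relaxed_add:
  assumes "relaxed f H" "relaxed g K" shows "relaxed (\<lambda>x. f x + g x) (\<lambda>x. H x + K x)"
proof -
  obtain F u where F: "\<And>n. Lip M (F n)" "L2_tendsto m F f" "L2_tendsto m u H"
    "\<And>n x. x \<in> mspace M \<Longrightarrow> local_lip M (F n) x \<le> u n x" using relaxedE[OF assms(1)] by blast
  obtain G v where G: "\<And>n. Lip M (G n)" "L2_tendsto m G g" "L2_tendsto m v K"
    "\<And>n x. x \<in> mspace M \<Longrightarrow> local_lip M (G n) x \<le> v n x" using relaxedE[OF assms(2)] by blast
  show ?thesis
  proof (rule relaxedI[OF Lip_add[OF F(1) G(1)] L2_tendsto_add[OF F(2) G(2)] L2_tendsto_add[OF F(3) G(3)]])
    fix n x assume x: "x \<in> mspace M"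
    show "local_lip M (\<lambda>x. F n x + G n x) x \<le> u n x + v n x"
      by (rule order_trans[OF local_lip_add_le[OF x F(1) G(1)] add_mono[OF F(4)[OF x] G(4)[OF x]]])
  qed
qed

lemma relaxed_nonexpansive:
  fixes \<psi> :: "real \<Rightarrow> real"
  assumes \<psi>: "\<And>s t. \<bar>\<psi> s - \<psi> t\<bar> \<le> \<bar>s - t\<bar>" "\<psi> 0 = 0" and "relaxed f H"
  shows "relaxed (\<lambda>x. \<psi> (f x)) H"
proof -
  obtain F u where F: "\<And>n. Lip M (F n)" "L2_tendsto m F f" "L2_tendsto m u H"
    "\<And>n x. x \<in> mspace M \<Longrightarrow> local_lip M (F n) x \<le> u n x" using relaxedE[OF assms(3)] by blast
  show ?thesis
  proof (rule relaxedI[OF Lip_compose[OF F(1) \<psi>(1)] L2_tendsto_nonexpansive[OF \<psi> F(2)] F(3)])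
    fix n x assume x: "x \<in> mspace M"
    show "local_lip M (\<lambda>x. \<psi> (F n x)) x \<le> u n x"
      by (rule order_trans[OF local_lip_compose_le[OF x F(1) \<psi>(1)] F(4)[OF x]])
  qed
qed

lemma relaxed_mult:
  assumes f: "relaxed f H"
    and \<eta>: "\<And>x. 0 \<le> \<eta> x" "\<And>x. \<eta> x \<le> 1"
    and L: "L > 0" "\<And>x y. x \<in> mspace M \<Longrightarrow> y \<in> mspace M \<Longrightarrow> \<bar>\<eta> x - \<eta> y\<bar> \<le> L * mdist M x y"
  shows "relaxed (\<lambda>x. \<eta> x * f x) (\<lambda>x. \<eta> x * H x + L * \<bar>f x\<bar>)"
proof -
  have \<eta>L: "Lip M \<eta>" by (rule LipI[OF L(2)])
  have ab: "\<bar>\<eta> x\<bar> \<le> 1" for x using \<eta>(1,2)[of x] by simp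
  obtain F u T where F: "\<And>n. Lip M (F n)" "L2_tendsto m F f" "L2_tendsto m u H"
    "\<And>n x. x \<in> mspace M \<Longrightarrow> local_lip M (F n) x \<le> u n x" "\<And>n x. \<bar>F n x\<bar> \<le> T n"
    by (rule relaxed_truncated[OF f]) (rule that)
  have b: "L2_tendsto m (\<lambda>n x. \<eta> x * A n x) (\<lambda>x. \<eta> x * B x)" if "L2_tendsto m A B" for A B
    by (rule L2_tendsto_bounded_mult[OF that Lip_measurable[OF \<eta>L] ab])
  show ?thesis
  proof (rule relaxedI[OF bounded_Lip_mult[OF \<eta>L \<eta> F(1,5)] b[OF F(2)] L2_tendsto_add[OF b[OF F(3)] L2_tendsto_cmult[OF L2_tendsto_abs[OF F(2)]]]])
    fix n x assume x: "x \<in> mspace M"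
    \<comment> \<open>A product with a cutoff is a convex combination with the zero
      function.\<close>
    have "local_lip M (\<lambda>x. \<eta> x * F n x + (1 - \<eta> x) * 0) x \<le> \<eta> x * local_lip M (F n) x + (1 - \<eta> x) * local_lip M (\<lambda>x. 0) x + L * \<bar>F n x - 0\<bar>"
      by (rule local_lip_convex_le[OF x F(1) Lip_const \<eta>(1,2) L(2,1)])
    moreover have "local_lip M (\<lambda>x. 0) x \<le> 0" by (rule local_lip_le[OF x, of 0 1]) auto
    then have "(1 - \<eta> x) * local_lip M (\<lambda>x. 0) x \<le> 0" using \<eta>(2)[of x] by (simp add: mult_nonneg_nonpos)
    moreover have "\<eta> x * local_lip M (F n) x \<le> \<eta> x * u n x" by (rule mult_left_mono[OF F(4)[OF x] \<eta>(1)])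
    ultimately show "local_lip M (\<lambda>x. \<eta> x * F n x) x \<le> \<eta> x * u n x + L * \<bar>F n x\<bar>" by simp
  qed
qed

text \<open>The weight in front of the slope of \<open>F n\<close> depends on \<open>n\<close>.
  Along an almost everywhere convergent subsequence the weight times \<open>H\<close> converges by
  domination, and the weight times \<open>u n - H\<close> is a bounded factor times a null
  sequence.\<close>

lemma relaxed_flat:
  fixes \<psi> :: "real \<Rightarrow> real"
  assumes \<psi>: "\<And>s t. \<bar>\<psi> s - \<psi> t\<bar> \<le> \<bar>s - t\<bar>" "\<psi> 0 = 0" and f: "relaxed f H"
    and flat: "\<And>s t. \<bar>s - c\<bar> < d \<Longrightarrow> \<bar>t - c\<bar> < d \<Longrightarrow> \<psi> s = \<psi> t" and d: "d > 0"
  shows "relaxed (\<lambda>x. \<psi> (f x)) (\<lambda>x. min 1 (\<bar>f x - c\<bar> / d) * H x)"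
proof -
  obtain F u where F: "\<And>n. Lip M (F n)" "L2_tendsto m F f" "L2_tendsto m u H"
    "\<And>n x. x \<in> mspace M \<Longrightarrow> local_lip M (F n) x \<le> u n x" using relaxedE[OF f] by blast
  obtain r :: "nat \<Rightarrow> nat" where r: "strict_mono r" "AE x in m. (\<lambda>n. F (r n) x) \<longlonglongrightarrow> f x"
    using L2_tendsto_AE_subseq[OF F(2)] by blast
  define \<theta> where "\<theta> s = min 1 (\<bar>s - c\<bar> / d)" for s
  have \<theta>: "0 \<le> \<theta> s" "\<bar>\<theta> s\<bar> \<le> 1" for s using d by (auto simp: \<theta>_def)
  have \<theta>c: "continuous_on UNIV \<theta>" unfolding \<theta>_def by (intro continuous_intros) (use d in auto)
  have \<theta>m: "\<theta> \<in> borel_measurable borel" by (rule borel_measurable_continuous_onI[OF \<theta>c])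
  have FL: "F n \<in> L2 m" "f \<in> L2 m" "u n \<in> L2 m" "H \<in> L2 m" for n using F(2,3) by (auto simp: L2_tendsto_def)
  have m1: "(\<lambda>x. \<theta> (F n x)) \<in> borel_measurable m" for n using measurable_compose[OF L2_measurable[OF FL(1)] \<theta>m] .
  have m2: "(\<lambda>x. \<theta> (f x)) \<in> borel_measurable m" using measurable_compose[OF L2_measurable[OF FL(2)] \<theta>m] .
  have bd: "\<bar>\<theta> (g x) * h\<bar> \<le> \<bar>h\<bar>" for g h and x :: 'a using \<theta>[of "g x"] by (simp add: abs_mult mult_left_le_one_le)
  have t1: "L2_tendsto m (\<lambda>n x. \<theta> (F (r n) x) * H x) (\<lambda>x. \<theta> (f x) * H x)"
  proof (rule L2_dominated[OF _ _ L2_abs[OF FL(4)]])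
    show "(\<lambda>x. \<theta> (F (r n) x) * H x) \<in> borel_measurable m" for n by (intro borel_measurable_times m1 L2_measurable FL)
    show "(\<lambda>x. \<theta> (f x) * H x) \<in> borel_measurable m" by (intro borel_measurable_times m2 L2_measurable FL)
    show "AE x in m. (\<lambda>n. \<theta> (F (r n) x) * H x) \<longlonglongrightarrow> \<theta> (f x) * H x"
      using r(2)
    proof eventually_elim
      case (elim x)
      show ?case
        by (rule tendsto_mult[OF continuous_on_tendsto_compose[OF \<theta>c elim] tendsto_const]) auto
    qed
    show "AE x in m. \<bar>\<theta> (F (r n) x) * H x\<bar> \<le> \<bar>H x\<bar>" for n by (rule AE_I2) (rule bd)
  qed
  have t2: "L2_tendsto m (\<lambda>n x. \<theta> (F (r n) x) * (u (r n) x - H x)) (\<lambda>x. 0)"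
    unfolding L2_tendsto_iff
  proof (intro conjI allI)
    have D: "(\<lambda>x. u (r n) x - H x) \<in> L2 m" for n by (rule L2_diff[OF FL(3,4)])
    note B = L2_bounded_mult[OF D m1 \<theta>(2)]
    show "(\<lambda>x. \<theta> (F (r n) x) * (u (r n) x - H x)) \<in> L2 m" for n by (rule B(1))
    have u0: "(\<lambda>n. l2norm m (\<lambda>x. u (r n) x - H x)) \<longlonglongrightarrow> 0"
      using L2_tendsto_subseq[OF F(3) r(1)] by (simp add: L2_tendsto_iff)
    show "(\<lambda>n. l2norm m (\<lambda>x. \<theta> (F (r n) x) * (u (r n) x - H x) - 0)) \<longlonglongrightarrow> 0"
      by (rule Lim_null_comparison[OF _ u0]) (use B(2) in \<open>simp add: always_eventually\<close>)
  qed simp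
  have t3: "L2_tendsto m (\<lambda>n x. \<theta> (F (r n) x) * u (r n) x) (\<lambda>x. \<theta> (f x) * H x)"
    by (rule L2_tendsto_cong[OF L2_tendsto_add[OF t2 t1]]) (simp_all add: right_diff_distrib)
  have "relaxed (\<lambda>x. \<psi> (f x)) (\<lambda>x. \<theta> (f x) * H x)"
  proof (rule relaxedI[OF Lip_compose[OF F(1) \<psi>(1)] L2_tendsto_nonexpansive[OF \<psi> L2_tendsto_subseq[OF F(2) r(1)]] t3])
    fix n x assume x: "x \<in> mspace M"
    have "local_lip M (\<lambda>x. \<psi> (F (r n) x)) x \<le> \<theta> (F (r n) x) * local_lip M (F (r n)) x"
      unfolding \<theta>_def by (rule local_lip_flat_le[OF x F(1) \<psi>(1) flat d])
    moreover have "\<theta> (F (r n) x) * local_lip M (F (r n)) x \<le> \<theta> (F (r n) x) * u (r n) x"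
      by (rule mult_left_mono[OF F(4)[OF x] \<theta>(1)])
    ultimately show "local_lip M (\<lambda>x. \<psi> (F (r n) x)) x \<le> \<theta> (F (r n) x) * u (r n) x" by (rule order_trans)
  qed
  then show ?thesis by (simp only: \<theta>_def)
qed

text \<open>Flattening \<open>f\<close> within \<open>d n\<close> of the value \<open>c\<close>
  changes it by at most \<open>2 * d n\<close> and suppresses its gradient near the level set. As
  \<open>d n\<close> tends to 0, the factors become 0 on the level set and 1 off it.\<close>

lemma relaxed_level_set:
  assumes f: "relaxed f H"
  shows "relaxed f (\<lambda>x. if f x = c then 0 else H x)"
proof -
  define d where "d n = 1 / real (Suc n)" for n
  have d: "d n > 0" for n by (simp add: d_def)
  have d0: "d \<longlonglongrightarrow> 0" unfolding d_def by (rule LIMSEQ_Suc[OF lim_1_over_n])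
  define cl where "cl n t = max (- d n) (min (d n) t)" for n t
  define \<psi> where "\<psi> n s = s - cl n (s - c) + cl n (- c)" for n s
  have \<psi>: "\<bar>\<psi> n s - \<psi> n t\<bar> \<le> \<bar>s - t\<bar>" "\<psi> n 0 = 0" for n s t
    using d[of n] by (auto simp: \<psi>_def cl_def min_def max_def)
  have flat: "\<psi> n s = \<psi> n t" if "\<bar>s - c\<bar> < d n" "\<bar>t - c\<bar> < d n" for n s t
    using that by (auto simp: \<psi>_def cl_def min_def max_def)
  have near: "\<bar>\<psi> n s - s\<bar> \<le> 2 * d n" for n s
    using d[of n] by (auto simp: \<psi>_def cl_def min_def max_def)
  have FL: "f \<in> L2 m" "H \<in> L2 m" using f by (auto simp: relaxed_def)
  note fm = L2_measurable[OF FL(1)] and Hm = L2_measurable[OF FL(2)]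
  show ?thesis
  proof (rule relaxed_closed[where f = "\<lambda>n x. \<psi> n (f x)" and H = "\<lambda>n x. min 1 (\<bar>f x - c\<bar> / d n) * H x"])
    show "relaxed (\<lambda>x. \<psi> n (f x)) (\<lambda>x. min 1 (\<bar>f x - c\<bar> / d n) * H x)" for n
      by (rule relaxed_flat[OF \<psi> f flat d])
    show "L2_tendsto m (\<lambda>n x. \<psi> n (f x)) f"
    proof (rule L2_dominated[OF L2_measurable[OF L2_nonexpansive[OF \<psi> FL(1)]] fm L2_abs[OF FL(1)]])
      show "AE x in m. (\<lambda>n. \<psi> n (f x)) \<longlonglongrightarrow> f x"
      proof (rule AE_I2, rule LIM_zero_cancel, rule Lim_null_comparison)
        fix x
        show "\<forall>\<^sub>F n in sequentially. norm (\<psi> n (f x) - f x) \<le> 2 * d n" using near by simp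
        show "(\<lambda>n. 2 * d n) \<longlonglongrightarrow> 0" using tendsto_mult_right_zero[OF d0] .
      qed
      have "\<bar>\<psi> n s\<bar> \<le> \<bar>s\<bar>" for n s using \<psi>(1)[of n s 0] \<psi>(2)[of n] by simp
      then show "AE x in m. \<bar>\<psi> n (f x)\<bar> \<le> \<bar>f x\<bar>" for n by (intro AE_I2)
    qed
    show "L2_tendsto m (\<lambda>n x. min 1 (\<bar>f x - c\<bar> / d n) * H x) (\<lambda>x. if f x = c then 0 else H x)"
    proof (rule L2_dominated[OF _ _ L2_abs[OF FL(2)]])
      show "(\<lambda>x. min 1 (\<bar>f x - c\<bar> / d n) * H x) \<in> borel_measurable m" for n
        using fm Hm by measurable
      show "(\<lambda>x. if f x = c then 0 else H x) \<in> borel_measurable m"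
        using fm Hm by measurable
      show "AE x in m. (\<lambda>n. min 1 (\<bar>f x - c\<bar> / d n) * H x) \<longlonglongrightarrow> (if f x = c then 0 else H x)"
      proof (rule AE_I2, rule tendsto_eventually)
        fix x
        show "\<forall>\<^sub>F n in sequentially. min 1 (\<bar>f x - c\<bar> / d n) * H x = (if f x = c then 0 else H x)"
        proof (cases "f x = c")
          case False
          then have "\<bar>f x - c\<bar> > 0" by simp
          from order_tendstoD(2)[OF d0 this] show ?thesis
            by eventually_elim (use False d in \<open>simp add: min_def\<close>)
        qed simp
      qed
      have "\<bar>min 1 (\<bar>f x - c\<bar> / d n) * H x\<bar> \<le> \<bar>H x\<bar>" for n x
        using less_imp_le[OF d[of n]] by (simp add: abs_mult mult_left_le_one_le)
      then show "AE x in m. \<bar>min 1 (\<bar>f x - c\<bar> / d n) * H x\<bar> \<le> \<bar>H x\<bar>" for n by (intro AE_I2)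
    qed
  qed
qed

section \<open>Locality and Leibniz estimates for the minimal gradient\<close>

abbreviation grad :: "('a \<Rightarrow> real) \<Rightarrow> 'a \<Rightarrow> real" where
  "grad \<equiv> min_weak_upper_gradient M m"

lemma relaxed_imp_W12:
  assumes "relaxed f H" shows "f \<in> W12 M m"
proof -
  obtain G where "lip_limit M m f G" by (rule ex_min_gradient[OF assms]) (rule that)
  then show ?thesis using assms by (auto simp: W12_def relaxed_def)
qed

lemma W12_relaxed:
  assumes "f \<in> W12 M m" obtains H where "relaxed f H"
  using assms lip_limit_imp_relaxed by (auto simp: W12_def)

lemma is_min_grad:
  assumes "f \<in> W12 M m"
  shows "is_min_weak_upper_gradient M m f (grad f)"
proof -
  obtain H where H: "relaxed f H" using W12_relaxed[OF assms] .
  obtain G where G: "lip_limit M m f G" "\<And>H. relaxed f H \<Longrightarrow> AE x in m. G x \<le> H x"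
    by (rule ex_min_gradient[OF H]) (rule that)
  have "is_min_weak_upper_gradient M m f G"
    unfolding is_min_weak_upper_gradient_def using G lip_limit_imp_relaxed by (intro conjI allI impI) auto
  then have "\<exists>G. is_min_weak_upper_gradient M m f G" by blast
  from someI_ex[OF this] show ?thesis by (simp only: min_weak_upper_gradient_def)
qed

lemma grad_relaxed:
  assumes "f \<in> W12 M m" shows "relaxed f (grad f)"
  using is_min_grad[OF assms] lip_limit_imp_relaxed by (auto simp: is_min_weak_upper_gradient_def)

lemma grad_le:
  assumes "relaxed f H" shows "AE x in m. grad f x \<le> H x"
proof -
  obtain G where G: "lip_limit M m f G" "\<And>H. relaxed f H \<Longrightarrow> AE x in m. G x \<le> H x"
    by (rule ex_min_gradient[OF assms]) (rule that)
  have "AE x in m. grad f x \<le> G x"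
    using is_min_grad[OF relaxed_imp_W12[OF assms]] G(1) by (auto simp: is_min_weak_upper_gradient_def)
  with G(2)[OF assms] show ?thesis by eventually_elim (rule order_trans)
qed

lemma grad_L2: "f \<in> W12 M m \<Longrightarrow> grad f \<in> L2 m"
  and W12_L2: "f \<in> W12 M m \<Longrightarrow> f \<in> L2 m"
  using grad_relaxed by (auto simp: relaxed_def)

lemma grad_nonneg: "f \<in> W12 M m \<Longrightarrow> AE x in m. 0 \<le> grad f x"
  using grad_relaxed relaxed_nonneg_AE by blast

lemma W12_cmult: "f \<in> W12 M m \<Longrightarrow> (\<lambda>x. c * f x) \<in> W12 M m"
  using relaxed_imp_W12[OF relaxed_cmult[OF grad_relaxed]] .

lemma W12_add: "f \<in> W12 M m \<Longrightarrow> g \<in> W12 M m \<Longrightarrow> (\<lambda>x. f x + g x) \<in> W12 M m"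
  using relaxed_imp_W12[OF relaxed_add[OF grad_relaxed grad_relaxed]] .

lemma W12_diff: "f \<in> W12 M m \<Longrightarrow> g \<in> W12 M m \<Longrightarrow> (\<lambda>x. f x - g x) \<in> W12 M m"
  using W12_add[OF _ W12_cmult[of g "-1"]] by simp

lemma grad_level_set:
  assumes f: "f \<in> W12 M m" shows "AE x in m. f x = c \<longrightarrow> grad f x = 0"
  using grad_le[OF relaxed_level_set[OF grad_relaxed[OF f], of c]] grad_nonneg[OF f]
  by eventually_elim (auto split: if_splits)

lemma grad_add_le:
  assumes "f \<in> W12 M m" "g \<in> W12 M m" shows "AE x in m. grad (\<lambda>x. f x + g x) x \<le> grad f x + grad g x"
  by (rule grad_le[OF relaxed_add[OF grad_relaxed grad_relaxed]]) (use assms in auto)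

lemma grad_cmult:
  assumes f: "f \<in> W12 M m" shows "AE x in m. grad (\<lambda>x. c * f x) x = \<bar>c\<bar> * grad f x"
proof (cases "c = 0")
  case True
  have "AE x in m. (0 :: real) = 0 \<longrightarrow> grad (\<lambda>x. 0) x = 0"
    using grad_level_set[OF W12_cmult[OF f, of 0], of 0] by simp
  then show ?thesis using True by simp
next
  case False
  have "AE x in m. grad (\<lambda>x. (1 / c) * (c * f x)) x \<le> \<bar>1 / c\<bar> * grad (\<lambda>x. c * f x) x"
    by (rule grad_le[OF relaxed_cmult[OF grad_relaxed[OF W12_cmult[OF f]]]])
  moreover have "AE x in m. grad (\<lambda>x. c * f x) x \<le> \<bar>c\<bar> * grad f x"
    by (rule grad_le[OF relaxed_cmult[OF grad_relaxed[OF f]]])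
  ultimately show ?thesis
  proof eventually_elim
    case (elim x)
    have "grad f x \<le> grad (\<lambda>x. c * f x) x / \<bar>c\<bar>" using elim(1) False by simp
    then have "\<bar>c\<bar> * grad f x \<le> grad (\<lambda>x. c * f x) x" using False by (simp add: pos_le_divide_eq mult.commute)
    with elim(2) show ?case by simp
  qed
qed

text \<open>On the set in question \<open>f - g\<close> is constant, so its gradient vanishes there
  almost everywhere; subadditivity in both directions equates the other two gradients.\<close>

lemma grad_locality:
  assumes f: "f \<in> W12 M m" and g: "g \<in> W12 M m"
  shows "AE x in m. f x = g x + c \<longrightarrow> grad f x = grad g x"
proof -
  have "AE x in m. grad (\<lambda>x. g x + (f x - g x)) x \<le> grad g x + grad (\<lambda>x. f x - g x) x"
    "AE x in m. grad (\<lambda>x. f x + (g x - f x)) x \<le> grad f x + grad (\<lambda>x. g x - f x) x"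
    by (rule grad_add_le[OF g W12_diff[OF f g]], rule grad_add_le[OF f W12_diff[OF g f]])
  then show ?thesis
    using grad_level_set[OF W12_diff[OF f g], of c] grad_level_set[OF W12_diff[OF g f], of "- c"]
    by eventually_elim auto
qed

text \<open>Form suited to piecewise affine compositions: each of countably many branches
  \<open>\<plusminus> g + c\<close> costs one null set.\<close>

lemma grad_locality_countable:
  assumes f: "f \<in> W12 M m" and g: "g \<in> W12 M m" and C: "countable C"
  shows "AE x in m. (\<exists>c\<in>C. f x = g x + c \<or> f x = - g x + c) \<longrightarrow> grad f x = grad g x"
proof -
  have g': "(\<lambda>x. (-1) * g x) \<in> W12 M m" by (rule W12_cmult[OF g])
  have "AE x in m. \<forall>c\<in>C. f x = g x + c \<longrightarrow> grad f x = grad g x"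
    using grad_locality[OF f g] C by (intro AE_ball_countable') auto
  moreover have "AE x in m. \<forall>c\<in>C. f x = (-1) * g x + c \<longrightarrow> grad f x = grad (\<lambda>x. (-1) * g x) x"
    using grad_locality[OF f g'] C by (intro AE_ball_countable') auto
  ultimately show ?thesis
    using grad_cmult[OF g, of "-1"] by eventually_elim auto
qed

text \<open>The upper estimate is the product bound for \<eta>. The lower one comes from the same
  bound for \<open>1 - \<eta>\<close>, since \<open>h\<close> is the sum of
  \<open>\<eta> * h\<close> and \<open>(1 - \<eta>) * h\<close> and gradients are
  subadditive.\<close>

lemma grad_mult_diff:
  assumes h: "h \<in> W12 M m"
    and \<eta>: "\<And>x. 0 \<le> \<eta> x" "\<And>x. \<eta> x \<le> 1"
    and L: "L > 0" "\<And>x y. x \<in> mspace M \<Longrightarrow> y \<in> mspace M \<Longrightarrow> \<bar>\<eta> x - \<eta> y\<bar> \<le> L * mdist M x y"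
  shows "(\<lambda>x. \<eta> x * h x) \<in> W12 M m"
    and "AE x in m. \<bar>grad (\<lambda>x. \<eta> x * h x) x - \<eta> x * grad h x\<bar> \<le> L * \<bar>h x\<bar>"
proof -
  have c: "0 \<le> 1 - \<eta> x" "1 - \<eta> x \<le> 1" for x using \<eta>(1,2)[of x] by auto
  have cL: "\<bar>1 - \<eta> x - (1 - \<eta> y)\<bar> \<le> L * mdist M x y" if "x \<in> mspace M" "y \<in> mspace M" for x y
    using L(2)[OF that] by simp
  have r1: "relaxed (\<lambda>x. \<eta> x * h x) (\<lambda>x. \<eta> x * grad h x + L * \<bar>h x\<bar>)"
    by (rule relaxed_mult[OF grad_relaxed[OF h] \<eta> L])
  have r2: "relaxed (\<lambda>x. (1 - \<eta> x) * h x) (\<lambda>x. (1 - \<eta> x) * grad h x + L * \<bar>h x\<bar>)"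
    by (rule relaxed_mult[OF grad_relaxed[OF h] c L(1) cL])
  show W: "(\<lambda>x. \<eta> x * h x) \<in> W12 M m" by (rule relaxed_imp_W12[OF r1])
  have eq: "(\<lambda>x. \<eta> x * h x + (1 - \<eta> x) * h x) = h" by (simp add: fun_eq_iff algebra_simps)
  show "AE x in m. \<bar>grad (\<lambda>x. \<eta> x * h x) x - \<eta> x * grad h x\<bar> \<le> L * \<bar>h x\<bar>"
    using grad_le[OF r1] grad_le[OF r2] grad_add_le[OF W relaxed_imp_W12[OF r2], unfolded eq]
  proof eventually_elim
    case (elim x)
    then have "grad h x \<le> grad (\<lambda>x. \<eta> x * h x) x + ((1 - \<eta> x) * grad h x + L * \<bar>h x\<bar>)" by linarith
    then have "\<eta> x * grad h x \<le> grad (\<lambda>x. \<eta> x * h x) x + L * \<bar>h x\<bar>" by (simp add: left_diff_distrib)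
    with elim(1) show ?case by (simp add: abs_le_iff)
  qed
qed

end

section \<open>Localising the parallelogram identity\<close>

text \<open>Cauchy's functional equation: the defect from linearity is additive and vanishes on
  integers, hence has period 1 and is bounded. Bounded multiples \<open>n * b t\<close> force it to
  be 0.\<close>

lemma additive_bounded_imp_linear:
  fixes a :: "real \<Rightarrow> real"
  assumes add: "\<And>s t. a (s + t) = a s + a t" and bd: "\<And>t. \<bar>t\<bar> \<le> 1 \<Longrightarrow> \<bar>a t\<bar> \<le> K"
  shows "a t = t * a 1"
proof -
  define b where "b t = a t - t * a 1" for t
  have badd: "b (s + t) = b s + b t" for s t by (simp add: b_def add algebra_simps)
  have b0: "b 0 = 0" using badd[of 0 0] by simp
  have b1: "b 1 = 0" by (simp add: b_def)
  have bn: "b (real n * t) = real n * b t" for n t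
    by (induction n) (simp_all add: b0 badd distrib_right)
  have bneg: "b (- t) = - b t" for t using badd[of t "- t"] b0 by simp
  have bint: "b (of_int k) = 0" for k
  proof (cases "0 \<le> k")
    case True
    then show ?thesis using bn[of "nat k" 1] b1 by simp
  next
    case False
    then show ?thesis using bn[of "nat (- k)" 1] b1 bneg[of "of_int k"] by simp
  qed
  have bb: "\<bar>b t\<bar> \<le> K + \<bar>a 1\<bar>" for t
  proof -
    have "b t = b (frac t)" using badd[of "of_int \<lfloor>t\<rfloor>" "frac t"] bint by (simp add: frac_def)
    moreover have f: "\<bar>frac t\<bar> \<le> 1" using frac_ge_0[of t] frac_lt_1[of t] by simp
    have "\<bar>b (frac t)\<bar> \<le> \<bar>a (frac t)\<bar> + \<bar>frac t * a 1\<bar>" unfolding b_def by (rule abs_triangle_ineq4)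
    moreover have "\<bar>frac t * a 1\<bar> \<le> \<bar>a 1\<bar>" unfolding abs_mult using f by (intro mult_left_le_one_le) auto
    ultimately show ?thesis using bd[OF f] by linarith
  qed
  have "b t = 0"
  proof (rule ccontr)
    assume "b t \<noteq> 0"
    then obtain n where n: "K + \<bar>a 1\<bar> < real n * \<bar>b t\<bar>" using ex_less_of_nat_mult[of "\<bar>b t\<bar>"] by auto
    have "real n * \<bar>b t\<bar> = \<bar>b (real n * t)\<bar>" by (simp add: bn abs_mult)
    with bb[of "real n * t"] n show False by simp
  qed
  then show ?thesis by (simp add: b_def)
qed

text \<open>The form is obtained by polarisation. Real homogeneity is deduced from additivity and a
  bound for small scalars, so no continuity of \<open>Q\<close> enters.\<close>

lemma jordan_von_neumann:
  fixes V :: "('a \<Rightarrow> real) set" and Q :: "('a \<Rightarrow> real) \<Rightarrow> real"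
  assumes add: "\<And>f g. f \<in> V \<Longrightarrow> g \<in> V \<Longrightarrow> (\<lambda>x. f x + g x) \<in> V"
    and cmult: "\<And>c f. f \<in> V \<Longrightarrow> (\<lambda>x. c * f x) \<in> V"
    and nonneg: "\<And>f. f \<in> V \<Longrightarrow> 0 \<le> Q f"
    and hom: "\<And>c f. f \<in> V \<Longrightarrow> Q (\<lambda>x. c * f x) = c\<^sup>2 * Q f"
    and para: "\<And>f g. f \<in> V \<Longrightarrow> g \<in> V \<Longrightarrow> Q (\<lambda>x. f x + g x) + Q (\<lambda>x. f x - g x) = 2 * Q f + 2 * Q g"
  shows "\<exists>B. (\<forall>f\<in>V. \<forall>g\<in>V. B f g = B g f) \<and>
        (\<forall>f\<in>V. \<forall>g\<in>V. \<forall>h\<in>V. B (\<lambda>x. f x + g x) h = B f h + B g h) \<and>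
        (\<forall>c. \<forall>f\<in>V. \<forall>g\<in>V. B (\<lambda>x. c * f x) g = c * B f g) \<and>
        (\<forall>f\<in>V. B f f = Q f)"
proof -
  define B where "B f g = (Q (\<lambda>x. f x + g x) - Q (\<lambda>x. f x - g x)) / 4" for f g
  have diff: "(\<lambda>x. f x - g x) \<in> V" if "f \<in> V" "g \<in> V" for f g
    using add[OF that(1) cmult[OF that(2), of "-1"]] by simp
  have neg: "Q (\<lambda>x. g x - f x) = Q (\<lambda>x. f x - g x)" if "f \<in> V" "g \<in> V" for f g
    using hom[OF diff[OF that], of "-1"] by simp
  have sym: "B f g = B g f" if "f \<in> V" "g \<in> V" for f g
    using neg[OF that] by (simp add: B_def add.commute)
  have half: "B (\<lambda>x. f x + g x) h + B (\<lambda>x. f x - g x) h = 2 * B f h" if V: "f \<in> V" "g \<in> V" "h \<in> V" for f g h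
  proof -
    have 1: "Q (\<lambda>x. f x + h x + g x) + Q (\<lambda>x. f x + h x - g x) = 2 * Q (\<lambda>x. f x + h x) + 2 * Q g"
      by (rule para[OF add[OF V(1,3)] V(2)])
    have 2: "Q (\<lambda>x. f x - h x + g x) + Q (\<lambda>x. f x - h x - g x) = 2 * Q (\<lambda>x. f x - h x) + 2 * Q g"
      by (rule para[OF diff[OF V(1,3)] V(2)])
    have e: "(\<lambda>x. f x + h x + g x) = (\<lambda>x. f x + g x + h x)" "(\<lambda>x. f x + h x - g x) = (\<lambda>x. f x - g x + h x)"
      "(\<lambda>x. f x - h x + g x) = (\<lambda>x. f x + g x - h x)" "(\<lambda>x. f x - h x - g x) = (\<lambda>x. f x - g x - h x)"
      by (simp_all add: fun_eq_iff)
    show ?thesis using 1 2 unfolding e by (simp add: B_def field_simps)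
  qed
  have anti: "B (\<lambda>x. g x - f x) h = - B (\<lambda>x. f x - g x) h" if V: "f \<in> V" "g \<in> V" "h \<in> V" for f g h
  proof -
    have "Q (\<lambda>x. g x - f x + h x) = Q (\<lambda>x. f x - g x - h x)" "Q (\<lambda>x. g x - f x - h x) = Q (\<lambda>x. f x - g x + h x)"
      using hom[OF diff[OF diff[OF V(1,2)] V(3)], of "-1"] hom[OF add[OF diff[OF V(1,2)] V(3)], of "-1"]
      by (simp_all add: algebra_simps)
    then show ?thesis by (simp add: B_def field_simps)
  qed
  \<comment> \<open>Adding \<open>half\<close> for the pair and for the swapped pair makes the terms
    with the difference cancel by \<open>anti\<close>.\<close>
  have Badd: "B (\<lambda>x. f x + g x) h = B f h + B g h" if V: "f \<in> V" "g \<in> V" "h \<in> V" for f g h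
  proof -
    have e: "(\<lambda>x. g x + f x) = (\<lambda>x. f x + g x)" by (simp add: add.commute)
    show ?thesis using half[OF V] half[OF V(2,1,3)] anti[OF V] unfolding e by linarith
  qed
  have Bhom: "B (\<lambda>x. c * f x) g = c * B f g" if V: "f \<in> V" "g \<in> V" for c f g
  proof -
    have "B (\<lambda>x. (s + t) * f x) g = B (\<lambda>x. s * f x) g + B (\<lambda>x. t * f x) g" for s t
      unfolding distrib_right by (rule Badd[OF cmult[OF V(1)] cmult[OF V(1)] V(2)])
    \<comment> \<open>The two nonnegative values of \<open>Q\<close> in the polarisation have a sum
      fixed by the parallelogram identity, which therefore bounds their difference.\<close>
    moreover have "\<bar>B (\<lambda>x. t * f x) g\<bar> \<le> Q f + Q g" if t: "\<bar>t\<bar> \<le> 1" for t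
    proof -
      have "t\<^sup>2 * Q f \<le> 1 * Q f" using t nonneg[OF V(1)] by (intro mult_right_mono) (auto simp: abs_square_le_1)
      moreover have "Q (\<lambda>x. t * f x + g x) + Q (\<lambda>x. t * f x - g x) = 2 * (t\<^sup>2 * Q f) + 2 * Q g"
        using para[OF cmult[OF V(1)] V(2), of t] hom[OF V(1), of t] by simp
      moreover have "0 \<le> Q (\<lambda>x. t * f x + g x)" "0 \<le> Q (\<lambda>x. t * f x - g x)"
        using nonneg[OF add[OF cmult[OF V(1)] V(2)]] nonneg[OF diff[OF cmult[OF V(1)] V(2)]] by auto
      ultimately show ?thesis
        using nonneg[OF V(1)] nonneg[OF V(2)] unfolding B_def abs_le_iff by (simp add: field_simps)
    qed
    ultimately have "B (\<lambda>x. c * f x) g = c * B (\<lambda>x. 1 * f x) g"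
      by (rule additive_bounded_imp_linear[of "\<lambda>c. B (\<lambda>x. c * f x) g"])
    then show ?thesis by simp
  qed
  have "B f f = Q f" if "f \<in> V" for f
    using hom[OF that, of 2] hom[OF that, of 0] by (simp add: B_def flip: mult_2)
  with sym Badd Bhom show ?thesis by (intro exI[of _ B]) simp
qed

text \<open>This is the distance of \<open>s\<close> to the nearest integer multiple of
  \<open>d\<close>: a function of slope \<plusminus>1 whose height shrinks with
  \<open>d\<close>.\<close>

definition sawtooth :: "real \<Rightarrow> real \<Rightarrow> real" where
  "sawtooth d s = d * \<bar>s / d - of_int (round (s / d))\<bar>"

lemma sawtooth_nonexpansive:
  assumes d: "d > 0" shows "\<bar>sawtooth d s - sawtooth d t\<bar> \<le> \<bar>s - t\<bar>"
proof -
  have *: "sawtooth d s - sawtooth d t \<le> \<bar>s - t\<bar>" for s t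
  proof -
    have "\<bar>s / d - of_int (round (s / d))\<bar> \<le> \<bar>s / d - of_int (round (t / d))\<bar>" by (rule round_diff_minimal)
    also have "\<dots> \<le> \<bar>s / d - t / d\<bar> + \<bar>t / d - of_int (round (t / d))\<bar>" by linarith
    finally have "sawtooth d s \<le> d * (\<bar>s / d - t / d\<bar> + \<bar>t / d - of_int (round (t / d))\<bar>)"
      unfolding sawtooth_def using d by (intro mult_left_mono) auto
    also have "\<dots> = d * \<bar>s / d - t / d\<bar> + sawtooth d t" by (simp add: sawtooth_def distrib_left)
    also have "d * \<bar>s / d - t / d\<bar> = \<bar>s - t\<bar>"
      using d by (simp add: diff_divide_distrib[symmetric])
    finally show ?thesis by simp
  qed
  show ?thesis using *[of s t] *[of t s] by (simp add: abs_le_iff abs_minus_commute)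
qed

lemma sawtooth_0 [simp]: "sawtooth d 0 = 0" by (simp add: sawtooth_def)

lemma sawtooth_le:
  assumes d: "d > 0" shows "\<bar>sawtooth d s\<bar> \<le> d"
proof -
  have "\<bar>s / d - of_int (round (s / d))\<bar> \<le> 1" using of_int_round_abs_le[of "s / d"] by (simp add: abs_minus_commute)
  then show ?thesis using d by (simp add: sawtooth_def abs_mult)
qed

lemma sawtooth_affine:
  assumes d: "d > 0"
  shows "\<exists>c\<in>range (\<lambda>k::int. d * of_int k). sawtooth d s = s + c \<or> sawtooth d s = - s + c"
proof -
  let ?r = "round (s / d)"
  have "s - d * of_int ?r = d * (s / d - of_int ?r)" using d by (simp add: right_diff_distrib)
  then have "\<bar>s - d * of_int ?r\<bar> = d * \<bar>s / d - of_int ?r\<bar>" using d by (simp only: abs_mult abs_of_pos)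
  then have "sawtooth d s = \<bar>s - d * of_int ?r\<bar>" by (simp only: sawtooth_def)
  then have "sawtooth d s = s + d * of_int (- ?r) \<or> sawtooth d s = - s + d * of_int ?r" by auto
  then show ?thesis by blast
qed

text \<open>Testing with the set where \<open>q < p\<close> makes the difference of the squares a
  nonnegative function with integral 0; exchanging the two functions gives the other
  inequality.\<close>

lemma AE_eq_if_weighted_norms_eq:
  assumes p: "p \<in> L2 m" "\<And>x. 0 \<le> p x" and q: "q \<in> L2 m" "\<And>x. 0 \<le> q x"
    and eq: "\<And>A. A \<in> sets m \<Longrightarrow> l2norm m (\<lambda>x. indicator A x * p x) = l2norm m (\<lambda>x. indicator A x * q x)"
  shows "AE x in m. p x = q x"
proof -
  have *: "AE x in m. p x \<le> q x"
    if p: "p \<in> L2 m" "\<And>x. 0 \<le> p x" and q: "q \<in> L2 m" "\<And>x. 0 \<le> q x"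
    and eq: "\<And>A. A \<in> sets m \<Longrightarrow> l2norm m (\<lambda>x. indicator A x * p x) = l2norm m (\<lambda>x. indicator A x * q x)" for p q
  proof -
    define A where "A = {x \<in> space m. q x < p x}"
    have A: "A \<in> sets m" unfolding A_def using L2_measurable[OF q(1)] L2_measurable[OF p(1)] by (rule borel_measurable_less)
    have i: "integrable m (\<lambda>x. indicator A x * (f x)\<^sup>2)" if "f \<in> L2 m" for f
      using integrable_mult_indicator[OF A L2_integrable[OF that]] by simp
    have n: "(l2norm m (\<lambda>x. indicator A x * f x))\<^sup>2 = (\<integral>x. indicator A x * (f x)\<^sup>2 \<partial>m)" for f
      unfolding l2norm_power2 by (rule Bochner_Integration.integral_cong) (auto simp: indicator_def)
    let ?h = "\<lambda>x. indicator A x * (p x)\<^sup>2 - indicator A x * (q x)\<^sup>2"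
    have "integral\<^sup>L m ?h = 0"
      using Bochner_Integration.integral_diff[OF i[OF p(1)] i[OF q(1)]] n[of p] n[of q] eq[OF A] by simp
    moreover have nn: "0 \<le> ?h x" for x
      using power_mono[of "q x" "p x" 2] q(2)[of x] by (auto simp: indicator_def A_def)
    moreover have "integrable m ?h" by (rule Bochner_Integration.integrable_diff[OF i[OF p(1)] i[OF q(1)]])
    ultimately have "AE x in m. ?h x = 0" by (subst (asm) integral_nonneg_eq_0_iff_AE) auto
    then show ?thesis
      using AE_space
    proof eventually_elim
      case (elim x)
      show ?case
      proof (rule ccontr)
        assume "\<not> p x \<le> q x"
        with elim have "(p x)\<^sup>2 = (q x)\<^sup>2" by (simp add: A_def)
        then have "p x = q x" using p(2)[of x] q(2)[of x] by (simp add: power2_eq_iff_nonneg)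
        with \<open>\<not> p x \<le> q x\<close> show False by simp
      qed
    qed
  qed
  have "AE x in m. p x \<le> q x" by (rule *[OF p q eq])
  moreover have "AE x in m. q x \<le> p x" by (rule *[OF q p eq[symmetric]])
  ultimately show ?thesis by eventually_elim simp
qed

section \<open>From the integrated to the pointwise parallelogram identity\<close>

context borel_metric_measure
begin

text \<open>One sequence of cutoffs has to work for \<open>p\<close> and \<open>q\<close> at once.
  It is chosen to approximate an indicator against \<open>p + q\<close>, and multiplying by a ratio
  bounded by 1 recovers the convergence for each function.\<close>

lemma AE_eq_if_Lip_weighted_norms_eq:
  assumes p: "p \<in> L2 m" "\<And>x. 0 \<le> p x" and q: "q \<in> L2 m" "\<And>x. 0 \<le> q x"
    and eq: "\<And>\<eta>. Lip M \<eta> \<Longrightarrow> (\<forall>x. 0 \<le> \<eta> x \<and> \<eta> x \<le> 1) \<Longrightarrow> l2norm m (\<lambda>x. \<eta> x * p x) = l2norm m (\<lambda>x. \<eta> x * q x)"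
  shows "AE x in m. p x = q x"
proof (rule AE_eq_if_weighted_norms_eq[OF p q])
  fix A assume A: "A \<in> sets m"
  let ?g = "\<lambda>x. p x + q x"
  have g: "?g \<in> L2 m" by (rule L2_add[OF p(1) q(1)])
  obtain \<eta> :: "nat \<Rightarrow> 'a \<Rightarrow> real" where \<eta>: "\<And>n. Lip M (\<eta> n)" "\<And>n x. 0 \<le> \<eta> n x" "\<And>n x. \<eta> n x \<le> 1"
    and lim: "L2_tendsto m (\<lambda>n x. \<eta> n x * ?g x) (\<lambda>x. indicator A x * ?g x)"
    by (rule Lip_approx_indicator_seq[OF A g]) (rule that)
  have conv: "(\<lambda>n. l2norm m (\<lambda>x. \<eta> n x * f x)) \<longlonglongrightarrow> l2norm m (\<lambda>x. indicator A x * f x)"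
    if f: "f \<in> L2 m" and le: "\<And>x. 0 \<le> f x" "\<And>x. f x \<le> ?g x" for f
  proof -
    \<comment> \<open>Where \<open>?g\<close> vanishes the quotient is 0 by the convention for
      division; \<open>f\<close> vanishes there as well, so \<open>kf\<close> holds
      everywhere.\<close>
    define k where "k x = f x / ?g x" for x
    have k: "\<bar>k x\<bar> \<le> 1" for x
    proof -
      have "0 \<le> ?g x" using le[of x] by linarith
      then show ?thesis unfolding k_def abs_of_nonneg[OF divide_nonneg_nonneg[OF le(1) \<open>0 \<le> ?g x\<close>]]
        using le(2)[of x] by (cases "?g x = 0") (simp_all add: divide_le_eq_1)
    qed
    have km: "k \<in> borel_measurable m"
      unfolding k_def[abs_def] using L2_measurable[OF f] L2_measurable[OF g] by (rule borel_measurable_divide)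
    have kf: "k x * (t * ?g x) = t * f x" for t x
    proof (cases "?g x = 0")
      case True
      then have "f x = 0" using le[of x] by simp
      with True show ?thesis by simp
    qed (simp add: k_def)
    from L2_tendsto_l2norm[OF L2_tendsto_bounded_mult[OF lim km k]] show ?thesis
      unfolding kf .
  qed
  have "(\<lambda>n. l2norm m (\<lambda>x. \<eta> n x * p x)) \<longlonglongrightarrow> l2norm m (\<lambda>x. indicator A x * p x)"
    by (rule conv[OF p]) (simp add: q(2))
  moreover have "(\<lambda>n. l2norm m (\<lambda>x. \<eta> n x * q x)) \<longlonglongrightarrow> l2norm m (\<lambda>x. indicator A x * q x)"
    by (rule conv[OF q]) (simp add: p(2))
  moreover have "l2norm m (\<lambda>x. \<eta> n x * p x) = l2norm m (\<lambda>x. \<eta> n x * q x)" for n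
    by (rule eq[OF \<eta>(1)]) (simp add: \<eta>)
  ultimately show "l2norm m (\<lambda>x. indicator A x * p x) = l2norm m (\<lambda>x. indicator A x * q x)"
    using LIMSEQ_unique by simp
qed

text \<open>At each point the new functions are \<open>\<plusminus> f + a\<close> and
  \<open>\<plusminus> g + b\<close>. Equal signs keep sum and difference, opposite signs exchange
  them, up to sign and constants; hence the sum of the two squared gradients is unchanged although
  the individual terms may not be.\<close>

lemma grad_sawtooth:
  assumes f: "f \<in> W12 M m" and g: "g \<in> W12 M m" and d: "d > 0"
  defines "f' \<equiv> \<lambda>x. sawtooth d (f x)" and "g' \<equiv> \<lambda>x. sawtooth d (g x)"
  shows "f' \<in> W12 M m" "g' \<in> W12 M m" "AE x in m. grad f' x = grad f x" "AE x in m. grad g' x = grad g x"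
    "AE x in m. (grad (\<lambda>x. f' x + g' x) x)\<^sup>2 + (grad (\<lambda>x. f' x - g' x) x)\<^sup>2 =
       (grad (\<lambda>x. f x + g x) x)\<^sup>2 + (grad (\<lambda>x. f x - g x) x)\<^sup>2"
proof -
  note \<psi> = sawtooth_nonexpansive[OF d] sawtooth_0[of d]
  show f': "f' \<in> W12 M m" and g': "g' \<in> W12 M m"
    unfolding f'_def g'_def by (rule relaxed_imp_W12[OF relaxed_nonexpansive[OF \<psi> grad_relaxed]], fact)+
  define C where "C = range (\<lambda>k::int. d * of_int k)"
  have C: "countable C" by (simp add: C_def)
  have af: "\<exists>c\<in>C. f' x = f x + c \<or> f' x = - f x + c" and ag: "\<exists>c\<in>C. g' x = g x + c \<or> g' x = - g x + c" for x
    using sawtooth_affine[OF d] by (simp_all add: C_def f'_def g'_def)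
  show "AE x in m. grad f' x = grad f x" "AE x in m. grad g' x = grad g x"
    using grad_locality_countable[OF f' f C] grad_locality_countable[OF g' g C] af ag by simp_all
  \<comment> \<open>Offsets that can occur between sums and differences of affine branches; a
    countable set again.\<close>
  define E where "E = (\<lambda>(a, b). a + b) ` (C \<times> C) \<union> (\<lambda>(a, b). a - b) ` (C \<times> C)"
  have E: "countable E" using C by (simp add: E_def)
  have inE: "a + b \<in> E" "a - b \<in> E" if "a \<in> C" "b \<in> C" for a b using that by (force simp: E_def)+
  let ?s = "\<lambda>x. f x + g x" and ?t = "\<lambda>x. f x - g x" and ?s' = "\<lambda>x. f' x + g' x" and ?t' = "\<lambda>x. f' x - g' x"
  note s = W12_add[OF f g] and t = W12_diff[OF f g] and s' = W12_add[OF f' g'] and t' = W12_diff[OF f' g']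
  show "AE x in m. (grad ?s' x)\<^sup>2 + (grad ?t' x)\<^sup>2 = (grad ?s x)\<^sup>2 + (grad ?t x)\<^sup>2"
    using grad_locality_countable[OF s' s E] grad_locality_countable[OF s' t E]
      grad_locality_countable[OF t' s E] grad_locality_countable[OF t' t E]
  proof eventually_elim
    case (elim x)
    obtain a where a: "a \<in> C" "f' x = f x + a \<or> f' x = - f x + a" using af[of x] by blast
    obtain b where b: "b \<in> C" "g' x = g x + b \<or> g' x = - g x + b" using ag[of x] by blast
    note ab = inE[OF a(1) b(1)]
    from a(2) b(2) have "grad ?s' x = grad ?s x \<and> grad ?t' x = grad ?t x \<or> grad ?s' x = grad ?t x \<and> grad ?t' x = grad ?s x"
    proof (elim disjE)
      assume h: "f' x = f x + a" "g' x = g x + b"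
      then have "?s' x = ?s x + (a + b)" "?t' x = ?t x + (a - b)" by simp_all
      with elim(1,4) ab show ?thesis by blast
    next
      assume h: "f' x = f x + a" "g' x = - g x + b"
      then have "?s' x = ?t x + (a + b)" "?t' x = ?s x + (a - b)" by simp_all
      with elim(2,3) ab show ?thesis by blast
    next
      assume h: "f' x = - f x + a" "g' x = g x + b"
      then have "?s' x = - ?t x + (a + b)" "?t' x = - ?s x + (a - b)" by simp_all
      with elim(2,3) ab show ?thesis by blast
    next
      assume h: "f' x = - f x + a" "g' x = - g x + b"
      then have "?s' x = - ?s x + (a + b)" "?t' x = - ?t x + (a - b)" by simp_all
      with elim(1,4) ab show ?thesis by blast
    qed
    then show ?case by auto
  qed
qed

text \<open>The uniform bound by the height yields only pointwise convergence when the measure is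
  infinite; domination by \<open>\<bar>f\<bar>\<close> turns it into convergence in norm.\<close>

lemma L2_tendsto_sawtooth:
  assumes f: "f \<in> L2 m"
  shows "(\<lambda>n. l2norm m (\<lambda>x. sawtooth (1 / real (Suc n)) (f x))) \<longlonglongrightarrow> 0"
proof -
  have d: "1 / real (Suc n) > 0" for n by simp
  note \<psi> = sawtooth_nonexpansive[OF d] sawtooth_0
  have "L2_tendsto m (\<lambda>n x. sawtooth (1 / real (Suc n)) (f x)) (\<lambda>x. 0)"
  proof (rule L2_dominated[OF L2_measurable[OF L2_nonexpansive[OF \<psi> f]] borel_measurable_const L2_abs[OF f]])
    show "AE x in m. (\<lambda>n. sawtooth (1 / real (Suc n)) (f x)) \<longlonglongrightarrow> 0"
    proof (rule AE_I2, rule Lim_null_comparison[OF _ LIMSEQ_Suc[OF lim_1_over_n]])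
      fix x
      show "\<forall>\<^sub>F n in sequentially. norm (sawtooth (1 / real (Suc n)) (f x)) \<le> 1 / real (Suc n)"
        unfolding real_norm_def by (rule always_eventually) (intro allI sawtooth_le d)
    qed
    have "\<bar>sawtooth (1 / real (Suc n)) (f x)\<bar> \<le> \<bar>f x\<bar>" for n x
      using \<psi>(1)[of n "f x" 0] by (simp del: of_nat_Suc)
    then show "AE x in m. \<bar>sawtooth (1 / real (Suc n)) (f x)\<bar> \<le> \<bar>f x\<bar>" for n by (intro AE_I2)
  qed
  then show ?thesis by (simp add: L2_tendsto_iff del: of_nat_Suc)
qed

lemma l2norm_sum_squares_cong:
  assumes "f \<in> L2 m" "g \<in> L2 m" "f' \<in> L2 m" "g' \<in> L2 m"
    and "AE x in m. (f x)\<^sup>2 + (g x)\<^sup>2 = (f' x)\<^sup>2 + (g' x)\<^sup>2"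
  shows "(l2norm m f)\<^sup>2 + (l2norm m g)\<^sup>2 = (l2norm m f')\<^sup>2 + (l2norm m g')\<^sup>2"
proof -
  have "(\<integral>x. (f x)\<^sup>2 + (g x)\<^sup>2 \<partial>m) = (\<integral>x. (f' x)\<^sup>2 + (g' x)\<^sup>2 \<partial>m)"
    by (rule integral_cong_AE) (use assms in \<open>auto simp: L2_def\<close>)
  then show ?thesis using assms by (simp add: l2norm_power2 L2_def)
qed

lemma abs_power2_diff_le:
  fixes a b e :: real
  assumes "\<bar>a - b\<bar> \<le> e" "0 \<le> b" "b \<le> K"
  shows "\<bar>a\<^sup>2 - b\<^sup>2\<bar> \<le> e * (e + 2 * K)"
proof -
  have "\<bar>a\<^sup>2 - b\<^sup>2\<bar> = \<bar>a - b\<bar> * \<bar>a + b\<bar>" by (simp add: power2_eq_square square_diff_square_factored abs_mult mult.commute)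
  also have "\<dots> \<le> e * (e + 2 * K)" using assms by (intro mult_mono) auto
  finally show ?thesis .
qed

text \<open>The hypothesis is applied to \<eta> times the sawtooth versions of \<open>f\<close> and
  \<open>g\<close>. Moving \<eta> out of each gradient costs \<open>L\<close> times the norm of a
  small function, while the weighted gradients themselves are those of \<open>f\<close> and
  \<open>g\<close>.\<close>

lemma weighted_parallelogram:
  assumes para: "\<And>f g. f \<in> W12 M m \<Longrightarrow> g \<in> W12 M m \<Longrightarrow>
      (l2norm m (grad (\<lambda>x. f x + g x)))\<^sup>2 + (l2norm m (grad (\<lambda>x. f x - g x)))\<^sup>2 = 2 * (l2norm m (grad f))\<^sup>2 + 2 * (l2norm m (grad g))\<^sup>2"
    and f: "f \<in> W12 M m" and g: "g \<in> W12 M m"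
    and \<eta>: "Lip M \<eta>" "\<And>x. 0 \<le> \<eta> x" "\<And>x. \<eta> x \<le> 1"
  shows "(l2norm m (\<lambda>x. \<eta> x * grad (\<lambda>x. f x + g x) x))\<^sup>2 + (l2norm m (\<lambda>x. \<eta> x * grad (\<lambda>x. f x - g x) x))\<^sup>2 =
      2 * (l2norm m (\<lambda>x. \<eta> x * grad f x))\<^sup>2 + 2 * (l2norm m (\<lambda>x. \<eta> x * grad g x))\<^sup>2" (is "?S = ?T")
proof -
  obtain L where L: "L > 0" "\<And>x y. x \<in> mspace M \<Longrightarrow> y \<in> mspace M \<Longrightarrow> \<bar>\<eta> x - \<eta> y\<bar> \<le> L * mdist M x y"
    using \<eta>(1) by (rule LipE) blast
  have ab: "\<bar>\<eta> x\<bar> \<le> 1" for x using \<eta>(2,3)[of x] by simp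
  have mL: "(\<lambda>x. \<eta> x * h x) \<in> L2 m" if "h \<in> L2 m" for h
    by (rule L2_bounded_mult(1)[OF that Lip_measurable[OF \<eta>(1)] ab])
  have W: "(\<lambda>x. \<eta> x * h x) \<in> W12 M m" if "h \<in> W12 M m" for h by (rule grad_mult_diff(1)[OF that \<eta>(2,3) L])
  have near: "\<bar>l2norm m (grad (\<lambda>x. \<eta> x * h x)) - l2norm m (\<lambda>x. \<eta> x * grad h x)\<bar> \<le> L * l2norm m h" if h: "h \<in> W12 M m" for h
  proof -
    let ?D = "\<lambda>x. grad (\<lambda>x. \<eta> x * h x) x - \<eta> x * grad h x"
    have G: "grad (\<lambda>x. \<eta> x * h x) \<in> L2 m" "(\<lambda>x. \<eta> x * grad h x) \<in> L2 m"
      using grad_L2[OF W[OF h]] mL[OF grad_L2[OF h]] by auto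
    have a: "AE x in m. \<bar>?D x\<bar> \<le> L * \<bar>h x\<bar>" by (rule grad_mult_diff(2)[OF h \<eta>(2,3) L])
    have b: "AE x in m. \<bar>?D x\<bar> \<le> \<bar>L * h x\<bar>" using a by eventually_elim (use L(1) in \<open>simp add: abs_mult\<close>)
    have "l2norm m ?D \<le> l2norm m (\<lambda>x. L * h x)"
      by (rule L2_bound(2)[OF L2_cmult[OF W12_L2[OF h]] L2_measurable[OF L2_diff[OF G]] b])
    then have "l2norm m ?D \<le> L * l2norm m h" using L(1) by (simp add: l2norm_cmult)
    with l2norm_diff_abs[OF G] show ?thesis by linarith
  qed
  \<comment> \<open>A bound, uniform in \<open>n\<close>, for the four weighted gradient norms:
    their squares are dominated by \<open>?S\<close> or \<open>?T\<close>, which do not change under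
    the sawtooth.\<close>
  define K where "K = sqrt ?S + sqrt ?T"
  have ST: "0 \<le> ?S" "0 \<le> ?T" by auto
  define d where "d n = 1 / real (Suc n)" for n
  have d: "d n > 0" for n by (simp add: d_def)
  define e where "e n = L * (l2norm m (\<lambda>x. sawtooth (d n) (f x)) + l2norm m (\<lambda>x. sawtooth (d n) (g x)))" for n
  have e0: "e \<longlonglongrightarrow> L * (0 + 0)"
    unfolding e_def d_def by (intro tendsto_intros L2_tendsto_sawtooth W12_L2 f g)
  \<comment> \<open>The factor 6 is the sum of the coefficients 1, 1, 2, 2 of the four squared norms
    in the identity.\<close>
  have bound: "\<bar>?S - ?T\<bar> \<le> 6 * (e n * (e n + 2 * K))" for n
  proof -
    define f' where "f' x = sawtooth (d n) (f x)" for x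
    define g' where "g' x = sawtooth (d n) (g x)" for x
    note saw = grad_sawtooth[OF f g d[of n], folded f'_def g'_def]
    note f' = saw(1) and g' = saw(2)
    note s' = W12_add[OF f' g'] and t' = W12_diff[OF f' g']
    have f'L: "f' \<in> L2 m" "g' \<in> L2 m" using W12_L2 f' g' by auto
    have E: "e n = L * (l2norm m f' + l2norm m g')" by (simp add: e_def f'_def[abs_def] g'_def[abs_def])
    let ?s = "\<lambda>x. \<eta> x * grad (\<lambda>x. f' x + g' x) x" and ?t = "\<lambda>x. \<eta> x * grad (\<lambda>x. f' x - g' x) x"
    let ?a = "\<lambda>x. \<eta> x * grad f' x" and ?b = "\<lambda>x. \<eta> x * grad g' x"
    have S': "(l2norm m ?s)\<^sup>2 + (l2norm m ?t)\<^sup>2 = ?S"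
    proof (rule l2norm_sum_squares_cong)
      show "AE x in m. (?s x)\<^sup>2 + (?t x)\<^sup>2 = (\<eta> x * grad (\<lambda>x. f x + g x) x)\<^sup>2 + (\<eta> x * grad (\<lambda>x. f x - g x) x)\<^sup>2"
        using saw(5) by eventually_elim (simp add: power_mult_distrib flip: distrib_left)
    qed (intro mL grad_L2 W12_add W12_diff f g f' g')+
    have a: "l2norm m ?a = l2norm m (\<lambda>x. \<eta> x * grad f x)"
      by (rule L2_cong_AE(2)[OF mL[OF grad_L2[OF f]] L2_measurable[OF mL[OF grad_L2[OF f']]]])
         (use saw(3) in eventually_elim, simp)
    have b: "l2norm m ?b = l2norm m (\<lambda>x. \<eta> x * grad g x)"
      by (rule L2_cong_AE(2)[OF mL[OF grad_L2[OF g]] L2_measurable[OF mL[OF grad_L2[OF g']]]])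
         (use saw(4) in eventually_elim, simp)
    have T': "2 * (l2norm m ?a)\<^sup>2 + 2 * (l2norm m ?b)\<^sup>2 = ?T" by (simp only: a b)
    have le: "y \<le> K" if "y\<^sup>2 \<le> ?S \<or> y\<^sup>2 \<le> ?T" for y
    proof -
      have "y \<le> sqrt ?S \<or> y \<le> sqrt ?T" using that real_le_rsqrt by blast
      moreover have "0 \<le> sqrt ?S" "0 \<le> sqrt ?T" using ST by simp_all
      ultimately show ?thesis unfolding K_def by linarith
    qed
    have Kb: "l2norm m ?s \<le> K" "l2norm m ?t \<le> K" "l2norm m ?a \<le> K" "l2norm m ?b \<le> K"
    proof -
      have sq: "0 \<le> (l2norm m ?s)\<^sup>2" "0 \<le> (l2norm m ?t)\<^sup>2" "0 \<le> (l2norm m ?a)\<^sup>2" "0 \<le> (l2norm m ?b)\<^sup>2" by auto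
      have "(l2norm m ?s)\<^sup>2 \<le> ?S" "(l2norm m ?t)\<^sup>2 \<le> ?S" "(l2norm m ?a)\<^sup>2 \<le> ?T" "(l2norm m ?b)\<^sup>2 \<le> ?T"
        using S' T' sq by linarith+
      then show "l2norm m ?s \<le> K" "l2norm m ?t \<le> K" "l2norm m ?a \<le> K" "l2norm m ?b \<le> K" using le by blast+
    qed
    have ee: "L * l2norm m f' \<le> e n" "L * l2norm m g' \<le> e n"
      "L * l2norm m (\<lambda>x. f' x + g' x) \<le> e n" "L * l2norm m (\<lambda>x. f' x - g' x) \<le> e n"
      unfolding E using L(1) l2norm_triangle[OF f'L] l2norm_triangle[OF f'L(1) L2_uminus[OF f'L(2)]]
      by (auto intro!: mult_left_mono)
    have p: "(l2norm m (grad (\<lambda>x. \<eta> x * (f' x + g' x))))\<^sup>2 + (l2norm m (grad (\<lambda>x. \<eta> x * (f' x - g' x))))\<^sup>2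
        = 2 * (l2norm m (grad (\<lambda>x. \<eta> x * f' x)))\<^sup>2 + 2 * (l2norm m (grad (\<lambda>x. \<eta> x * g' x)))\<^sup>2"
      using para[OF W[OF f'] W[OF g']] by (simp only: distrib_left right_diff_distrib)
    note q = abs_power2_diff_le[OF order_trans[OF near[OF s'] ee(3)] l2norm_nonneg Kb(1)]
      abs_power2_diff_le[OF order_trans[OF near[OF t'] ee(4)] l2norm_nonneg Kb(2)]
      abs_power2_diff_le[OF order_trans[OF near[OF f'] ee(1)] l2norm_nonneg Kb(3)]
      abs_power2_diff_le[OF order_trans[OF near[OF g'] ee(2)] l2norm_nonneg Kb(4)]
    show ?thesis unfolding S'[symmetric] T'[symmetric] using p q by linarith
  qed
  have "(\<lambda>n. 6 * (e n * (e n + 2 * K))) \<longlonglongrightarrow> 6 * (L * (0 + 0) * (L * (0 + 0) + 2 * K))"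
    by (intro tendsto_intros e0)
  then have "(\<lambda>n. 6 * (e n * (e n + 2 * K))) \<longlonglongrightarrow> 0" by simp
  from LIMSEQ_le_const[OF this] have "\<bar>?S - ?T\<bar> \<le> 0" using bound by blast
  then show ?thesis by linarith
qed

lemma pointwise_parallelogram:
  assumes para: "\<And>f g. f \<in> W12 M m \<Longrightarrow> g \<in> W12 M m \<Longrightarrow>
      (l2norm m (grad (\<lambda>x. f x + g x)))\<^sup>2 + (l2norm m (grad (\<lambda>x. f x - g x)))\<^sup>2 = 2 * (l2norm m (grad f))\<^sup>2 + 2 * (l2norm m (grad g))\<^sup>2"
    and f: "f \<in> W12 M m" and g: "g \<in> W12 M m"
  shows "AE x in m. (grad (\<lambda>x. f x + g x) x)\<^sup>2 + (grad (\<lambda>x. f x - g x) x)\<^sup>2 = 2 * (grad f x)\<^sup>2 + 2 * (grad g x)\<^sup>2"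
proof -
  let ?s = "grad (\<lambda>x. f x + g x)" and ?t = "grad (\<lambda>x. f x - g x)"
  have L2: "?s \<in> L2 m" "?t \<in> L2 m" "grad f \<in> L2 m" "grad g \<in> L2 m"
    by (intro grad_L2 W12_add W12_diff f g)+
  note meas = L2_measurable[OF L2(1)] L2_measurable[OF L2(2)] L2_measurable[OF L2(3)] L2_measurable[OF L2(4)]
  \<comment> \<open>Square roots turn the two sides of the identity into functions in
    \<open>L2\<close> whose weighted norms can be compared.\<close>
  define p where "p x = sqrt ((?s x)\<^sup>2 + (?t x)\<^sup>2)" for x
  define q where "q x = sqrt (2 * (grad f x)\<^sup>2 + 2 * (grad g x)\<^sup>2)" for x
  have p2: "(p x)\<^sup>2 = (?s x)\<^sup>2 + (?t x)\<^sup>2" and q2: "(q x)\<^sup>2 = 2 * (grad f x)\<^sup>2 + 2 * (grad g x)\<^sup>2" for x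
    by (simp_all add: p_def q_def)
  have pm: "p \<in> borel_measurable m" and qm: "q \<in> borel_measurable m"
    unfolding p_def[abs_def] q_def[abs_def] using meas by measurable
  have pL: "p \<in> L2 m" and qL: "q \<in> L2 m" using pm qm L2 by (auto simp: L2_def p2 q2)
  have "AE x in m. p x = q x"
  proof (rule AE_eq_if_Lip_weighted_norms_eq[OF pL _ qL])
    show "0 \<le> p x" "0 \<le> q x" for x by (simp_all add: p_def q_def)
    fix \<eta> assume \<eta>: "Lip M \<eta>" "\<forall>x. 0 \<le> \<eta> x \<and> \<eta> x \<le> 1"
    then have \<eta>01: "0 \<le> \<eta> x" "\<eta> x \<le> 1" "\<bar>\<eta> x\<bar> \<le> 1" for x by (auto simp: abs_le_iff order_trans[of _ 0])
    have i: "integrable m (\<lambda>x. (\<eta> x * h x)\<^sup>2)" if "h \<in> L2 m" for h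
      by (rule L2_integrable[OF L2_bounded_mult(1)[OF that Lip_measurable[OF \<eta>(1)] \<eta>01(3)]])
    have "(l2norm m (\<lambda>x. \<eta> x * p x))\<^sup>2 = (\<integral>x. (\<eta> x * ?s x)\<^sup>2 + (\<eta> x * ?t x)\<^sup>2 \<partial>m)"
      unfolding l2norm_power2 by (simp add: power_mult_distrib p2 distrib_left)
    also have "\<dots> = (l2norm m (\<lambda>x. \<eta> x * ?s x))\<^sup>2 + (l2norm m (\<lambda>x. \<eta> x * ?t x))\<^sup>2"
      unfolding l2norm_power2 by (rule Bochner_Integration.integral_add[OF i[OF L2(1)] i[OF L2(2)]])
    also have "\<dots> = 2 * (l2norm m (\<lambda>x. \<eta> x * grad f x))\<^sup>2 + 2 * (l2norm m (\<lambda>x. \<eta> x * grad g x))\<^sup>2"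
      by (rule weighted_parallelogram[OF para f g \<eta>(1) \<eta>01(1,2)])
    also have "\<dots> = (\<integral>x. 2 * (\<eta> x * grad f x)\<^sup>2 + 2 * (\<eta> x * grad g x)\<^sup>2 \<partial>m)"
      unfolding l2norm_power2 using i[OF L2(3)] i[OF L2(4)] by simp
    also have "\<dots> = (l2norm m (\<lambda>x. \<eta> x * q x))\<^sup>2"
      unfolding l2norm_power2 by (simp add: power_mult_distrib q2 distrib_left mult.left_commute)
    finally show "l2norm m (\<lambda>x. \<eta> x * p x) = l2norm m (\<lambda>x. \<eta> x * q x)"
      by (simp add: power2_eq_iff_nonneg)
  qed
  then show ?thesis
  proof eventually_elim
    case (elim x)
    then have "(p x)\<^sup>2 = (q x)\<^sup>2" by simp
    then show ?case by (simp only: p2 q2)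
  qed
qed

end

section \<open>Absolutely continuous curves\<close>

text \<open>\<open>integrable_ccontinuous_explicit\<close> controls averages over intervals to the
  right of a point. Applied to the reflected function it controls those to the left, and together
  they give a two-sided derivative.\<close>

lemma lebesgue_differentiation:
  fixes g :: "real \<Rightarrow> real"
  assumes g: "g integrable_on {a..b}"
  obtains N where "negligible N"
    "\<And>x. \<lbrakk>a < x; x < b; x \<notin> N\<rbrakk> \<Longrightarrow> ((\<lambda>t. integral {a..t} g) has_real_derivative g x) (at x)"
proof -
  \<comment> \<open>Extension by 0 makes the function integrable on every interval, as required for
    averages that reach beyond the endpoints.\<close>
  define f where "f x = (if x \<in> {a..b} then g x else 0)" for x
  have fU: "f integrable_on UNIV"
    using g unfolding f_def by (simp only: integrable_restrict_UNIV)
  then have f: "f integrable_on cbox c d" for c d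
    using integrable_on_subcbox by blast
  have f': "(\<lambda>x. f (- x)) integrable_on cbox c d" for c d
    using integrable_reflect[of "\<lambda>x. f (- x)" d c] f[of "-d" "-c"] by simp
  obtain N1 where N1: "negligible N1" and N1': "\<And>x e. \<lbrakk>x \<notin> N1; 0 < e\<rbrakk> \<Longrightarrow>
      \<exists>d>0. \<forall>h. 0 < h \<and> h < d \<longrightarrow> norm (integral (cbox x (x + h *\<^sub>R One)) f /\<^sub>R h ^ DIM(real) - f x) < e"
    using integrable_ccontinuous_explicit[OF f] by blast
  obtain N2 where N2: "negligible N2" and N2': "\<And>x e. \<lbrakk>x \<notin> N2; 0 < e\<rbrakk> \<Longrightarrow>
      \<exists>d>0. \<forall>h. 0 < h \<and> h < d \<longrightarrow> norm (integral (cbox x (x + h *\<^sub>R One)) (\<lambda>x. f (- x)) /\<^sub>R h ^ DIM(real) - f (- x)) < e"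
    using integrable_ccontinuous_explicit[OF f'] by blast
  show thesis
  proof
    have "negligible (uminus ` N2)"
      by (rule negligible_differentiable_image_negligible[OF _ N2]) (auto intro!: derivative_intros simp: differentiable_on_def)
    then show "negligible (N1 \<union> uminus ` N2)"
      using N1 by simp
    fix x assume x: "a < x" "x < b" "x \<notin> N1 \<union> uminus ` N2"
    have nx: "x \<notin> N1" "- x \<notin> N2" using x by force+
    have fx: "f x = g x" using x by (simp add: f_def)
    let ?F = "\<lambda>t. integral {a..t} g"
    have sub: "integral {s..t} f = ?F t - ?F s" if "a \<le> s" "s \<le> t" "t \<le> b" for s t
    proof -
      have "integral {s..t} f = integral {s..t} g"
        by (rule integral_cong) (use that in \<open>auto simp: f_def\<close>)
      moreover have "?F s + integral {s..t} g = ?F t"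
        by (rule Henstock_Kurzweil_Integration.integral_combine)
           (use that g in \<open>auto intro: integrable_subinterval_real\<close>)
      ultimately show ?thesis by linarith
    qed
    show "(?F has_real_derivative g x) (at x)"
      unfolding has_field_derivative_iff
    proof (rule LIM_I)
      fix e :: real assume e: "0 < e"
      obtain d1 where d1: "d1 > 0" "\<And>h. 0 < h \<Longrightarrow> h < d1 \<Longrightarrow> \<bar>integral {x..x+h} f / h - f x\<bar> < e"
        using N1'[OF nx(1) e] by (auto simp: divide_inverse_commute)
      obtain d2 where d2: "d2 > 0" "\<And>h. 0 < h \<Longrightarrow> h < d2 \<Longrightarrow> \<bar>integral {-x..-x+h} (\<lambda>x. f (-x)) / h - f x\<bar> < e"
        using N2'[OF nx(2) e] by (auto simp: divide_inverse_commute)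
      have refl: "integral {-x..-x+h} (\<lambda>x. f (-x)) = integral {x-h..x} f" for h
        using Henstock_Kurzweil_Integration.integral_reflect_real[of x "x-h" f] by (simp add: algebra_simps)
      let ?d = "min (min d1 d2) (min (b - x) (x - a))"
      show "\<exists>s>0. \<forall>y. y \<noteq> x \<and> norm (y - x) < s \<longrightarrow> norm ((?F y - ?F x) / (y - x) - g x) < e"
      proof (intro exI[of _ ?d] conjI allI impI)
        show "?d > 0" using x d1 d2 by simp
        fix y assume y: "y \<noteq> x \<and> norm (y - x) < ?d"
        show "norm ((?F y - ?F x) / (y - x) - g x) < e"
        proof (cases "y > x")
          case True
          then show ?thesis using d1(2)[of "y - x"] sub[of x y] y x fx by auto
        next
          case False
          then have "(?F y - ?F x) / (y - x) = integral {y..x} f / (x - y)"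
            using sub[of y x] y x by (subst minus_divide_divide[symmetric]) auto
          then show ?thesis using False d2(2)[of "x - y"] refl[of "x - y"] y x fx by auto
        qed
      qed
    qed
  qed
qed

text \<open>Both \<open>G + \<phi>\<close> and \<open>G - \<phi>\<close>, with \<open>G\<close> the primitive of \<open>g\<close>, are nondecreasing. Their Stieltjes
  measures add up to the one of \<open>2 G\<close>, so each is absolutely continuous.\<close>

lemma absolutely_continuous_imp_integral_nonneg:
  fixes \<phi> g :: "real \<Rightarrow> real"
  assumes pos: "\<And>x. 0 \<le> g x"
    and g: "g absolutely_integrable_on {a..b}" and ab: "a \<le> b"
    and \<phi>: "\<And>s t. \<lbrakk>a \<le> s; s \<le> t; t \<le> b\<rbrakk> \<Longrightarrow> \<bar>\<phi> t - \<phi> s\<bar> \<le> integral {s..t} g"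
  obtains h where "h absolutely_integrable_on {a..b}"
    "\<And>s t. \<lbrakk>a \<le> s; s \<le> t; t \<le> b\<rbrakk> \<Longrightarrow> \<phi> t - \<phi> s = integral {s..t} h"
proof -
  \<comment> \<open>Clamping to the interval makes all primitives constant outside it, so that they
    define finite measures on the whole line.\<close>
  define c where "c t = max a (min b t)" for t
  have c: "a \<le> c t" "c t \<le> b" "s \<le> t \<Longrightarrow> c s \<le> c t" for s t using ab by (auto simp: c_def)
  have cid: "c t = t" if "a \<le> t" "t \<le> b" for t using that by (auto simp: c_def)
  have contc: "continuous_on UNIV c" unfolding c_def by (intro continuous_intros)
  have gi: "g integrable_on {s..t}" if "a \<le> s" "t \<le> b" for s t
    using g that by (metis absolutely_integrable_on_def integrable_subinterval_real atLeastatMost_subset_iff)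
  define G where "G t = integral {a..c t} g" for t
  have Gdiff: "G t - G s = integral {c s..c t} g" if "s \<le> t" for s t
    using Henstock_Kurzweil_Integration.integral_combine[of a "c s" "c t" g] c that gi unfolding G_def by force
  have "continuous_on {a..b} (\<lambda>t. integral {a..t} g)"
    by (rule indefinite_integral_continuous_1) (use gi in auto)
  from continuous_on_compose2[OF this contc] have contG: "continuous_on UNIV G"
    unfolding G_def using c by (auto simp: image_subset_iff)
  have \<phi>G: "\<bar>\<phi> (c t) - \<phi> (c s)\<bar> \<le> G t - G s" if "s \<le> t" for s t
    using \<phi>[of "c s" "c t"] c that Gdiff[OF that] by auto
  have cont\<phi>: "continuous_on UNIV (\<lambda>t. \<phi> (c t))"
    unfolding continuous_on_iff
  proof (intro ballI allI impI)
    fix x e :: real assume "0 < e"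
    then obtain d where d: "d>0" "\<And>y. dist y x < d \<Longrightarrow> dist (G y) (G x) < e"
      using contG unfolding continuous_on_iff by (meson UNIV_I)
    have "dist (\<phi> (c y)) (\<phi> (c x)) < e" if "dist y x < d" for y
      using d(2)[OF that] \<phi>G[of x y] \<phi>G[of y x] unfolding dist_real_def by linarith
    then show "\<exists>d>0. \<forall>x'\<in>UNIV. dist x' x < d \<longrightarrow> dist (\<phi> (c x')) (\<phi> (c x)) < e"
      using d(1) by blast
  qed
  define H1 where "H1 t = G t + \<phi> (c t)" for t
  define H2 where "H2 t = G t - \<phi> (c t)" for t
  have H: "mono H1" "mono H2"
    using \<phi>G by (auto intro!: monoI simp: H1_def H2_def abs_le_iff) (smt (verit))+
  have contH: "continuous_on UNIV H1" "continuous_on UNIV H2"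
    unfolding H1_def H2_def by (intro continuous_intros contG cont\<phi>)+
  have rc: "continuous (at_right x) H1" "continuous (at_right x) H2" for x
    using contH by (auto simp: continuous_on_eq_continuous_at continuous_at_imp_continuous_within)
  define \<mu>1 where "\<mu>1 = interval_measure H1"
  define \<mu>2 where "\<mu>2 = interval_measure H2"
  have Ioc: "emeasure \<mu>1 {s<..t} = ennreal (H1 t - H1 s)" "emeasure \<mu>2 {s<..t} = ennreal (H2 t - H2 s)" if "s \<le> t" for s t
    unfolding \<mu>1_def \<mu>2_def using emeasure_interval_measure_Ioc[OF that] H rc by (auto simp: mono_def)
  have [simp]: "sets \<mu>1 = sets borel" "sets \<mu>2 = sets borel" "space \<mu>1 = UNIV" "space \<mu>2 = UNIV"
    by (auto simp: \<mu>1_def \<mu>2_def)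
  have gm: "(\<lambda>x. indicator {a..b} x * \<bar>g x\<bar>) \<in> borel_measurable lebesgue"
    using set_integrable_abs[OF g] unfolding set_integrable_def by auto
  \<comment> \<open>The function \<open>g\<close> is only Lebesgue measurable, whereas the Stieltjes
    measures live on Borel sets; \<open>k\<close> is a Borel version of it.\<close>
  obtain k where k: "k \<in> borel_measurable lborel" "AE x in lborel. indicator {a..b} x * \<bar>g x\<bar> = k x"
    using completion_ex_borel_measurable_real[OF gm] by blast
  define \<nu> where "\<nu> = density lborel (\<lambda>x. ennreal (2 * \<bar>k x\<bar>))"
  have [simp]: "sets \<nu> = sets borel" "space \<nu> = UNIV" by (auto simp: \<nu>_def)
  have kae: "AE x in lebesgue. indicator {a..b} x * \<bar>g x\<bar> = k x" using k(2) by (rule AE_completion)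
  have kint: "integrable lborel k"
  proof -
    have "integrable lebesgue (\<lambda>x. indicator {a..b} x * \<bar>g x\<bar>)"
      using set_integrable_abs[OF g] unfolding set_integrable_def by auto
    then have "integrable lebesgue k"
      by (rule Bochner_Integration.integrable_cong_AE_imp) (use k kae in \<open>auto intro: measurable_completion\<close>)
    then show ?thesis using k(1) by (simp add: integrable_completion)
  qed
  have kcap: "(\<integral>\<^sup>+x. ennreal (2 * \<bar>k x\<bar>) * indicator {s<..t} x \<partial>lborel) = ennreal (2 * (G t - G s))" if st: "s \<le> t" for s t
  proof -
    have "(\<integral>\<^sup>+x. ennreal (2 * \<bar>k x\<bar>) * indicator {s<..t} x \<partial>lborel)
        = (\<integral>\<^sup>+x. ennreal (2 * \<bar>k x\<bar>) * indicator {s<..t} x \<partial>lebesgue)"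
      using k(1) by (intro nn_integral_completion[symmetric])
    also have "\<dots> = (\<integral>\<^sup>+x. ennreal (2 * (indicator {c s..c t} x *\<^sub>R g x)) \<partial>lebesgue)"
    proof (rule nn_integral_cong_AE)
      \<comment> \<open>Only at these points can the half-open interval and the clamped closed
        interval disagree where \<open>g\<close> matters.\<close>
      have "negligible {a, b, s}" by simp
      then have "AE x in lebesgue. x \<notin> {a, b, s}"
        unfolding negligible_iff_null_sets by (rule AE_not_in)
      with kae show "AE x in lebesgue. ennreal (2 * \<bar>k x\<bar>) * indicator {s<..t} x = ennreal (2 * (indicator {c s..c t} x *\<^sub>R g x))"
      proof eventually_elim
        case (elim x)
        then have "k x = indicator {a..b} x * g x" using pos by simp
        with elim show ?case using st pos[of x]
          by (auto simp: c_def split: split_indicator)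
      qed
    qed
    also have "\<dots> = ennreal (2 * set_lebesgue_integral lebesgue {c s..c t} g)"
    proof -
      have si: "set_integrable lebesgue {c s..c t} g"
        by (rule absolutely_integrable_on_subinterval[OF g]) (use c in auto)
      then show ?thesis
        unfolding set_lebesgue_integral_def set_integrable_def
        by (subst nn_integral_eq_integral) (use pos in auto)
    qed
    also have "set_lebesgue_integral lebesgue {c s..c t} g = G t - G s"
      using set_lebesgue_integral_eq_integral(2)[OF absolutely_integrable_on_subinterval[OF g]] c Gdiff[OF st]
      by auto
    finally show ?thesis .
  qed
  have \<nu>Ioc: "emeasure \<nu> {s<..t} = ennreal (2 * (G t - G s))" if "s \<le> t" for s t
    unfolding \<nu>_def using k(1) kcap[OF that] by (subst emeasure_density) auto
  let ?J = "\<lambda>n. {- real n<..real n}"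
  have J: "incseq ?J" "(\<Union>n. ?J n) = UNIV"
  proof -
    show "(\<Union>n. ?J n) = UNIV"
    proof -
      have "x \<in> (\<Union>n. ?J n)" for x :: real
      proof -
        obtain n where "\<bar>x\<bar> < real n" using reals_Archimedean2 by blast
        then have "x \<in> ?J n" by auto
        then show ?thesis by blast
      qed
      then show ?thesis by blast
    qed
  qed (auto simp: incseq_def)
  have ev: "\<forall>\<^sub>F n in sequentially. c (real n) = b \<and> c (- real n) = a"
  proof -
    obtain n0 where n0: "\<bar>a\<bar> + \<bar>b\<bar> < real n0" using reals_Archimedean2 by blast
    show ?thesis
      using eventually_ge_at_top[of n0]
    proof eventually_elim
      case (elim n)
      then have "real n0 \<le> real n" by simp
      with n0 ab show ?case unfolding c_def by linarith
    qed
  qed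
  have UN: "emeasure M UNIV = ennreal C"
    if "sets M = sets borel" "\<And>n. emeasure M (?J n) = ennreal (f (real n) - f (- real n))"
      "\<forall>\<^sub>F n in sequentially. f (real n) - f (- real n) = C" for M :: "real measure" and f C
  proof (rule LIMSEQ_unique)
    show "(\<lambda>n. emeasure M (?J n)) \<longlonglongrightarrow> emeasure M UNIV"
      using Lim_emeasure_incseq[of ?J M] J that(1) by (simp add: image_subset_iff)
    show "(\<lambda>n. emeasure M (?J n)) \<longlonglongrightarrow> ennreal C"
      by (rule tendsto_eventually) (use that(3) in \<open>simp add: that(2) eventually_mono\<close>)
  qed
  have "\<forall>\<^sub>F n in sequentially. H1 (real n) - H1 (- real n) = H1 b - H1 a"
    "\<forall>\<^sub>F n in sequentially. H2 (real n) - H2 (- real n) = H2 b - H2 a"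
    "\<forall>\<^sub>F n in sequentially. 2 * G (real n) - 2 * G (- real n) = 2 * G b - 2 * G a"
    using ev by (eventually_elim, simp add: H1_def H2_def G_def cid ab)+
  then have tot: "emeasure \<mu>1 UNIV = ennreal (H1 b - H1 a)" "emeasure \<mu>2 UNIV = ennreal (H2 b - H2 a)"
    "emeasure \<nu> UNIV = ennreal (2 * G b - 2 * G a)"
    by (auto intro!: UN simp: Ioc \<nu>Ioc)
  have split: "ennreal (H1 t - H1 s) + ennreal (H2 t - H2 s) = ennreal (2 * (G t - G s))" if "s \<le> t" for s t
    using H that by (subst ennreal_plus[symmetric]) (auto simp: mono_def H1_def H2_def)
  \<comment> \<open>Agreement on half-open intervals extends to Borel sets by the Dynkin argument;
    the step for complements subtracts, and this needs the finite total masses in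
    \<open>tot\<close>.\<close>
  have sum: "emeasure \<mu>1 A + emeasure \<mu>2 A = emeasure \<nu> A" if "A \<in> sets borel" for A
  proof -
    have int: "Int_stable (range (\<lambda>(s, t). {s<..t::real}))"
    proof (rule Int_stableI, safe)
      fix s t s' t' :: real
      have "{s<..t} \<inter> {s'<..t'} = (\<lambda>(s, t). {s<..t}) (max s s', min t t')" by auto
      then show "{s<..t} \<inter> {s'<..t'} \<in> range (\<lambda>(s, t). {s<..t})" by (metis rangeI)
    qed
    have gen: "A \<in> sigma_sets UNIV (range (\<lambda>(s, t). {s<..t::real}))"
      using that by (simp add: borel_sigma_sets_Ioc)
    have "range (\<lambda>(s, t). {s<..t::real}) \<subseteq> Pow UNIV" by simp
    from int this gen show ?thesis
    proof (induction rule: sigma_sets_induct_disjoint)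
      case (basic A)
      then obtain s t where "A = {s<..t}" by auto
      then show ?case
        using split[of s t] by (cases "s \<le> t") (auto simp: Ioc \<nu>Ioc)
    next
      case (compl A)
      then have A: "A \<in> sets borel" by (simp add: borel_sigma_sets_Ioc)
      have m: "emeasure \<mu>1 A + emeasure \<mu>1 (UNIV - A) = emeasure \<mu>1 UNIV"
        "emeasure \<mu>2 A + emeasure \<mu>2 (UNIV - A) = emeasure \<mu>2 UNIV"
        "emeasure \<nu> A + emeasure \<nu> (UNIV - A) = emeasure \<nu> UNIV"
        using A by (subst plus_emeasure; auto)+
      have "emeasure \<nu> A + (emeasure \<mu>1 (UNIV - A) + emeasure \<mu>2 (UNIV - A))
        = emeasure \<nu> A + emeasure \<nu> (UNIV - A)"
      proof -
        have "emeasure \<mu>1 UNIV + emeasure \<mu>2 UNIV = emeasure \<nu> UNIV"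
          unfolding tot using split[OF ab] by (simp add: algebra_simps)
        then have "emeasure \<nu> A + (emeasure \<mu>1 (UNIV - A) + emeasure \<mu>2 (UNIV - A)) = emeasure \<nu> UNIV"
          unfolding compl.IH[symmetric] m(1)[symmetric] m(2)[symmetric] by (simp add: ac_simps)
        then show ?thesis unfolding m(3) .
      qed
      moreover have "emeasure \<nu> A \<noteq> top"
      proof -
        have "emeasure \<nu> A \<le> emeasure \<nu> UNIV" by (rule emeasure_mono) auto
        then show ?thesis unfolding tot(3) using ennreal_neq_top neq_top_trans by blast
      qed
      ultimately show ?case by (simp add: ennreal_add_left_cancel)
    next
      case (union A)
      then have A: "range A \<subseteq> sets borel" by (auto simp: borel_sigma_sets_Ioc)
      have "emeasure M (\<Union>i. A i) = (\<Sum>i. emeasure M (A i))" if "sets M = sets borel" for M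
        by (rule suminf_emeasure[symmetric]) (use that A union in auto)
      then show ?case using union(3) by (simp add: suminf_add)
    qed auto
  qed
  have "absolutely_continuous lborel \<mu>1"
    unfolding absolutely_continuous_def
  proof
    fix A :: "real set" assume A: "A \<in> null_sets lborel"
    have "absolutely_continuous lborel \<nu>"
      unfolding \<nu>_def by (rule absolutely_continuousI_density) (use k in auto)
    with A have "emeasure \<nu> A = 0" by (auto simp: absolutely_continuous_def)
    then show "A \<in> null_sets \<mu>1" using sum[of A] A by (auto simp: null_sets_def)
  qed
  then obtain f where f: "f \<in> borel_measurable lborel" "density lborel f = \<mu>1"
    using sigma_finite_measure.Radon_Nikodym[OF sigma_finite_lborel, of \<mu>1] by auto
  have fin: "(\<integral>\<^sup>+x. f x \<partial>lborel) \<noteq> \<infinity>"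
    using tot(1) f by (subst (asm) f(2)[symmetric]) (auto simp: emeasure_density)
  define h where "h x = enn2real (f x)" for x
  have fh: "AE x in lborel. f x = ennreal (h x)"
    using nn_integral_PInf_AE[OF f(1) fin] by eventually_elim (simp add: h_def less_top)
  have hm: "h \<in> borel_measurable lborel" using f(1) by (simp add: h_def[abs_def])
  have hi: "integrable lborel h"
  proof (rule integrableI_nonneg[OF hm])
    show "(\<integral>\<^sup>+x. ennreal (h x) \<partial>lborel) < \<infinity>"
      using fin fh by (subst nn_integral_cong_AE[where v = f]) (auto simp: less_top)
  qed (simp add: h_def)
  have hc: "integral {s..t} h = H1 t - H1 s" if "s \<le> t" for s t
  proof -
    have si: "set_integrable lborel {s<..t} h"
      unfolding set_integrable_def by (rule integrable_mult_indicator[OF _ hi]) simp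
    have "ennreal (H1 t - H1 s) = (\<integral>\<^sup>+x. f x * indicator {s<..t} x \<partial>lborel)"
      using f by (subst Ioc(1)[OF that, symmetric], subst f(2)[symmetric]) (auto simp: emeasure_density)
    also have "\<dots> = (\<integral>\<^sup>+x. ennreal (indicator {s<..t} x *\<^sub>R h x) \<partial>lborel)"
      by (rule nn_integral_cong_AE, use fh in eventually_elim) (auto split: split_indicator)
    also have "\<dots> = ennreal (set_lebesgue_integral lborel {s<..t} h)"
      unfolding set_lebesgue_integral_def
      by (rule nn_integral_eq_integral) (use si in \<open>auto simp: set_integrable_def h_def\<close>)
    finally have "set_lebesgue_integral lborel {s<..t} h = H1 t - H1 s"
      using H(1) that by (subst (asm) ennreal_inj) (auto simp: mono_def set_lebesgue_integral_def h_def intro!: integral_nonneg)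
    then have "integral {s<..t} h = H1 t - H1 s"
      using set_borel_integral_eq_integral(2)[OF si] by simp
    moreover have "integral {s<..t} h = integral {s..t} h"
      by (rule integral_spike_set; rule negligible_subset[of "{s}"]) auto
    ultimately show ?thesis by simp
  qed
  have habs: "h absolutely_integrable_on {s..t}" for s t
    unfolding set_integrable_def by (rule integrable_mult_indicator) (use hi hm in \<open>auto simp: integrable_completion\<close>)
  show thesis
  proof
    \<comment> \<open>The Radon-Nikodym density \<open>h\<close> belongs to the primitive of
      \<open>g\<close> plus \<phi>, so the density of \<phi> is \<open>h - g\<close>.\<close>
    show "(\<lambda>x. h x - g x) absolutely_integrable_on {a..b}"
      by (rule set_integral_diff(1)[OF habs g])
    fix s t assume st: "a \<le> s" "s \<le> t" "t \<le> b"
    have "integral {s..t} (\<lambda>x. h x - g x) = integral {s..t} h - integral {s..t} g"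
      by (rule Henstock_Kurzweil_Integration.integral_diff)
         (use habs gi st in \<open>auto simp: absolutely_integrable_on_def\<close>)
    then show "\<phi> t - \<phi> s = integral {s..t} (\<lambda>x. h x - g x)"
      using hc[OF st(2)] Gdiff[OF st(2)] st by (simp add: cid H1_def)
  qed
qed

lemma absolutely_continuous_imp_integral:
  fixes \<phi> g :: "real \<Rightarrow> real"
  assumes g: "g absolutely_integrable_on {a..b}" and ab: "a \<le> b"
    and \<phi>: "\<And>s t. \<lbrakk>a \<le> s; s \<le> t; t \<le> b\<rbrakk> \<Longrightarrow> \<bar>\<phi> t - \<phi> s\<bar> \<le> integral {s..t} g"
  obtains h where "h absolutely_integrable_on {a..b}"
    "\<And>s t. \<lbrakk>a \<le> s; s \<le> t; t \<le> b\<rbrakk> \<Longrightarrow> \<phi> t - \<phi> s = integral {s..t} h"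
proof (rule absolutely_continuous_imp_integral_nonneg[of "\<lambda>x. \<bar>g x\<bar>" a b \<phi>])
  show ga: "(\<lambda>x. \<bar>g x\<bar>) absolutely_integrable_on {a..b}"
    using g by (rule set_integrable_abs)
  fix s t assume st: "a \<le> s" "s \<le> t" "t \<le> b"
  have "integral {s..t} g \<le> integral {s..t} (\<lambda>x. \<bar>g x\<bar>)"
    using absolutely_integrable_on_subinterval[OF g, of s t] absolutely_integrable_on_subinterval[OF ga, of s t] st
    by (intro integral_le) (auto simp: absolutely_integrable_on_def)
  then show "\<bar>\<phi> t - \<phi> s\<bar> \<le> integral {s..t} (\<lambda>x. \<bar>g x\<bar>)"
    using \<phi>[OF st] by simp
qed (use ab that in auto)

text \<open>The integrable function of \<open>ac_curve\<close> becomes an explicit argument. Curves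
  can then be reversed, concatenated and estimated with any convenient bound, without computing
  their speed.\<close>

definition speed_bound :: "'a metric \<Rightarrow> (real \<Rightarrow> 'a) \<Rightarrow> (real \<Rightarrow> real) \<Rightarrow> bool" where
  "speed_bound M \<gamma> g \<longleftrightarrow> \<gamma> \<in> {0..1} \<rightarrow> mspace M \<and> g absolutely_integrable_on {0..1} \<and>
     (\<forall>s t. 0 \<le> s \<and> s \<le> t \<and> t \<le> 1 \<longrightarrow> mdist M (\<gamma> s) (\<gamma> t) \<le> integral {s..t} g)"

lemma ac_curve_iff_speed_bound: "ac_curve M \<gamma> \<longleftrightarrow> (\<exists>g. speed_bound M \<gamma> g)"
proof -
  have "set_lebesgue_integral lebesgue {s..t} g = integral {s..t} g"
    if "g absolutely_integrable_on {0..1}" "0 \<le> s" "s \<le> t" "t \<le> 1" for g :: "real \<Rightarrow> real" and s t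
    by (rule set_lebesgue_integral_eq_integral(2)) (use that in \<open>auto intro: absolutely_integrable_on_subinterval\<close>)
  then show ?thesis
    unfolding ac_curve_def speed_bound_def by (metis (no_types, lifting))
qed

lemma has_real_derivative_imp_abs_quotient_tendsto:
  fixes f :: "real \<Rightarrow> real"
  assumes "(f has_real_derivative D) (at t)"
  shows "((\<lambda>s. \<bar>f s - f t\<bar> / \<bar>s - t\<bar>) \<longlongrightarrow> \<bar>D\<bar>) (at t)"
  using tendsto_rabs[OF assms[unfolded has_field_derivative_iff]] by simp

lemma speed_bound_mdist_le:
  assumes "speed_bound M \<gamma> g" "0 \<le> s" "s \<le> 1" "0 \<le> t" "t \<le> 1"
  shows "mdist M (\<gamma> s) (\<gamma> t) \<le> \<bar>integral {0..s} g - integral {0..t} g\<bar>"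
proof -
  have gi: "g integrable_on {a..b}" if "0 \<le> a" "b \<le> 1" for a b
    using assms(1) that unfolding speed_bound_def
    by (metis absolutely_integrable_on_def integrable_subinterval_real atLeastatMost_subset_iff)
  have *: "mdist M (\<gamma> s) (\<gamma> t) \<le> \<bar>integral {0..s} g - integral {0..t} g\<bar>"
    if "0 \<le> s" "s \<le> t" "t \<le> 1" for s t
  proof -
    have "integral {0..s} g + integral {s..t} g = integral {0..t} g"
      by (rule Henstock_Kurzweil_Integration.integral_combine) (use that gi in auto)
    moreover have "mdist M (\<gamma> s) (\<gamma> t) \<le> integral {s..t} g"
      using assms(1) that unfolding speed_bound_def by blast
    ultimately show ?thesis by linarith
  qed
  show ?thesis
    using *[of s t] *[of t s] assms by (cases "s \<le> t") (auto simp: mdist_commute abs_minus_commute)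
qed

lemma speed_bound_imp_continuous:
  assumes "speed_bound M \<gamma> g"
  shows "continuous_map (top_of_set {0..1}) (mtopology_of M) \<gamma>"
proof -
  have "continuous_on {0..1} (\<lambda>t. integral {0..t} g)"
    using assms unfolding speed_bound_def
    by (intro indefinite_integral_continuous_1) (auto simp: absolutely_integrable_on_def)
  note cont = this[unfolded continuous_on_iff, rule_format]
  have "\<exists>U. openin (top_of_set {0..1}) U \<and> t \<in> U \<and> (\<forall>s\<in>U. \<gamma> s \<in> mball_of M (\<gamma> t) e)"
    if t: "t \<in> {0..1}" and e: "e > 0" for t e
  proof -
    obtain d where d: "d > 0" "\<And>s. s \<in> {0..1} \<Longrightarrow> dist s t < d \<Longrightarrow> dist (integral {0..s} g) (integral {0..t} g) < e"
      using cont[OF t e] by blast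
    have "\<gamma> s \<in> mball_of M (\<gamma> t) e" if s: "s \<in> {0..1}" "dist s t < d" for s
      using speed_bound_mdist_le[OF assms, of t s] d(2)[OF s] s t assms
      by (auto simp: speed_bound_def dist_real_def)
    then show ?thesis
      by (intro exI[of _ "{0..1} \<inter> ball t d"]) (use t d in \<open>auto simp: dist_commute\<close>)
  qed
  moreover have "\<gamma> \<in> {0..1} \<rightarrow> mspace M" using assms by (simp add: speed_bound_def)
  ultimately show ?thesis
    by (auto simp: mball_of_def mtopology_of_def Metric_space.continuous_map_to_metric Pi_iff)
qed

text \<open>The speed is the supremum over a dense set of points \<open>q\<close> on the curve of the derivatives of
  \<open>t \<mapsto> d (\<gamma> t) q\<close>.\<close>

lemma metric_speed_properties:
  assumes sb: "speed_bound M \<gamma> g"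
  obtains N where "negligible N"
    "\<And>t. t \<in> {0..1} - N \<Longrightarrow> 0 \<le> metric_speed M \<gamma> t \<and> metric_speed M \<gamma> t \<le> g t"
    "speed_bound M \<gamma> (metric_speed M \<gamma>)"
proof -
  have \<gamma>: "\<gamma> t \<in> mspace M" if "0 \<le> t" "t \<le> 1" for t using sb that by (auto simp: speed_bound_def)
  have g: "g absolutely_integrable_on {0..1}" using sb by (auto simp: speed_bound_def)
  have dle: "mdist M (\<gamma> s) (\<gamma> t) \<le> integral {s..t} g" if "0 \<le> s" "s \<le> t" "t \<le> 1" for s t
    using sb that by (auto simp: speed_bound_def)
  \<comment> \<open>Rational parameters give a countable set of points of the curve that is dense in
    it by continuity; no other points of the space are tested.\<close>
  define q where "q = from_nat_into (\<rat> \<inter> {0..1::real})"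
  have "countable (\<rat> \<inter> {0..1::real})" "\<rat> \<inter> {0..1::real} \<noteq> {}"
    using countable_rat Rats_0 by force+
  then have q: "range q = \<rat> \<inter> {0..1}" unfolding q_def by (rule range_from_nat_into[rotated])
  then have q01: "0 \<le> q i" "q i \<le> 1" for i by auto
  define \<phi> where "\<phi> i t = mdist M (\<gamma> t) (\<gamma> (q i))" for i t
  have \<phi>d: "\<bar>\<phi> i t - \<phi> i s\<bar> \<le> mdist M (\<gamma> s) (\<gamma> t)" if "0 \<le> s" "s \<le> 1" "0 \<le> t" "t \<le> 1" for i s t
    using mdist_triangle[of "\<gamma> t" M "\<gamma> s" "\<gamma> (q i)"] mdist_triangle[of "\<gamma> s" M "\<gamma> t" "\<gamma> (q i)"] that q01[of i] \<gamma>
    by (auto simp: \<phi>_def mdist_commute abs_le_iff)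
  have "\<exists>h. h absolutely_integrable_on {0..1} \<and>
      (\<forall>s t. 0 \<le> s \<longrightarrow> s \<le> t \<longrightarrow> t \<le> 1 \<longrightarrow> \<phi> i t - \<phi> i s = integral {s..t} h)" for i
  proof -
    have "\<bar>\<phi> i t - \<phi> i s\<bar> \<le> integral {s..t} g" if "0 \<le> s" "s \<le> t" "t \<le> 1" for s t
      using \<phi>d[of s t i] dle[OF that] that by simp
    from absolutely_continuous_imp_integral[OF g zero_le_one this] show ?thesis by metis
  qed
  then obtain h where h: "\<And>i. h i absolutely_integrable_on {0..1}"
     and h\<phi>: "\<And>i s t. 0 \<le> s \<Longrightarrow> s \<le> t \<Longrightarrow> t \<le> 1 \<Longrightarrow> \<phi> i t - \<phi> i s = integral {s..t} (h i)"
    by metis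
  have "\<exists>N. negligible N \<and> (\<forall>t. 0 < t \<longrightarrow> t < 1 \<longrightarrow> t \<notin> N \<longrightarrow> (\<phi> i has_real_derivative h i t) (at t))" for i
  proof -
    obtain N where N: "negligible N" "\<And>x. \<lbrakk>0 < x; x < 1; x \<notin> N\<rbrakk> \<Longrightarrow> ((\<lambda>t. integral {0..t} (h i)) has_real_derivative h i x) (at x)"
      using lebesgue_differentiation[of "h i" 0 1] h[of i] by (auto simp: absolutely_integrable_on_def)
    have "(\<phi> i has_real_derivative h i t) (at t)" if t: "0 < t" "t < 1" "t \<notin> N" for t
    proof -
      have "((\<lambda>t. \<phi> i 0 + integral {0..t} (h i)) has_real_derivative h i t) (at t)"
        using N(2)[OF t] by (auto intro!: derivative_eq_intros)
      then show ?thesis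
      proof (rule has_field_derivative_transform_within_open[of _ _ _ "{0<..<1}"])
        fix x :: real assume "x \<in> {0<..<1}"
        then show "\<phi> i 0 + integral {0..x} (h i) = \<phi> i x" using h\<phi>[of 0 x i] by auto
      qed (use t in auto)
    qed
    then show ?thesis using N(1) by blast
  qed
  then obtain Nh where Nh: "\<And>i. negligible (Nh i)"
      "\<And>i t. \<lbrakk>0 < t; t < 1; t \<notin> Nh i\<rbrakk> \<Longrightarrow> (\<phi> i has_real_derivative h i t) (at t)"
    by metis
  obtain Ng where Ng: "negligible Ng" "\<And>x. \<lbrakk>0 < x; x < 1; x \<notin> Ng\<rbrakk> \<Longrightarrow> ((\<lambda>t. integral {0..t} g) has_real_derivative g x) (at x)"
    using lebesgue_differentiation[of g 0 1] g by (auto simp: absolutely_integrable_on_def)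
  define N1 where "N1 = (\<Union>i. Nh i) \<union> Ng \<union> {0, 1}"
  have N1: "negligible N1" unfolding N1_def using Nh(1) Ng(1) by (auto intro!: negligible_countable_Union)
  define A where "A = {0..1} - N1"
  have A: "0 < t" "t < 1" "t \<notin> Ng" "\<And>i. t \<notin> Nh i" if "t \<in> A" for t
    using that by (auto simp: A_def N1_def less_le)
  have Alm: "A \<in> sets lebesgue"
    unfolding A_def using N1 by (auto simp: negligible_iff_null_sets)
  have near: "\<forall>\<^sub>F s in at t. 0 < s \<and> s < 1 \<and> s \<noteq> t" if "t \<in> A" for t
  proof -
    have "\<forall>\<^sub>F s in at t. s \<in> {0<..<1}"
      by (rule eventually_at_in_open') (use A[OF that] in auto)
    moreover have "\<forall>\<^sub>F s in at t. s \<noteq> t" by (simp add: eventually_at_filter)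
    ultimately show ?thesis by eventually_elim auto
  qed
  \<comment> \<open>The bound \<open>g\<close> may take negative values, but its primitive is
    nondecreasing because its increments dominate distances.\<close>
  have gnn: "0 \<le> g t" if "t \<in> A" for t
  proof -
    have "((\<lambda>s. (integral {0..s} g - integral {0..t} g) / (s - t)) \<longlongrightarrow> g t) (at t)"
      using Ng(2)[of t] A[OF that] unfolding has_field_derivative_iff by blast
    moreover have "\<forall>\<^sub>F s in at t. 0 \<le> (integral {0..s} g - integral {0..t} g) / (s - t)"
      using near[OF that]
    proof eventually_elim
      case (elim s)
      have gi: "g integrable_on {a..b}" if "0 \<le> a" "b \<le> 1" for a b
        using g that by (metis absolutely_integrable_on_def integrable_subinterval_real atLeastatMost_subset_iff)
      have mono: "integral {0..x} g \<le> integral {0..y} g" if "0 \<le> x" "x \<le> y" "y \<le> 1" for x y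
        using Henstock_Kurzweil_Integration.integral_combine[of 0 x y g] dle[of x y] that gi
          order_trans[OF mdist_nonneg[of M "\<gamma> x" "\<gamma> y"] dle[of x y]] by fastforce
      show ?case using mono[of s t] mono[of t s] elim A(1,2)[OF that]
        by (cases "s < t") (auto simp: divide_nonpos_neg divide_nonneg_pos)
    qed
    ultimately show ?thesis by (rule tendsto_lowerbound) simp
  qed
  have hg: "\<bar>h i t\<bar> \<le> g t" if "t \<in> A" for i t
  proof -
    have "\<bar>h i t\<bar> \<le> \<bar>g t\<bar>"
    proof (rule tendsto_le[OF _ has_real_derivative_imp_abs_quotient_tendsto has_real_derivative_imp_abs_quotient_tendsto])
      show "(\<phi> i has_real_derivative h i t) (at t)" using Nh(2) A[OF that] by blast
      show "((\<lambda>t. integral {0..t} g) has_real_derivative g t) (at t)" using Ng(2) A[OF that] by blast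
      show "\<forall>\<^sub>F s in at t. \<bar>\<phi> i s - \<phi> i t\<bar> / \<bar>s - t\<bar> \<le> \<bar>integral {0..s} g - integral {0..t} g\<bar> / \<bar>s - t\<bar>"
        using near[OF that]
      proof eventually_elim
        case (elim s)
        then show ?case
          using \<phi>d[of t s i] speed_bound_mdist_le[OF sb, of t s] A(1,2)[OF that]
          by (intro divide_right_mono) auto
      qed
    qed simp
    with gnn[OF that] show ?thesis by simp
  qed
  \<comment> \<open>Cutting down to the good set \<open>A\<close> makes every \<open>k i\<close>
    bounded by the same finite value at each point, so the supremum exists everywhere.\<close>
  define k where "k i t = indicator A t *\<^sub>R \<bar>h i t\<bar>" for i t
  have km: "k i \<in> borel_measurable lebesgue" for i
  proof -
    have "(\<lambda>t. \<bar>h i t\<bar>) absolutely_integrable_on {0..1}" using h by (rule set_integrable_abs)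
    then have "(\<lambda>t. indicator {0..1} t *\<^sub>R \<bar>h i t\<bar>) \<in> borel_measurable lebesgue"
      unfolding set_integrable_def by auto
    then have "(\<lambda>t. indicator A t *\<^sub>R (indicator {0..1} t *\<^sub>R \<bar>h i t\<bar>)) \<in> borel_measurable lebesgue"
      using Alm by measurable
    moreover have "k i = (\<lambda>t. indicator A t *\<^sub>R (indicator {0..1} t *\<^sub>R \<bar>h i t\<bar>))"
      by (auto simp: k_def A_def split: split_indicator)
    ultimately show ?thesis by simp
  qed
  have kg: "k i t \<le> indicator A t * g t" for i t using hg[of t i] by (auto simp: k_def split: split_indicator)
  have bdd: "bdd_above (range (\<lambda>i. k i t))" for t using kg by (auto intro!: bdd_aboveI2)
  define \<psi> where "\<psi> t = (SUP i. k i t)" for t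
  have \<psi>m: "\<psi> \<in> borel_measurable lebesgue"
    unfolding \<psi>_def[abs_def] by (rule borel_measurable_cSUP) (use km bdd in auto)
  have k\<psi>: "k i t \<le> \<psi> t" for i t unfolding \<psi>_def by (rule cSUP_upper[OF _ bdd]) simp
  have \<psi>nn: "0 \<le> \<psi> t" for t using k\<psi>[of 0 t] by (auto simp: k_def split: split_indicator_asm)
  have \<psi>g: "\<psi> t \<le> indicator A t * g t" for t unfolding \<psi>_def by (rule cSUP_least) (use kg in auto)
  have \<psi>i: "\<psi> absolutely_integrable_on {0..1}"
  proof (rule measurable_bounded_by_integrable_imp_absolutely_integrable)
    show "(\<lambda>t. \<bar>g t\<bar>) integrable_on {0..1}" using set_integrable_abs[OF g] by (simp add: absolutely_integrable_on_def)
    show "norm (\<psi> t) \<le> \<bar>g t\<bar>" for t using \<psi>nn[of t] \<psi>g[of t] by (auto split: split_indicator_asm)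
    show "\<psi> \<in> borel_measurable (lebesgue_on {0..1})" using \<psi>m by (rule measurable_restrict_space1)
  qed auto
  have conv: "\<exists>i. mdist M (\<gamma> (q i)) (\<gamma> s) < e" if s: "0 \<le> s" "s \<le> 1" and e: "e > 0" for s e
  proof -
    have "continuous_on {0..1} (\<lambda>t. integral {0..t} g)"
      using g by (intro indefinite_integral_continuous_1) (auto simp: absolutely_integrable_on_def)
    then obtain d where d: "d > 0" "\<And>x. x \<in> {0..1} \<Longrightarrow> dist x s < d \<Longrightarrow> dist (integral {0..x} g) (integral {0..s} g) < e"
      using s e unfolding continuous_on_iff by (metis atLeastAtMost_iff)
    have "\<exists>r\<in>\<rat>. r \<in> {0..1} \<and> dist r s < d"
    proof -
      have "max 0 (s - d) < min 1 (s + d)" using s d by auto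
      then obtain r where "r \<in> \<rat>" "max 0 (s - d) < r" "r < min 1 (s + d)" using Rats_dense_in_real by blast
      then show ?thesis by (intro bexI[of _ r]) (auto simp: dist_real_def)
    qed
    then obtain i where i: "dist (q i) s < d" using q by (metis IntI rangeE)
    show ?thesis
      using speed_bound_mdist_le[OF sb, of "q i" s] d(2)[of "q i"] i q01[of i] s
      by (intro exI[of _ i]) (auto simp: dist_real_def)
  qed
  have \<psi>sub: "\<psi> absolutely_integrable_on {s..t}" if "0 \<le> s" "t \<le> 1" for s t
    by (rule absolutely_integrable_on_subinterval[OF \<psi>i]) (use that in auto)
  \<comment> \<open>For a sample point close to \<open>\<gamma> s\<close>, the function
    \<open>\<phi> i\<close> grows from \<open>s\<close> to \<open>t\<close> by almost the distance
    of \<open>\<gamma> s\<close> and \<open>\<gamma> t\<close>, and this growth is the integral of a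
    function below \<psi>.\<close>
  have sb\<psi>: "speed_bound M \<gamma> \<psi>"
    unfolding speed_bound_def
  proof (intro conjI allI impI)
    fix s t :: real assume st: "0 \<le> s \<and> s \<le> t \<and> t \<le> 1"
    show "mdist M (\<gamma> s) (\<gamma> t) \<le> integral {s..t} \<psi>"
    proof (rule field_le_epsilon)
      fix e :: real assume e: "e > 0"
      obtain i where i: "mdist M (\<gamma> (q i)) (\<gamma> s) < e / 2" using conv[of s "e/2"] st e by auto
      have "mdist M (\<gamma> s) (\<gamma> t) - e \<le> \<phi> i t - \<phi> i s"
        using i mdist_triangle[of "\<gamma> s" M "\<gamma> (q i)" "\<gamma> t"] \<gamma> q01[of i] st by (simp add: \<phi>_def mdist_commute)
      also have "\<dots> = integral {s..t} (h i)" using h\<phi> st by blast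
      also have "\<dots> \<le> integral {s..t} \<psi>"
      proof -
        have "integral {s..t} (\<lambda>x. indicator A x *\<^sub>R h i x) \<le> integral {s..t} \<psi>"
        proof (rule integral_le)
          have "(\<lambda>x. indicator A x *\<^sub>R h i x) absolutely_integrable_on {s..t}"
            by (rule absolutely_integrable_spike[OF absolutely_integrable_on_subinterval[OF h[of i]] N1])
               (use st in \<open>auto simp: A_def\<close>)
          then show "(\<lambda>x. indicator A x *\<^sub>R h i x) integrable_on {s..t}" by (simp add: absolutely_integrable_on_def)
          show "\<psi> integrable_on {s..t}" using \<psi>sub st by (simp add: absolutely_integrable_on_def)
          show "indicator A x *\<^sub>R h i x \<le> \<psi> x" for x
            using k\<psi>[of i x] by (auto simp: k_def split: split_indicator_asm split_indicator)
        qed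
        moreover have "integral {s..t} (\<lambda>x. indicator A x *\<^sub>R h i x) = integral {s..t} (h i)"
          by (rule integral_spike[OF N1]) (use st in \<open>auto simp: A_def\<close>)
        ultimately show ?thesis by simp
      qed
      finally show "mdist M (\<gamma> s) (\<gamma> t) \<le> integral {s..t} \<psi> + e" by simp
    qed
  qed (use \<psi>i \<gamma> in auto)
  obtain N\<psi> where N\<psi>: "negligible N\<psi>" "\<And>x. \<lbrakk>0 < x; x < 1; x \<notin> N\<psi>\<rbrakk> \<Longrightarrow> ((\<lambda>t. integral {0..t} \<psi>) has_real_derivative \<psi> x) (at x)"
    using lebesgue_differentiation[of \<psi> 0 1] \<psi>i by (auto simp: absolutely_integrable_on_def)
  \<comment> \<open>From below the quotients are controlled by the derivatives of the
    \<open>\<phi> i\<close>, whose supremum is \<psi>; from above by \<open>sb\<psi>\<close> and the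
    derivative of the primitive of \<psi>. So the limit exists at almost every
    \<open>t\<close>.\<close>
  have ms: "metric_speed M \<gamma> t = \<psi> t" if t: "t \<in> A" "t \<notin> N\<psi>" for t
  proof -
    have "((\<lambda>s. mdist M (\<gamma> s) (\<gamma> t) / \<bar>s - t\<bar>) \<longlongrightarrow> \<psi> t) (at t)"
    proof (rule order_tendstoI)
      fix a assume "a < \<psi> t"
      then obtain i where i: "a < k i t" unfolding \<psi>_def by (subst (asm) less_cSUP_iff) (use bdd in auto)
      have "\<forall>\<^sub>F s in at t. a < \<bar>\<phi> i s - \<phi> i t\<bar> / \<bar>s - t\<bar>"
        by (rule order_tendstoD(1)[OF has_real_derivative_imp_abs_quotient_tendsto[OF Nh(2)[of t i]]])
           (use i A[OF t(1)] t in \<open>auto simp: k_def\<close>)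
      then show "\<forall>\<^sub>F s in at t. a < mdist M (\<gamma> s) (\<gamma> t) / \<bar>s - t\<bar>"
        using near[OF t(1)]
      proof eventually_elim
        case (elim s)
        have "\<bar>\<phi> i s - \<phi> i t\<bar> / \<bar>s - t\<bar> \<le> mdist M (\<gamma> s) (\<gamma> t) / \<bar>s - t\<bar>"
          using \<phi>d[of t s i] A(1,2)[OF t(1)] elim by (intro divide_right_mono) (auto simp: mdist_commute)
        with elim show ?case by linarith
      qed
    next
      fix a assume a: "\<psi> t < a"
      have "\<forall>\<^sub>F s in at t. \<bar>integral {0..s} \<psi> - integral {0..t} \<psi>\<bar> / \<bar>s - t\<bar> < a"
        by (rule order_tendstoD(2)[OF has_real_derivative_imp_abs_quotient_tendsto[OF N\<psi>(2)[of t]]])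
           (use a A[OF t(1)] t \<psi>nn[of t] in auto)
      then show "\<forall>\<^sub>F s in at t. mdist M (\<gamma> s) (\<gamma> t) / \<bar>s - t\<bar> < a"
        using near[OF t(1)]
      proof eventually_elim
        case (elim s)
        have "mdist M (\<gamma> s) (\<gamma> t) / \<bar>s - t\<bar> \<le> \<bar>integral {0..s} \<psi> - integral {0..t} \<psi>\<bar> / \<bar>s - t\<bar>"
          using speed_bound_mdist_le[OF sb\<psi>, of s t] A(1,2)[OF t(1)] elim by (intro divide_right_mono) auto
        with elim show ?case by linarith
      qed
    qed
    moreover have "at t within {0..1} = at t"
      using at_within_interior[of t "{0..1}"] A[OF t(1)] by simp
    ultimately show ?thesis
      unfolding metric_speed_def by (simp add: tendsto_Lim)
  qed
  show thesis
  proof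
    show neg: "negligible (N1 \<union> N\<psi>)" using N1 N\<psi>(1) by simp
    have eq: "metric_speed M \<gamma> t = \<psi> t" if "t \<in> {0..1} - (N1 \<union> N\<psi>)" for t
      using ms[of t] that by (auto simp: A_def)
    then show "0 \<le> metric_speed M \<gamma> t \<and> metric_speed M \<gamma> t \<le> g t" if "t \<in> {0..1} - (N1 \<union> N\<psi>)" for t
      using that \<psi>nn[of t] \<psi>g[of t] by (auto simp: A_def split: split_indicator_asm)
    have "metric_speed M \<gamma> absolutely_integrable_on {0..1}"
      by (rule absolutely_integrable_spike[OF \<psi>i neg]) (use eq in auto)
    moreover have "integral {s..t} (metric_speed M \<gamma>) = integral {s..t} \<psi>" if "0 \<le> s" "s \<le> t" "t \<le> 1" for s t
      by (rule integral_spike[OF neg, symmetric]) (use eq that in auto)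
    ultimately show "speed_bound M \<gamma> (metric_speed M \<gamma>)"
      using sb\<psi> by (simp add: speed_bound_def)
  qed
qed

section \<open>The conformal distance\<close>

text \<open>Every bound dominates the speed almost everywhere and is thus nonnegative off a null
  set; passing to \<open>\<bar>g\<bar>\<close> changes no integral.\<close>

lemma speed_bound_nonneg:
  assumes sb: "speed_bound M \<gamma> g"
  obtains g' where "speed_bound M \<gamma> g'" "\<And>t. 0 \<le> g' t" "\<And>k. integral {0..1} (\<lambda>t. g' t * k t) = integral {0..1} (\<lambda>t. g t * k t)"
proof -
  obtain N where N: "negligible N" "\<And>t. t \<in> {0..1} - N \<Longrightarrow> 0 \<le> metric_speed M \<gamma> t \<and> metric_speed M \<gamma> t \<le> g t"
    using metric_speed_properties[OF sb] by metis
  have gN: "0 \<le> g t" if "t \<in> {0..1} - N" for t using N(2)[OF that] by linarith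
  show thesis
  proof
    have "(\<lambda>t. \<bar>g t\<bar>) absolutely_integrable_on {0..1}"
      using sb by (auto simp: speed_bound_def intro: set_integrable_abs)
    moreover have "integral {s..t} (\<lambda>t. \<bar>g t\<bar>) = integral {s..t} g" if "0 \<le> s" "t \<le> 1" for s t
      by (rule integral_spike[OF N(1), symmetric]) (use gN that in auto)
    ultimately show "speed_bound M \<gamma> (\<lambda>t. \<bar>g t\<bar>)" using sb by (auto simp: speed_bound_def)
    show "integral {0..1} (\<lambda>t. \<bar>g t\<bar> * k t) = integral {0..1} (\<lambda>t. g t * k t)" for k
      by (rule integral_spike[OF N(1), symmetric]) (use gN in auto)
  qed auto
qed

lemma integral_reflect_unit:
  fixes f :: "real \<Rightarrow> real"
  shows "((\<lambda>x. f (1 - x)) has_integral i) {s..t} \<longleftrightarrow> (f has_integral i) {1 - t..1 - s}"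
proof -
  have *: "((\<lambda>x. f (1 - x)) has_integral i) {1 - t..1 - s}" if "(f has_integral i) {s..t}" for s t and f :: "real \<Rightarrow> real"
  proof -
    have "(\<lambda>x. 1 - x) ` {s..t} = {1 - t..1 - s}"
      using image_diff_atLeastAtMost[of 1 s t] by simp
    then show ?thesis
      using has_integral_affinity[of f i s t "-1" 1] that by simp
  qed
  show ?thesis
    using *[of f "1 - t" "1 - s"] *[of "\<lambda>x. f (1 - x)" s t] by auto
qed

lemma speed_bound_reflect:
  assumes sb: "speed_bound M \<gamma> g"
  shows "speed_bound M (\<lambda>t. \<gamma> (1 - t)) (\<lambda>t. g (1 - t))"
proof -
  have "g integrable_on {0..1}" "(\<lambda>x. norm (g x)) integrable_on {0..1}"
    using sb by (auto simp: speed_bound_def absolutely_integrable_on_def)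
  then have "(\<lambda>t. g (1 - t)) absolutely_integrable_on {0..1}"
    unfolding absolutely_integrable_on_def integrable_on_def
    using integral_reflect_unit[of g _ 0 1] integral_reflect_unit[of "\<lambda>x. norm (g x)" _ 0 1] by simp
  moreover have "integral {s..t} (\<lambda>t. g (1 - t)) = integral {1 - t..1 - s} g" if "0 \<le> s" "t \<le> 1" for s t
  proof -
    have "g integrable_on {1 - t..1 - s}"
      using sb that unfolding speed_bound_def
      by (metis absolutely_integrable_on_def integrable_subinterval_real atLeastatMost_subset_iff diff_ge_0_iff_ge diff_le_eq le_add_same_cancel1)
    then show ?thesis
      using integral_reflect_unit[of g _ s t] by (metis integrable_integral integral_unique)
  qed
  moreover have "mdist M (\<gamma> (1 - s)) (\<gamma> (1 - t)) \<le> integral {1 - t..1 - s} g" if "0 \<le> s" "s \<le> t" "t \<le> 1" for s t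
    using sb that unfolding speed_bound_def by (subst mdist_commute) auto
  ultimately show ?thesis using sb unfolding speed_bound_def by auto
qed

lemma has_integral_double:
  fixes f :: "real \<Rightarrow> real"
  shows "(f has_integral i) {2 * s + c..2 * t + c} \<Longrightarrow> ((\<lambda>x. 2 * f (2 * x + c)) has_integral i) {s..t}"
  using has_integral_mult_right[OF has_integral_affinity'[of f i "2 * s + c" "2 * t + c" 2 c], of 2] by simp

definition glue :: "(real \<Rightarrow> 'b) \<Rightarrow> (real \<Rightarrow> 'b) \<Rightarrow> real \<Rightarrow> 'b" where
  "glue f g t = (if t \<le> 1 / 2 then f (2 * t) else g (2 * t - 1))"

lemma has_integral_glue:
  fixes f g :: "real \<Rightarrow> real"
  assumes "(f has_integral i) {0..1}" "(g has_integral j) {0..1}"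
  shows "((\<lambda>t. 2 * glue f g t) has_integral (i + j)) {0..1}"
proof (rule has_integral_combine[of 0 "1/2"])
  have "((\<lambda>x. 2 * f (2 * x)) has_integral i) {0..1/2}" "((\<lambda>x. 2 * g (2 * x - 1)) has_integral j) {1/2..1}"
    using has_integral_double[of f i 0 0 "1/2"] has_integral_double[of g j "1/2" "-1" 1] assms by auto
  then show "((\<lambda>t. 2 * glue f g t) has_integral i) {0..1/2}" "((\<lambda>t. 2 * glue f g t) has_integral j) {1/2..1}"
    by - (rule has_integral_spike_finite[where S="{1/2}", rotated -1], assumption, auto simp: glue_def)+
qed auto

text \<open>Each curve is run in half the time, hence the factor 2. An interval containing
  \<open>1/2\<close> inside is split there, and the triangle inequality applies.\<close>

lemma speed_bound_glue:
  assumes sb: "speed_bound M \<gamma> g" "speed_bound M \<delta> h" and eq: "\<gamma> 1 = \<delta> 0"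
  shows "speed_bound M (glue \<gamma> \<delta>) (\<lambda>t. 2 * glue g h t)"
proof -
  let ?G = "\<lambda>t. 2 * glue g h t"
  have m: "\<gamma> t \<in> mspace M" "\<delta> t \<in> mspace M" if "0 \<le> t" "t \<le> 1" for t
    using sb that by (auto simp: speed_bound_def)
  have "g integrable_on {0..1}" "h integrable_on {0..1}" "(\<lambda>x. \<bar>g x\<bar>) integrable_on {0..1}" "(\<lambda>x. \<bar>h x\<bar>) integrable_on {0..1}"
    using sb by (auto simp: speed_bound_def absolutely_integrable_on_def)
  then have i1: "?G integrable_on {0..1}" and i2: "(\<lambda>t. 2 * glue (\<lambda>x. \<bar>g x\<bar>) (\<lambda>x. \<bar>h x\<bar>) t) integrable_on {0..1}"
    using has_integral_glue unfolding integrable_on_def by metis+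
  have "(\<lambda>t. 2 * glue (\<lambda>x. \<bar>g x\<bar>) (\<lambda>x. \<bar>h x\<bar>) t) = (\<lambda>t. norm (?G t))" by (auto simp: glue_def abs_mult)
  with i1 i2 have ai: "?G absolutely_integrable_on {0..1}" by (simp add: absolutely_integrable_on_def)
  have gi: "k integrable_on {a..b}" if "0 \<le> a" "b \<le> 1" "k integrable_on {0..1}" for a b and k :: "real \<Rightarrow> real"
    using that by (metis integrable_subinterval_real atLeastatMost_subset_iff)
  have I1: "integral {s..t} ?G = integral {2 * s..2 * t} g" if "0 \<le> s" "s \<le> t" "t \<le> 1/2" for s t
  proof -
    have "((\<lambda>x. 2 * g (2 * x)) has_integral integral {2 * s..2 * t} g) {s..t}"
      using has_integral_double[of g "integral {2 * s..2 * t} g" s 0 t] gi[of "2 * s" "2 * t" g] that \<open>g integrable_on _\<close>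
      by (simp add: integrable_integral)
    then have "(?G has_integral integral {2 * s..2 * t} g) {s..t}"
      by (rule has_integral_eq[rotated]) (use that in \<open>auto simp: glue_def\<close>)
    then show ?thesis by (rule integral_unique)
  qed
  have I2: "integral {s..t} ?G = integral {2 * s - 1..2 * t - 1} h" if "1/2 \<le> s" "s \<le> t" "t \<le> 1" for s t
  proof -
    have "((\<lambda>x. 2 * h (2 * x - 1)) has_integral integral {2 * s - 1..2 * t - 1} h) {s..t}"
      using has_integral_double[of h "integral {2 * s - 1..2 * t - 1} h" s "-1" t] gi[of "2 * s - 1" "2 * t - 1" h] that \<open>h integrable_on _\<close>
      by (simp add: integrable_integral)
    then have "(?G has_integral integral {2 * s - 1..2 * t - 1} h) {s..t}"
      by (rule has_integral_spike_finite[where S="{1/2}", rotated -1]) (use that in \<open>auto simp: glue_def\<close>)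
    then show ?thesis by (rule integral_unique)
  qed
  have d1: "mdist M (glue \<gamma> \<delta> s) (glue \<gamma> \<delta> t) \<le> integral {s..t} ?G" if "0 \<le> s" "s \<le> t" "t \<le> 1/2" for s t
    using sb(1) that unfolding I1[OF that] by (auto simp: glue_def speed_bound_def)
  have d2: "mdist M (glue \<gamma> \<delta> s) (glue \<gamma> \<delta> t) \<le> integral {s..t} ?G" if "1/2 \<le> s" "s \<le> t" "t \<le> 1" for s t
  proof -
    \<comment> \<open>At \<open>1/2\<close> the definition uses the first curve; the matching
      endpoints make the formula for the second one valid there too.\<close>
    have gl: "glue \<gamma> \<delta> x = \<delta> (2 * x - 1)" if "1/2 \<le> x" for x
    proof (cases "x = 1/2")
      case True
      then show ?thesis using eq by (subst True)+ (simp add: glue_def)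
    qed (use that in \<open>auto simp: glue_def\<close>)
    show ?thesis using sb(2) that unfolding I2[OF that] by (auto simp: gl speed_bound_def)
  qed
  have gm: "glue \<gamma> \<delta> t \<in> mspace M" if "0 \<le> t" "t \<le> 1" for t using m that by (auto simp: glue_def)
  show ?thesis
    unfolding speed_bound_def
  proof (intro conjI allI impI ai)
    fix s t :: real assume st: "0 \<le> s \<and> s \<le> t \<and> t \<le> 1"
    consider "t \<le> 1/2" | "1/2 \<le> s" | "s < 1/2" "1/2 < t" by linarith
    then show "mdist M (glue \<gamma> \<delta> s) (glue \<gamma> \<delta> t) \<le> integral {s..t} ?G"
    proof cases
      case 3
      have "mdist M (glue \<gamma> \<delta> s) (glue \<gamma> \<delta> t) \<le> mdist M (glue \<gamma> \<delta> s) (glue \<gamma> \<delta> (1/2)) + mdist M (glue \<gamma> \<delta> (1/2)) (glue \<gamma> \<delta> t)"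
        by (rule mdist_triangle) (use gm st 3 in auto)
      also have "\<dots> \<le> integral {s..1/2} ?G + integral {1/2..t} ?G"
        by (intro add_mono d1 d2) (use st 3 in auto)
      also have "\<dots> = integral {s..t} ?G"
        by (rule Henstock_Kurzweil_Integration.integral_combine) (use st 3 gi[OF _ _ i1] in auto)
      finally show ?thesis .
    qed (use d1 d2 st in auto)
  qed (use gm in auto)
qed

section \<open>Weighted lengths and the metric they induce\<close>

locale conformal_change =
  fixes M :: "'a metric" and w :: "'a \<Rightarrow> real" and C :: real
  assumes geodesic: "geodesic_metric M"
    and w_cont: "continuous_map (mtopology_of M) euclideanreal w"
    and w_bdd: "x \<in> mspace M \<Longrightarrow> \<bar>w x\<bar> \<le> C"
begin

abbreviation weighted_length :: "(real \<Rightarrow> 'a) \<Rightarrow> (real \<Rightarrow> real) \<Rightarrow> real" where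
  "weighted_length \<gamma> g \<equiv> integral {0..1} (\<lambda>t. g t * exp (w (\<gamma> t)))"

lemma weighted_integrable:
  assumes sb: "speed_bound M \<gamma> g"
  shows "(\<lambda>t. g t * exp (w (\<gamma> t))) absolutely_integrable_on {0..1}"
proof -
  have "continuous_map (top_of_set {0..1}) euclideanreal (w \<circ> \<gamma>)"
    by (rule continuous_map_compose[OF speed_bound_imp_continuous[OF sb] w_cont])
  then have cont: "continuous_on {0..1} (\<lambda>t. exp (w (\<gamma> t)))"
    by (auto intro!: continuous_intros simp: comp_def)
  then have "(\<lambda>t. exp (w (\<gamma> t)) * g t) absolutely_integrable_on {0..1}"
    using sb
    by (intro absolutely_integrable_bounded_measurable_product_real continuous_imp_measurable_on_sets_lebesgue compact_imp_bounded compact_continuous_image)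
       (auto simp: speed_bound_def)
  then show ?thesis by (simp add: mult.commute)
qed

text \<open>The piece of the curve between \<open>s\<close> and \<open>t\<close> already accounts
  for the bound, since a bound of the speed can be taken nonnegative. The freedom in
  \<open>s\<close> and \<open>t\<close> serves curves that are followed only until they leave a
  ball.\<close>

lemma weighted_length_ge:
  assumes sb: "speed_bound M \<gamma> g" and st: "0 \<le> s" "s \<le> t" "t \<le> 1"
    and K: "0 \<le> K" "\<And>r. s \<le> r \<Longrightarrow> r \<le> t \<Longrightarrow> K \<le> exp (w (\<gamma> r))"
  shows "K * mdist M (\<gamma> s) (\<gamma> t) \<le> weighted_length \<gamma> g"
proof -
  obtain h where h: "speed_bound M \<gamma> h" "\<And>t. 0 \<le> h t" "\<And>k. integral {0..1} (\<lambda>t. h t * k t) = integral {0..1} (\<lambda>t. g t * k t)"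
    using speed_bound_nonneg[OF sb] by blast
  have hi: "h integrable_on {s..t}"
    using h(1) st unfolding speed_bound_def
    by (metis absolutely_integrable_on_def integrable_subinterval_real atLeastatMost_subset_iff)
  have hw: "(\<lambda>t. h t * exp (w (\<gamma> t))) integrable_on {0..1}"
    using weighted_integrable[OF h(1)] by (simp add: absolutely_integrable_on_def)
  have hw': "(\<lambda>t. h t * exp (w (\<gamma> t))) integrable_on {s..t}"
    using hw st by (metis integrable_subinterval_real atLeastatMost_subset_iff)
  have "K * mdist M (\<gamma> s) (\<gamma> t) \<le> K * integral {s..t} h"
    using h(1) st K(1) by (intro mult_left_mono) (auto simp: speed_bound_def)
  also have "\<dots> = integral {s..t} (\<lambda>r. K * h r)" by simp
  also have "\<dots> \<le> integral {s..t} (\<lambda>r. h r * exp (w (\<gamma> r)))"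
  proof (rule integral_le)
    show "(\<lambda>r. K * h r) integrable_on {s..t}" using integrable_on_cmult_left[OF hi, of K] by simp
    show "K * h r \<le> h r * exp (w (\<gamma> r))" if "r \<in> {s..t}" for r
      using mult_left_mono[OF K(2)[of r] h(2)[of r]] that by (simp add: mult.commute)
  qed (rule hw')
  also have "\<dots> \<le> weighted_length \<gamma> h"
    by (rule integral_subset_le) (use st h(2) hw hw' in auto)
  also have "\<dots> = weighted_length \<gamma> g" by (rule h(3))
  finally show ?thesis .
qed

lemma weighted_length_nonneg: "speed_bound M \<gamma> g \<Longrightarrow> 0 \<le> weighted_length \<gamma> g"
  using weighted_length_ge[of \<gamma> g 0 1 0] by simp

text \<open>The speed is the least bound almost everywhere. Consequently the infimum defining the
  conformal distance may be estimated with arbitrary pairs of a curve and a bound of its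
  speed.\<close>

lemma speed_weighted_length_le:
  assumes sb: "speed_bound M \<gamma> g"
  shows "set_lebesgue_integral lebesgue {0..1} (\<lambda>t. metric_speed M \<gamma> t * exp (w (\<gamma> t))) = weighted_length \<gamma> (metric_speed M \<gamma>)"
    and "weighted_length \<gamma> (metric_speed M \<gamma>) \<le> weighted_length \<gamma> g"
    and "speed_bound M \<gamma> (metric_speed M \<gamma>)"
proof -
  obtain N where N: "negligible N"
    "\<And>t. t \<in> {0..1} - N \<Longrightarrow> 0 \<le> metric_speed M \<gamma> t \<and> metric_speed M \<gamma> t \<le> g t"
    and sbm: "speed_bound M \<gamma> (metric_speed M \<gamma>)"
    using metric_speed_properties[OF sb] by metis
  show "speed_bound M \<gamma> (metric_speed M \<gamma>)" by (rule sbm)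
  show "set_lebesgue_integral lebesgue {0..1} (\<lambda>t. metric_speed M \<gamma> t * exp (w (\<gamma> t))) = weighted_length \<gamma> (metric_speed M \<gamma>)"
    by (rule set_lebesgue_integral_eq_integral(2)[OF weighted_integrable[OF sbm]])
  have gi: "(\<lambda>t. g t * exp (w (\<gamma> t))) integrable_on {0..1}" and mi: "(\<lambda>t. metric_speed M \<gamma> t * exp (w (\<gamma> t))) integrable_on {0..1}"
    using weighted_integrable[OF sb] weighted_integrable[OF sbm] by (auto simp: absolutely_integrable_on_def)
  show "weighted_length \<gamma> (metric_speed M \<gamma>) \<le> weighted_length \<gamma> g"
  proof -
    \<comment> \<open>The minimum makes the comparison hold at every point, as
      \<open>integral_le\<close> demands, and agrees with the speed off a null set.\<close>
    let ?k = "\<lambda>t. min (metric_speed M \<gamma> t) (g t) * exp (w (\<gamma> t))"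
    have eq: "?k t = metric_speed M \<gamma> t * exp (w (\<gamma> t))" if "t \<in> {0..1} - N" for t
      using N(2)[OF that] by (simp add: min_absorb1)
    have "weighted_length \<gamma> (metric_speed M \<gamma>) = integral {0..1} ?k"
      by (rule integral_spike[OF N(1)]) (rule eq)
    also have "\<dots> \<le> weighted_length \<gamma> g"
      by (rule integral_le[OF integrable_spike[OF mi N(1) eq] gi]) (auto intro!: mult_right_mono)
    finally show ?thesis .
  qed
qed

lemma conformal_dist_le:
  assumes sb: "speed_bound M \<gamma> g"
  shows "conformal_dist M w (\<gamma> 0) (\<gamma> 1) \<le> weighted_length \<gamma> g"
proof -
  have "conformal_dist M w (\<gamma> 0) (\<gamma> 1) \<le> weighted_length \<gamma> (metric_speed M \<gamma>)"
    unfolding conformal_dist_def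
  proof (rule cInf_lower)
    show "weighted_length \<gamma> (metric_speed M \<gamma>) \<in> {LINT t:{0..1}|lebesgue. metric_speed M \<gamma>' t * exp (w (\<gamma>' t)) |\<gamma>'. ac_curve M \<gamma>' \<and> \<gamma>' 0 = \<gamma> 0 \<and> \<gamma>' 1 = \<gamma> 1}"
      using speed_weighted_length_le(1)[OF sb] sb ac_curve_iff_speed_bound[of M \<gamma>] by (intro CollectI exI[of _ \<gamma>]) auto
    show "bdd_below {LINT t:{0..1}|lebesgue. metric_speed M \<gamma>' t * exp (w (\<gamma>' t)) |\<gamma>'. ac_curve M \<gamma>' \<and> \<gamma>' 0 = \<gamma> 0 \<and> \<gamma>' 1 = \<gamma> 1}"
      using speed_weighted_length_le(1,3) weighted_length_nonneg by (intro bdd_belowI[of _ 0]) (auto simp: ac_curve_iff_speed_bound)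
  qed
  with speed_weighted_length_le(2)[OF sb] show ?thesis by linarith
qed

text \<open>A geodesic from \<open>x\<close> to \<open>y\<close> stays in the closed ball about
  \<open>x\<close> through \<open>y\<close>, so only the weight there matters. The curve is returned
  as well, to show that the infimum is over a nonempty set.\<close>

lemma conformal_dist_le_mult:
  assumes x: "x \<in> mspace M" and y: "y \<in> mspace M"
    and K: "\<And>z. z \<in> mspace M \<Longrightarrow> mdist M x z \<le> mdist M x y \<Longrightarrow> exp (w z) \<le> K"
  obtains \<gamma> g where "speed_bound M \<gamma> g" "\<gamma> 0 = x" "\<gamma> 1 = y" "conformal_dist M w x y \<le> K * mdist M x y"
proof -
  obtain \<gamma> :: "real \<Rightarrow> 'a" where \<gamma>: "\<gamma> \<in> {0..1} \<rightarrow> mspace M" "\<gamma> 0 = x" "\<gamma> 1 = y"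
    and d: "\<And>s t. s \<in> {0..1} \<Longrightarrow> t \<in> {0..1} \<Longrightarrow> mdist M (\<gamma> s) (\<gamma> t) = \<bar>s - t\<bar> * mdist M x y"
    using geodesic[unfolded geodesic_metric_def, rule_format, OF x y] by blast
  let ?g = "\<lambda>t::real. mdist M x y"
  have sb: "speed_bound M \<gamma> ?g"
    using \<gamma> d by (auto simp: speed_bound_def)
  have "weighted_length \<gamma> ?g \<le> integral {0..1::real} (\<lambda>t. K * mdist M x y)"
  proof (rule integral_le)
    show "(\<lambda>t. ?g t * exp (w (\<gamma> t))) integrable_on {0..1}"
      using weighted_integrable[OF sb] by (simp add: absolutely_integrable_on_def)
    fix t :: real assume t: "t \<in> {0..1}"
    have "mdist M x (\<gamma> t) = t * mdist M x y" using d[of 0 t] t \<gamma> by auto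
    also have "\<dots> \<le> mdist M x y" using t by (simp add: mult_left_le_one_le)
    finally have "mdist M x (\<gamma> t) \<le> mdist M x y" .
    moreover have "\<gamma> t \<in> mspace M" using \<gamma>(1) t by blast
    ultimately have "exp (w (\<gamma> t)) \<le> K" using K by simp
    then show "mdist M x y * exp (w (\<gamma> t)) \<le> K * mdist M x y"
      using mult_left_mono[of "exp (w (\<gamma> t))" K "mdist M x y"] by (simp add: mult.commute)
  qed auto
  with conformal_dist_le[OF sb] \<gamma> have "conformal_dist M w x y \<le> K * mdist M x y" by simp
  with sb \<gamma> that show thesis by blast
qed

lemma conformal_dist_approx:
  assumes x: "x \<in> mspace M" and y: "y \<in> mspace M" and e: "e > 0"
  obtains \<gamma> g where "speed_bound M \<gamma> g" "\<gamma> 0 = x" "\<gamma> 1 = y" "weighted_length \<gamma> g < conformal_dist M w x y + e"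
proof -
  let ?S = "{LINT t:{0..1}|lebesgue. metric_speed M \<gamma> t * exp (w (\<gamma> t)) |\<gamma>. ac_curve M \<gamma> \<and> \<gamma> 0 = x \<and> \<gamma> 1 = y}"
  have "exp (w z) \<le> exp C" if "z \<in> mspace M" for z using w_bdd[OF that] by simp
  then obtain \<gamma> g where "speed_bound M \<gamma> g" "\<gamma> 0 = x" "\<gamma> 1 = y"
    using conformal_dist_le_mult[OF x y, of "exp C"] by blast
  then have "?S \<noteq> {}" by (auto simp: ac_curve_iff_speed_bound)
  moreover have "Inf ?S < conformal_dist M w x y + e" using e by (simp add: conformal_dist_def)
  ultimately have "\<exists>r\<in>?S. r < conformal_dist M w x y + e" by (rule cInf_lessD)
  then obtain \<gamma> where \<gamma>: "ac_curve M \<gamma>" "\<gamma> 0 = x" "\<gamma> 1 = y"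
    "(LINT t:{0..1}|lebesgue. metric_speed M \<gamma> t * exp (w (\<gamma> t))) < conformal_dist M w x y + e" by blast
  then obtain g where "speed_bound M \<gamma> g" by (auto simp: ac_curve_iff_speed_bound)
  from speed_weighted_length_le(1,3)[OF this] \<gamma> show thesis
    by (intro that[of \<gamma> "metric_speed M \<gamma>"]) simp_all
qed

text \<open>Either a competing curve stays in the ball of radius \<open>r\<close>, where the weight
  is at least \<open>k\<close>, or it reaches distance \<open>r\<close> from \<open>x\<close>, and
  that piece alone has length at least \<open>exp (- C) * r\<close>.\<close>

lemma conformal_dist_ge:
  assumes x: "x \<in> mspace M" and y: "y \<in> mspace M" and r: "mdist M x y < r"
    and k: "0 \<le> k" "\<And>z. z \<in> mspace M \<Longrightarrow> mdist M x z < r \<Longrightarrow> k \<le> exp (w z)"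
  shows "min (k * mdist M x y) (exp (- C) * r) \<le> conformal_dist M w x y"
proof (rule field_le_epsilon)
  fix e :: real assume "e > 0"
  then obtain \<gamma> g where \<gamma>: "speed_bound M \<gamma> g" "\<gamma> 0 = x" "\<gamma> 1 = y" "weighted_length \<gamma> g < conformal_dist M w x y + e"
    using conformal_dist_approx[OF x y] by blast
  have m: "\<gamma> t \<in> mspace M" if "0 \<le> t" "t \<le> 1" for t using \<gamma>(1) that by (auto simp: speed_bound_def)
  show "min (k * mdist M x y) (exp (- C) * r) \<le> conformal_dist M w x y + e"
  proof (cases "\<forall>t\<in>{0..1}. mdist M x (\<gamma> t) < r")
    case True
    then have "k * mdist M (\<gamma> 0) (\<gamma> 1) \<le> weighted_length \<gamma> g"
      by (intro weighted_length_ge \<gamma> k) (use m in auto)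
    with \<gamma> have "k * mdist M x y \<le> conformal_dist M w x y + e" by simp
    then show ?thesis by (simp add: min_le_iff_disj)
  next
    case False
    then obtain t where t: "t \<in> {0..1}" "r \<le> mdist M x (\<gamma> t)" by force
    have "exp (- C) \<le> exp (w (\<gamma> s))" if "0 \<le> s" "s \<le> 1" for s
      using w_bdd[OF m[OF that]] by simp
    then have "exp (- C) * mdist M (\<gamma> 0) (\<gamma> t) \<le> weighted_length \<gamma> g"
      by (intro weighted_length_ge \<gamma>) (use t in auto)
    moreover have "exp (- C) * r \<le> exp (- C) * mdist M (\<gamma> 0) (\<gamma> t)"
      using t \<gamma>(2) by simp
    ultimately have "exp (- C) * r \<le> conformal_dist M w x y + e" using \<gamma>(2,4) by linarith
    then show ?thesis by (simp add: min_le_iff_disj)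
  qed
qed

lemma conformal_dist_bounds:
  assumes x: "x \<in> mspace M" and y: "y \<in> mspace M"
  shows "exp (- C) * mdist M x y \<le> conformal_dist M w x y" "conformal_dist M w x y \<le> exp C * mdist M x y"
proof -
  have e: "exp (- C) \<le> exp (w z)" "exp (w z) \<le> exp C" if "z \<in> mspace M" for z using w_bdd[OF that] by simp_all
  show "conformal_dist M w x y \<le> exp C * mdist M x y"
    using conformal_dist_le_mult[OF x y, of "exp C"] e(2) by blast
  show "exp (- C) * mdist M x y \<le> conformal_dist M w x y"
    \<comment> \<open>With the global lower bound as \<open>k\<close>, any radius beyond the
      distance makes the first entry of the minimum the smaller one.\<close>
    using conformal_dist_ge[OF x y, of "mdist M x y + 1" "exp (- C)"] e(1) by (simp add: min_def)
qed

lemma conformal_dist_commute_le: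
  assumes x: "x \<in> mspace M" and y: "y \<in> mspace M"
  shows "conformal_dist M w x y \<le> conformal_dist M w y x"
proof (rule field_le_epsilon)
  fix e :: real assume "e > 0"
  then obtain \<gamma> g where \<gamma>: "speed_bound M \<gamma> g" "\<gamma> 0 = y" "\<gamma> 1 = x" "weighted_length \<gamma> g < conformal_dist M w y x + e"
    using conformal_dist_approx[OF y x] by blast
  have "conformal_dist M w x y \<le> integral {0..1} (\<lambda>t. g (1 - t) * exp (w (\<gamma> (1 - t))))"
    using conformal_dist_le[OF speed_bound_reflect[OF \<gamma>(1)]] \<gamma> by simp
  also have "\<dots> = weighted_length \<gamma> g"
    using weighted_integrable[OF \<gamma>(1)] integral_reflect_unit[of "\<lambda>t. g t * exp (w (\<gamma> t))" _ 0 1]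
    by (intro integral_unique) (simp add: absolutely_integrable_on_def integrable_integral)
  finally show "conformal_dist M w x y \<le> conformal_dist M w y x + e" using \<gamma> by simp
qed

text \<open>Almost optimal curves are concatenated, and the weighted lengths add up exactly.\<close>

lemma conformal_dist_triangle:
  assumes x: "x \<in> mspace M" and y: "y \<in> mspace M" and z: "z \<in> mspace M"
  shows "conformal_dist M w x z \<le> conformal_dist M w x y + conformal_dist M w y z"
proof (rule field_le_epsilon)
  fix e :: real assume "e > 0"
  then have e: "e / 2 > 0" by simp
  obtain \<gamma> g where \<gamma>: "speed_bound M \<gamma> g" "\<gamma> 0 = x" "\<gamma> 1 = y" "weighted_length \<gamma> g < conformal_dist M w x y + e / 2"
    using conformal_dist_approx[OF x y e] by blast
  obtain \<delta> h where \<delta>: "speed_bound M \<delta> h" "\<delta> 0 = y" "\<delta> 1 = z" "weighted_length \<delta> h < conformal_dist M w y z + e / 2"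
    using conformal_dist_approx[OF y z e] by blast
  have sb: "speed_bound M (glue \<gamma> \<delta>) (\<lambda>t. 2 * glue g h t)"
    by (rule speed_bound_glue) (use \<gamma> \<delta> in auto)
  have "(\<lambda>t. 2 * glue g h t * exp (w (glue \<gamma> \<delta> t))) = (\<lambda>t. 2 * glue (\<lambda>t. g t * exp (w (\<gamma> t))) (\<lambda>t. h t * exp (w (\<delta> t))) t)"
    by (auto simp: glue_def)
  moreover have "((\<lambda>t. 2 * glue (\<lambda>t. g t * exp (w (\<gamma> t))) (\<lambda>t. h t * exp (w (\<delta> t))) t) has_integral (weighted_length \<gamma> g + weighted_length \<delta> h)) {0..1}"
    by (rule has_integral_glue)
       (use weighted_integrable[OF \<gamma>(1)] weighted_integrable[OF \<delta>(1)] in \<open>auto simp: absolutely_integrable_on_def integrable_integral\<close>)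
  ultimately have "weighted_length (glue \<gamma> \<delta>) (\<lambda>t. 2 * glue g h t) = weighted_length \<gamma> g + weighted_length \<delta> h"
    by (simp only: integral_unique)
  moreover have "glue \<gamma> \<delta> 0 = x" "glue \<gamma> \<delta> 1 = z" using \<gamma> \<delta> by (auto simp: glue_def)
  ultimately show "conformal_dist M w x z \<le> conformal_dist M w x y + conformal_dist M w y z + e"
    using conformal_dist_le[OF sb] \<gamma> \<delta> by simp
qed

lemma Metric_space_conformal:
  "Metric_space (mspace M) (\<lambda>x y. if x \<in> mspace M \<and> y \<in> mspace M then conformal_dist M w x y else 0)"
proof
  have nn: "0 \<le> conformal_dist M w x y" if "x \<in> mspace M" "y \<in> mspace M" for x y
    by (rule order_trans[OF _ conformal_dist_bounds(1)[OF that]]) simp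
  show "0 \<le> (if x \<in> mspace M \<and> y \<in> mspace M then conformal_dist M w x y else 0)" for x y
    using nn by auto
  show "(if x \<in> mspace M \<and> y \<in> mspace M then conformal_dist M w x y else 0) = (if y \<in> mspace M \<and> x \<in> mspace M then conformal_dist M w y x else 0)" for x y
    using conformal_dist_commute_le[of x y] conformal_dist_commute_le[of y x] by auto
  show "((if x \<in> mspace M \<and> y \<in> mspace M then conformal_dist M w x y else 0) = 0) = (x = y)" if "x \<in> mspace M" "y \<in> mspace M" for x y
  proof
    assume "(if x \<in> mspace M \<and> y \<in> mspace M then conformal_dist M w x y else 0) = 0"
    then have "exp (- C) * mdist M x y \<le> 0" using conformal_dist_bounds(1)[OF that] that by simp
    then have "mdist M x y \<le> 0" by (simp add: mult_le_0_iff)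
    then show "x = y" using that by (metis mdist_nonneg mdist_zero order_antisym)
  next
    assume "x = y"
    then show "(if x \<in> mspace M \<and> y \<in> mspace M then conformal_dist M w x y else 0) = 0"
    proof -
      have "mdist M x y = 0" using \<open>x = y\<close> that by simp
      then have "conformal_dist M w x y = 0"
        using conformal_dist_bounds(2)[OF that] nn[OF that] by simp
      then show ?thesis by simp
    qed
  qed
qed (auto simp: conformal_dist_triangle)

lemma mspace_conformal [simp]: "mspace (conformal_metric M w) = mspace M"
  unfolding conformal_metric_def by (rule Metric_space.mspace_metric[OF Metric_space_conformal])

lemma mdist_conformal: "x \<in> mspace M \<Longrightarrow> y \<in> mspace M \<Longrightarrow> mdist (conformal_metric M w) x y = conformal_dist M w x y"
  unfolding conformal_metric_def by (simp add: Metric_space.mdist_metric[OF Metric_space_conformal])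

lemma mtopology_of_conformal: "mtopology_of (conformal_metric M w) = mtopology_of M"
proof (rule topology_eq[THEN iffD2], rule allI)
  fix U
  \<comment> \<open>The two metrics are equivalent with factors \<open>exp C\<close> and
    \<open>exp (- C)\<close>, so shrinking a radius by \<open>exp (- C)\<close> suffices in both
    directions.\<close>
  have d: "mdist (conformal_metric M w) x y < exp (- C) * r \<Longrightarrow> mdist M x y < r"
    "mdist M x y < exp (- C) * r \<Longrightarrow> mdist (conformal_metric M w) x y < r"
    if "x \<in> mspace M" "y \<in> mspace M" for x y r
  proof -
    assume "mdist (conformal_metric M w) x y < exp (- C) * r"
    with conformal_dist_bounds(1)[OF that] have "exp (- C) * mdist M x y < exp (- C) * r"
      unfolding mdist_conformal[OF that] by (rule le_less_trans)
    then show "mdist M x y < r" by simp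
  next
    assume "mdist M x y < exp (- C) * r"
    then have "exp C * mdist M x y < exp C * (exp (- C) * r)" by simp
    also have "\<dots> = r" by (simp add: exp_minus)
    finally show "mdist (conformal_metric M w) x y < r"
      using conformal_dist_bounds(2)[OF that] by (simp add: mdist_conformal[OF that])
  qed
  show "openin (mtopology_of (conformal_metric M w)) U = openin (mtopology_of M) U"
    unfolding openin_mtopology_of_iff mspace_conformal
  proof (intro conj_cong refl ball_cong iffI)
    fix x assume "U \<subseteq> mspace M" and x: "x \<in> U"
    then have xm: "x \<in> mspace M" by auto
    show "\<exists>r>0. \<forall>y\<in>mspace M. mdist M x y < r \<longrightarrow> y \<in> U" if "\<exists>r>0. \<forall>y\<in>mspace M. mdist (conformal_metric M w) x y < r \<longrightarrow> y \<in> U"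
    proof -
      from that obtain r where "r > 0" "\<forall>y\<in>mspace M. mdist (conformal_metric M w) x y < r \<longrightarrow> y \<in> U" by blast
      then show ?thesis using d(2)[OF xm] by (intro exI[of _ "exp (- C) * r"]) auto
    qed
    show "\<exists>r>0. \<forall>y\<in>mspace M. mdist (conformal_metric M w) x y < r \<longrightarrow> y \<in> U" if "\<exists>r>0. \<forall>y\<in>mspace M. mdist M x y < r \<longrightarrow> y \<in> U"
    proof -
      from that obtain r where "r > 0" "\<forall>y\<in>mspace M. mdist M x y < r \<longrightarrow> y \<in> U" by blast
      then show ?thesis using d(1)[OF xm] by (intro exI[of _ "exp (- C) * r"]) auto
    qed
  qed
qed

lemma Lipschitz_conformal_iff:
  "Lipschitz_continuous_map (conformal_metric M w) euclidean_metric f \<longleftrightarrow> Lipschitz_continuous_map M euclidean_metric (f :: 'a \<Rightarrow> real)"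
proof
  assume "Lipschitz_continuous_map (conformal_metric M w) euclidean_metric f"
  then obtain B where B: "B > 0" "\<And>x y. x \<in> mspace M \<Longrightarrow> y \<in> mspace M \<Longrightarrow> dist (f x) (f y) \<le> B * conformal_dist M w x y"
    unfolding Lipschitz_continuous_map_pos by (auto simp: mdist_conformal)
  have "dist (f x) (f y) \<le> (B * exp C) * mdist M x y" if "x \<in> mspace M" "y \<in> mspace M" for x y
    using order_trans[OF B(2)[OF that] mult_left_mono[OF conformal_dist_bounds(2)[OF that]]] B(1) by (simp add: mult.assoc)
  then show "Lipschitz_continuous_map M euclidean_metric f"
    unfolding Lipschitz_continuous_map_def by auto
next
  assume "Lipschitz_continuous_map M euclidean_metric f"
  then obtain B where B: "B > 0" "\<And>x y. x \<in> mspace M \<Longrightarrow> y \<in> mspace M \<Longrightarrow> dist (f x) (f y) \<le> B * mdist M x y"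
    unfolding Lipschitz_continuous_map_pos by auto
  have "dist (f x) (f y) \<le> (B * exp C) * conformal_dist M w x y" if "x \<in> mspace M" "y \<in> mspace M" for x y
  proof -
    have "mdist M x y \<le> exp C * conformal_dist M w x y"
      using mult_left_mono[OF conformal_dist_bounds(1)[OF that], of "exp C"]
      by (simp add: mult.assoc[symmetric] flip: exp_add)
    from order_trans[OF B(2)[OF that] mult_left_mono[OF this]] B(1) show ?thesis by (simp add: mult.assoc)
  qed
  then show "Lipschitz_continuous_map (conformal_metric M w) euclidean_metric f"
    unfolding Lipschitz_continuous_map_def by (auto simp: mdist_conformal)
qed

end

text \<open>Eventually the factor is below any \<open>c' > c\<close>, and \<open>c'\<close> can
  decrease to \<open>c\<close> when the upper limit is finite; when it is infinite the right-hand
  side is infinite since \<open>c > 0\<close>.\<close>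

lemma Limsup_mult_tendsto_le:
  fixes a r :: "'b \<Rightarrow> real"
  assumes F: "F \<noteq> bot" and r: "(r \<longlongrightarrow> c) F" and c: "c > 0" and a: "\<And>y. 0 \<le> a y"
  shows "Limsup F (\<lambda>y. ereal (a y * r y)) \<le> ereal c * Limsup F (\<lambda>y. ereal (a y))"
proof -
  let ?L = "Limsup F (\<lambda>y. ereal (a y))"
  have L0: "0 \<le> ?L" by (rule le_Limsup[OF F]) (use a in auto)
  have le: "Limsup F (\<lambda>y. ereal (a y * r y)) \<le> ereal c' * ?L" if c': "c' > c" for c'
  proof -
    have "Limsup F (\<lambda>y. ereal (a y * r y)) \<le> Limsup F (\<lambda>y. ereal c' * ereal (a y))"
    proof (rule Limsup_mono)
      show "\<forall>\<^sub>F y in F. ereal (a y * r y) \<le> ereal c' * ereal (a y)"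
        using order_tendstoD(2)[OF r c']
      proof eventually_elim
        case (elim y)
        have "a y * r y \<le> a y * c'" using elim a[of y] by (intro mult_left_mono) auto
        then show ?case by (simp add: mult.commute)
      qed
    qed
    also have "\<dots> = ereal c' * ?L" by (rule Limsup_ereal_mult_left[OF F]) (use c c' in simp)
    finally show ?thesis .
  qed
  show ?thesis
  proof (cases ?L)
    case (real l)
    have "((\<lambda>c'. ereal (c' * l)) \<longlongrightarrow> ereal (c * l)) (at_right c)"
      by (intro tendsto_intros)
    then have "Limsup F (\<lambda>y. ereal (a y * r y)) \<le> ereal (c * l)"
    proof (rule tendsto_lowerbound)
      show "\<forall>\<^sub>F c' in at_right c. Limsup F (\<lambda>y. ereal (a y * r y)) \<le> ereal (c' * l)"
        using eventually_at_right_less[of c] by eventually_elim (use le real in auto)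
    qed simp
    then show ?thesis using real by simp
  qed (use c L0 in auto)
qed

section \<open>Infinitesimal comparison of the two metrics\<close>

context conformal_change
begin

abbreviation "M' \<equiv> conformal_metric M w"

text \<open>On a ball where \<open>exp (w z)\<close> differs from \<open>exp (w x)\<close> by less
  than \<open>e / 2\<close>, \<open>conformal_dist_le_mult\<close> bounds the ratio from above and
  \<open>conformal_dist_ge\<close> from below.\<close>

lemma conformal_dist_ratio:
  assumes x: "x \<in> mspace M"
  shows "((\<lambda>y. mdist M' x y / mdist M x y) \<longlongrightarrow> exp (w x)) (atin (mtopology_of M) x)"
proof (rule tendstoI)
  fix e :: real assume e: "e > 0"
  have "continuous_map (mtopology_of M) euclideanreal (\<lambda>z. exp (w z))"
    using continuous_map_compose[OF w_cont, of euclideanreal exp]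
    by (simp add: comp_def continuous_on_exp)
  from openin_continuous_map_preimage[OF this, of "ball (exp (w x)) (e / 2)"]
  have "openin (mtopology_of M) {z \<in> mspace M. exp (w z) \<in> ball (exp (w x)) (e / 2)}" by simp
  moreover have "x \<in> {z \<in> mspace M. exp (w z) \<in> ball (exp (w x)) (e / 2)}" using x e by simp
  ultimately obtain r where r: "r > 0" and "\<forall>z\<in>mspace M. mdist M x z < r \<longrightarrow> z \<in> {z \<in> mspace M. exp (w z) \<in> ball (exp (w x)) (e / 2)}"
    unfolding openin_mtopology_of_iff by blast
  then have near: "\<bar>exp (w x) - exp (w z)\<bar> < e / 2" if "z \<in> mspace M" "mdist M x z < r" for z
    using that by (auto simp: dist_real_def)
  \<comment> \<open>Truncated at 0 because \<open>conformal_dist_ge\<close> asks for a nonnegative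
    lower bound of the weight.\<close>
  define k where "k = max 0 (exp (w x) - e / 2)"
  have kC: "k \<le> exp C"
  proof -
    have "exp (w x) \<le> exp C" using w_bdd[OF x] by simp
    then have "exp (w x) - e / 2 \<le> exp C" using e by linarith
    then show ?thesis by (simp add: k_def)
  qed
  \<comment> \<open>Since \<open>k \<le> exp C\<close>, this radius guarantees that
    \<open>k * ?d\<close> stays below \<open>exp (- C) * r\<close>, so leaving the ball is never
    cheaper than going straight.\<close>
  let ?\<delta> = "min r (exp (- C) * exp (- C) * r)"
  show "\<forall>\<^sub>F y in atin (mtopology_of M) x. dist (mdist M' x y / mdist M x y) (exp (w x)) < e"
    unfolding eventually_atin_mtopology_of[OF x]
  proof (intro exI[of _ ?\<delta>] conjI ballI impI)
    show "?\<delta> > 0" using r by simp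
    fix y assume y: "y \<in> mspace M" and d: "0 < mdist M x y \<and> mdist M x y < ?\<delta>"
    let ?d = "mdist M x y"
    have "conformal_dist M w x y \<le> (exp (w x) + e / 2) * ?d"
    proof (rule conformal_dist_le_mult[OF x y])
      fix z assume z: "z \<in> mspace M" "mdist M x z \<le> ?d"
      then have "\<bar>exp (w x) - exp (w z)\<bar> < e / 2" using d near[of z] by simp
      then show "exp (w z) \<le> exp (w x) + e / 2" by linarith
    qed
    then have up: "mdist M' x y / ?d \<le> exp (w x) + e / 2"
      using d by (simp add: mdist_conformal[OF x y] pos_divide_le_eq)
    have "min (k * ?d) (exp (- C) * r) \<le> conformal_dist M w x y"
    proof (rule conformal_dist_ge[OF x y])
      show "?d < r" "0 \<le> k" using d by (auto simp: k_def)
      fix z assume z: "z \<in> mspace M" "mdist M x z < r"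
      from near[OF z] have "exp (w x) - e / 2 \<le> exp (w z)" by linarith
      then show "k \<le> exp (w z)" by (simp add: k_def)
    qed
    moreover have "k * ?d \<le> exp (- C) * r"
    proof -
      have "k * ?d \<le> exp C * (exp (- C) * exp (- C) * r)"
        using kC d by (intro mult_mono) auto
      also have "\<dots> = exp (- C) * r" by (simp add: mult.assoc[symmetric] flip: exp_add)
      finally show ?thesis .
    qed
    ultimately have "k * ?d \<le> conformal_dist M w x y" by simp
    then have "k \<le> mdist M' x y / ?d"
      using d by (simp add: mdist_conformal[OF x y] pos_le_divide_eq)
    then have "exp (w x) - e / 2 \<le> mdist M' x y / ?d" by (simp add: k_def)
    with up e show "dist (mdist M' x y / ?d) (exp (w x)) < e" by (simp add: dist_real_def abs_less_iff)
  qed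
qed

text \<open>The ratio of the metrics and its inverse both converge, so the upper limits are compared
  in both directions with mutually inverse factors, which leaves only equality.\<close>

lemma local_lip_conformal:
  assumes x: "x \<in> mspace M"
  shows "local_lip M' f x = exp (- w x) * local_lip M f x"
proof (cases "openin (mtopology_of M) {x}")
  case True
  then show ?thesis by (simp add: local_lip_def mtopology_of_conformal)
next
  case False
  let ?F = "atin (mtopology_of M) x"
  have F: "?F \<noteq> bot" by (rule atin_mtopology_of_nontrivial[OF x False])
  let ?q = "\<lambda>y. \<bar>f y - f x\<bar> / mdist M x y" and ?q' = "\<lambda>y. \<bar>f y - f x\<bar> / mdist M' x y"
  have nz: "\<forall>\<^sub>F y in ?F. mdist M x y \<noteq> 0 \<and> mdist M' x y \<noteq> 0"
    unfolding eventually_atin_mtopology_of[OF x]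
  proof (intro exI[of _ 1] conjI ballI impI)
    fix y assume y: "y \<in> mspace M" "0 < mdist M x y \<and> mdist M x y < 1"
    then show "mdist M x y \<noteq> 0" by simp
    then have "x \<noteq> y" using x by auto
    then show "mdist M' x y \<noteq> 0" using mdist_zero[of x M' y] x y by simp
  qed simp
  have r1: "((\<lambda>y. mdist M' x y / mdist M x y) \<longlongrightarrow> exp (w x)) ?F" by (rule conformal_dist_ratio[OF x])
  have r2: "((\<lambda>y. mdist M x y / mdist M' x y) \<longlongrightarrow> exp (- w x)) ?F"
    using tendsto_inverse[OF r1] by (simp add: exp_minus)
  have "Limsup ?F (\<lambda>y. ereal (?q' y)) = Limsup ?F (\<lambda>y. ereal (?q y * (mdist M x y / mdist M' x y)))"
    by (rule Limsup_eq, use nz in eventually_elim) auto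
  also have "\<dots> \<le> ereal (exp (- w x)) * Limsup ?F (\<lambda>y. ereal (?q y))"
    by (rule Limsup_mult_tendsto_le[OF F r2]) auto
  finally have 1: "Limsup ?F (\<lambda>y. ereal (?q' y)) \<le> ereal (exp (- w x)) * Limsup ?F (\<lambda>y. ereal (?q y))" .
  have "Limsup ?F (\<lambda>y. ereal (?q y)) = Limsup ?F (\<lambda>y. ereal (?q' y * (mdist M' x y / mdist M x y)))"
    by (rule Limsup_eq, use nz in eventually_elim) auto
  also have "\<dots> \<le> ereal (exp (w x)) * Limsup ?F (\<lambda>y. ereal (?q' y))"
    by (rule Limsup_mult_tendsto_le[OF F r1]) auto
  finally have 2: "Limsup ?F (\<lambda>y. ereal (?q y)) \<le> ereal (exp (w x)) * Limsup ?F (\<lambda>y. ereal (?q' y))" .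
  have "ereal (exp (- w x)) * Limsup ?F (\<lambda>y. ereal (?q y)) \<le> ereal (exp (- w x)) * (ereal (exp (w x)) * Limsup ?F (\<lambda>y. ereal (?q' y)))"
    by (rule ereal_mult_left_mono[OF 2]) simp
  also have "\<dots> = Limsup ?F (\<lambda>y. ereal (?q' y))"
    unfolding mult.assoc[symmetric] times_ereal.simps by (simp flip: exp_add)
  finally have "Limsup ?F (\<lambda>y. ereal (?q' y)) = ereal (exp (- w x)) * Limsup ?F (\<lambda>y. ereal (?q y))"
    using 1 by (intro antisym)
  then show ?thesis using False by (simp add: local_lip_def mtopology_of_conformal)
qed

end

section \<open>Integration against a bounded density\<close>

lemma L2_conformal_measure:
  fixes v :: "'a \<Rightarrow> real"
  assumes v: "v \<in> borel_measurable m" "\<And>x. x \<in> space m \<Longrightarrow> \<bar>v x\<bar> \<le> V"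
  shows "L2 (conformal_measure m v) = L2 m"
proof -
  have "integrable (conformal_measure m v) (\<lambda>x. (f x)\<^sup>2) \<longleftrightarrow> integrable m (\<lambda>x. (f x)\<^sup>2)" if f: "f \<in> borel_measurable m" for f :: "'a \<Rightarrow> real"
  proof -
    have "integrable (conformal_measure m v) (\<lambda>x. (f x)\<^sup>2) \<longleftrightarrow> integrable m (\<lambda>x. exp (v x) * (f x)\<^sup>2)"
      unfolding conformal_measure_def using v f by (subst integrable_density) auto
    also have "\<dots> \<longleftrightarrow> integrable m (\<lambda>x. (f x)\<^sup>2)"
    proof
      assume i: "integrable m (\<lambda>x. exp (v x) * (f x)\<^sup>2)"
      show "integrable m (\<lambda>x. (f x)\<^sup>2)"
      proof (rule Bochner_Integration.integrable_bound)
        show "integrable m (\<lambda>x. exp V * (exp (v x) * (f x)\<^sup>2))" using i by simp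
        show "AE x in m. norm ((f x)\<^sup>2) \<le> norm (exp V * (exp (v x) * (f x)\<^sup>2))"
        proof (rule AE_I2)
          fix x assume "x \<in> space m"
          then have "1 \<le> exp V * exp (v x)" using v(2)[of x] by (simp flip: exp_add)
          from mult_right_mono[OF this, of "(f x)\<^sup>2"] show "norm ((f x)\<^sup>2) \<le> norm (exp V * (exp (v x) * (f x)\<^sup>2))"
            by (simp add: mult.assoc)
        qed
      qed (use f in auto)
    next
      assume i: "integrable m (\<lambda>x. (f x)\<^sup>2)"
      show "integrable m (\<lambda>x. exp (v x) * (f x)\<^sup>2)"
      proof (rule Bochner_Integration.integrable_bound)
        show "integrable m (\<lambda>x. exp V * (f x)\<^sup>2)" using i by simp
        show "AE x in m. norm (exp (v x) * (f x)\<^sup>2) \<le> norm (exp V * (f x)\<^sup>2)"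
        proof (rule AE_I2)
          fix x assume "x \<in> space m"
          then have "exp (v x) \<le> exp V" using v(2)[of x] by simp
          from mult_right_mono[OF this, of "(f x)\<^sup>2"] show "norm (exp (v x) * (f x)\<^sup>2) \<le> norm (exp V * (f x)\<^sup>2)"
            by simp
        qed
      qed (use f v in auto)
    qed
    finally show ?thesis .
  qed
  then show ?thesis by (auto simp: L2_def conformal_measure_def)
qed

lemma integral_conformal_measure:
  fixes f :: "'a \<Rightarrow> real"
  assumes "v \<in> borel_measurable m" "f \<in> borel_measurable m"
  shows "(\<integral>x. f x \<partial>conformal_measure m v) = (\<integral>x. exp (v x) * f x \<partial>m)"
  unfolding conformal_measure_def using assms by (subst integral_density) auto

lemma AE_conformal_measure:
  assumes "v \<in> borel_measurable m"
  shows "(AE x in conformal_measure m v. P x) \<longleftrightarrow> (AE x in m. P x)"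
  unfolding conformal_measure_def using assms by (subst AE_density) auto

lemma L2_tendsto_conformal_measure:
  fixes v :: "'a \<Rightarrow> real"
  assumes v: "v \<in> borel_measurable m" "\<And>x. x \<in> space m \<Longrightarrow> \<bar>v x\<bar> \<le> V"
  shows "L2_tendsto (conformal_measure m v) F f \<longleftrightarrow> L2_tendsto m F f"
proof -
  have "(\<lambda>n. \<integral>x. (F n x - f x)\<^sup>2 \<partial>conformal_measure m v) \<longlonglongrightarrow> 0 \<longleftrightarrow> (\<lambda>n. \<integral>x. (F n x - f x)\<^sup>2 \<partial>m) \<longlonglongrightarrow> 0"
    if L2: "\<And>n. F n \<in> L2 m" "f \<in> L2 m"
  proof -
    have D: "(\<lambda>x. F n x - f x) \<in> L2 m" for n by (rule L2_diff[OF L2])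
    have i1: "integrable m (\<lambda>x. (F n x - f x)\<^sup>2)" for n by (rule L2_integrable[OF D])
    have eq: "(\<integral>x. (F n x - f x)\<^sup>2 \<partial>conformal_measure m v) = (\<integral>x. exp (v x) * (F n x - f x)\<^sup>2 \<partial>m)" for n
      using integral_conformal_measure[OF v(1)] L2_measurable[OF D] by simp
    have i2: "integrable m (\<lambda>x. exp (v x) * (F n x - f x)\<^sup>2)" for n
    proof -
      have "(\<lambda>x. F n x - f x) \<in> L2 (conformal_measure m v)" using D L2_conformal_measure[OF v] by simp
      from L2_integrable[OF this] show ?thesis
        unfolding conformal_measure_def using v(1) L2_measurable[OF D, of n] by (subst (asm) integrable_density) auto
    qed
    have e: "exp (- V) \<le> exp (v x)" "exp (v x) \<le> exp V" if "x \<in> space m" for x using v(2)[OF that] by auto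
    have up: "(\<integral>x. exp (v x) * (F n x - f x)\<^sup>2 \<partial>m) \<le> exp V * (\<integral>x. (F n x - f x)\<^sup>2 \<partial>m)" for n
    proof -
      have "(\<integral>x. exp (v x) * (F n x - f x)\<^sup>2 \<partial>m) \<le> (\<integral>x. exp V * (F n x - f x)\<^sup>2 \<partial>m)"
        by (rule integral_mono) (use i1 i2 e in \<open>auto intro!: mult_right_mono\<close>)
      then show ?thesis by simp
    qed
    have lo: "exp (- V) * (\<integral>x. (F n x - f x)\<^sup>2 \<partial>m) \<le> (\<integral>x. exp (v x) * (F n x - f x)\<^sup>2 \<partial>m)" for n
    proof -
      have "(\<integral>x. exp (- V) * (F n x - f x)\<^sup>2 \<partial>m) \<le> (\<integral>x. exp (v x) * (F n x - f x)\<^sup>2 \<partial>m)"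
        by (rule integral_mono) (use i1 i2 e in \<open>auto intro!: mult_right_mono\<close>)
      then show ?thesis by simp
    qed
    have nn: "0 \<le> (\<integral>x. exp (v x) * (F n x - f x)\<^sup>2 \<partial>m)" "0 \<le> (\<integral>x. (F n x - f x)\<^sup>2 \<partial>m)" for n
      by (simp_all add: integral_nonneg)
    show ?thesis unfolding eq
    proof
      assume *: "(\<lambda>n. \<integral>x. exp (v x) * (F n x - f x)\<^sup>2 \<partial>m) \<longlonglongrightarrow> 0"
      have "(\<integral>x. (F n x - f x)\<^sup>2 \<partial>m) \<le> exp V * (\<integral>x. exp (v x) * (F n x - f x)\<^sup>2 \<partial>m)" for n
        using mult_left_mono[OF lo[of n], of "exp V"] by (simp add: mult.assoc[symmetric] flip: exp_add)
      then show "(\<lambda>n. \<integral>x. (F n x - f x)\<^sup>2 \<partial>m) \<longlonglongrightarrow> 0"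
        using nn by (intro Lim_null_comparison[OF _ tendsto_mult_right_zero[OF *, of "exp V"]]) (simp add: always_eventually)
    next
      assume *: "(\<lambda>n. \<integral>x. (F n x - f x)\<^sup>2 \<partial>m) \<longlonglongrightarrow> 0"
      show "(\<lambda>n. \<integral>x. exp (v x) * (F n x - f x)\<^sup>2 \<partial>m) \<longlonglongrightarrow> 0"
        using nn up by (intro Lim_null_comparison[OF _ tendsto_mult_right_zero[OF *, of "exp V"]]) (simp add: always_eventually)
    qed
  qed
  then show ?thesis by (auto simp: L2_tendsto_def L2_conformal_measure[OF v])
qed

section \<open>The conformal transformation\<close>

lemma is_min_weak_upper_gradient_unique:
  assumes "is_min_weak_upper_gradient M m f G" "is_min_weak_upper_gradient M m f H"
  shows "AE x in m. G x = H x"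
proof -
  have "AE x in m. G x \<le> H x" "AE x in m. H x \<le> G x"
    using assms by (auto simp: is_min_weak_upper_gradient_def)
  then show ?thesis by eventually_elim simp
qed

locale conformal_transformation = borel_metric_measure M m + conformal_change M w C
  for M :: "'a metric" and m :: "'a measure" and w :: "'a \<Rightarrow> real" and C :: real +
  fixes v :: "'a \<Rightarrow> real" and V :: real
  assumes v_cont: "continuous_map (mtopology_of M) euclideanreal v"
    and v_bdd: "x \<in> mspace M \<Longrightarrow> \<bar>v x\<bar> \<le> V"
begin

abbreviation "m' \<equiv> conformal_measure m v"

lemma v_meas: "v \<in> borel_measurable m" and w_meas: "w \<in> borel_measurable m"
  using continuous_measurable v_cont w_cont by auto

lemma v_bdd': "x \<in> space m \<Longrightarrow> \<bar>v x\<bar> \<le> V"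
  using v_bdd by (simp add: space_eq)

lemma exp_w_meas: "(\<lambda>x. exp (w x)) \<in> borel_measurable m" "(\<lambda>x. exp (- w x)) \<in> borel_measurable m"
  using w_meas by measurable

lemma exp_w_bdd:
  assumes "x \<in> space m" shows "\<bar>exp (w x)\<bar> \<le> exp C" "\<bar>exp (- w x)\<bar> \<le> exp C"
  using w_bdd[of x] assms by (auto simp: space_eq)

lemma L2_tendsto': "L2_tendsto m' F f \<longleftrightarrow> L2_tendsto m F f"
  by (rule L2_tendsto_conformal_measure[OF v_meas v_bdd'])

lemma L2': "L2 m' = L2 m"
  by (rule L2_conformal_measure[OF v_meas v_bdd'])

lemma lip_limit_conformal:
  assumes "lip_limit M m f G"
  shows "lip_limit M' m' f (\<lambda>x. exp (- w x) * G x)"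
proof -
  obtain F :: "nat \<Rightarrow> 'a \<Rightarrow> real" where F: "\<And>n. Lip M (F n)" "L2_tendsto m F f" "L2_tendsto m (\<lambda>n. local_lip M (F n)) G"
    using assms unfolding lip_limit_def by blast
  have "L2_tendsto m (\<lambda>n. local_lip M' (F n)) (\<lambda>x. exp (- w x) * G x)"
    by (rule L2_tendsto_cong[OF L2_tendsto_bounded_mult[OF F(3) exp_w_meas(2) exp_w_bdd(2)]])
       (simp_all add: local_lip_conformal space_eq)
  then show ?thesis
    unfolding lip_limit_def Lipschitz_conformal_iff L2_tendsto' by (intro exI[of _ F] conjI allI F)
qed

lemma lip_limit_conformal_inverse:
  assumes "lip_limit M' m' f H"
  shows "lip_limit M m f (\<lambda>x. exp (w x) * H x)"
proof -
  obtain F :: "nat \<Rightarrow> 'a \<Rightarrow> real" where F: "\<And>n. Lip M (F n)" "L2_tendsto m F f" "L2_tendsto m (\<lambda>n. local_lip M' (F n)) H"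
    using assms unfolding lip_limit_def Lipschitz_conformal_iff L2_tendsto' by blast
  have "L2_tendsto m (\<lambda>n. local_lip M (F n)) (\<lambda>x. exp (w x) * H x)"
  proof (rule L2_tendsto_cong[OF L2_tendsto_bounded_mult[OF F(3) exp_w_meas(1) exp_w_bdd(1)]])
    fix n x assume "x \<in> space m"
    then show "exp (w x) * local_lip M' (F n) x = local_lip M (F n) x"
      by (simp add: local_lip_conformal space_eq mult.assoc[symmetric] flip: exp_add)
  qed simp_all
  then show ?thesis unfolding lip_limit_def by (intro exI[of _ F] conjI allI F)
qed

lemma W12_conformal: "W12 M' m' = W12 M m"
  unfolding W12_def L2'
  using lip_limit_conformal lip_limit_conformal_inverse by blast

lemma AE': "(AE x in m'. P x) \<longleftrightarrow> (AE x in m. P x)"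
  by (rule AE_conformal_measure[OF v_meas])

lemma is_min_conformal:
  assumes "is_min_weak_upper_gradient M m f G"
  shows "is_min_weak_upper_gradient M' m' f (\<lambda>x. exp (- w x) * G x)"
  unfolding is_min_weak_upper_gradient_def AE'
proof (intro conjI allI impI)
  show "lip_limit M' m' f (\<lambda>x. exp (- w x) * G x)"
    using assms lip_limit_conformal by (auto simp: is_min_weak_upper_gradient_def)
  fix H assume "lip_limit M' m' f H"
  then have "AE x in m. G x \<le> exp (w x) * H x"
    using assms lip_limit_conformal_inverse by (auto simp: is_min_weak_upper_gradient_def)
  then show "AE x in m. exp (- w x) * G x \<le> H x"
  proof eventually_elim
    case (elim x)
    from mult_left_mono[OF this, of "exp (- w x)"] show ?case
      by (simp add: mult.assoc[symmetric] flip: exp_add)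
  qed
qed

abbreviation grad' :: "('a \<Rightarrow> real) \<Rightarrow> 'a \<Rightarrow> real" where
  "grad' \<equiv> min_weak_upper_gradient M' m'"

lemma is_min_grad':
  assumes "f \<in> W12 M m" shows "is_min_weak_upper_gradient M' m' f (grad' f)"
proof -
  have "\<exists>G. is_min_weak_upper_gradient M' m' f G"
    using is_min_conformal[OF is_min_grad[OF assms]] by blast
  from someI_ex[OF this] show ?thesis by (simp only: min_weak_upper_gradient_def)
qed

lemma grad_conformal:
  assumes "f \<in> W12 M m" shows "AE x in m. grad' f x = exp (- w x) * grad f x"
  using is_min_weak_upper_gradient_unique[OF is_min_grad'[OF assms] is_min_conformal[OF is_min_grad[OF assms]]]
  unfolding AE' .

lemma W12_norm_power2: "(W12_norm M m f)\<^sup>2 = (l2norm m f)\<^sup>2 + (l2norm m (grad f))\<^sup>2"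
  by (simp add: W12_norm_def l2norm_power2 integral_nonneg)

lemma grad'_L2: "f \<in> W12 M m \<Longrightarrow> grad' f \<in> L2 m"
  using is_min_grad'[of f]
  by (auto simp: is_min_weak_upper_gradient_def lip_limit_def L2_tendsto_def L2')

text \<open>The density and the factor of the gradient are moved inside the squares as
  \<open>exp (v x / 2)\<close> and \<open>exp (v x / 2 - w x)\<close>, so that the norm of
  \<open>M'\<close> becomes a weighted norm over \<open>m\<close> and the tools for
  \<open>l2norm m\<close> apply.\<close>

lemma W12_norm_conformal_power2:
  assumes f: "f \<in> W12 M m"
  shows "(W12_norm M' m' f)\<^sup>2 = (l2norm m (\<lambda>x. exp (v x / 2) * f x))\<^sup>2 + (l2norm m (\<lambda>x. exp (v x / 2 - w x) * grad f x))\<^sup>2"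
proof -
  have fm: "f \<in> borel_measurable m" "grad f \<in> borel_measurable m" "grad' f \<in> borel_measurable m"
    using L2_measurable[OF W12_L2[OF f]] L2_measurable[OF grad_L2[OF f]] L2_measurable[OF grad'_L2[OF f]] by auto
  have sq: "(exp (a / 2))\<^sup>2 = exp a" for a :: real by (simp add: power2_eq_square flip: exp_add)
  have 1: "(\<integral>x. (f x)\<^sup>2 \<partial>m') = (\<integral>x. (exp (v x / 2) * f x)\<^sup>2 \<partial>m)"
    using integral_conformal_measure[OF v_meas] fm by (simp add: power_mult_distrib sq)
  have "(\<integral>x. (grad' f x)\<^sup>2 \<partial>m') = (\<integral>x. exp (v x) * (grad' f x)\<^sup>2 \<partial>m)"
    using integral_conformal_measure[OF v_meas] fm by simp
  also have "\<dots> = (\<integral>x. (exp (v x / 2 - w x) * grad f x)\<^sup>2 \<partial>m)"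
  proof (rule integral_cong_AE)
    show "AE x in m. exp (v x) * (grad' f x)\<^sup>2 = (exp (v x / 2 - w x) * grad f x)\<^sup>2"
      using grad_conformal[OF f]
    proof eventually_elim
      case (elim x)
      have "exp (v x / 2 - w x) = exp (v x / 2) * exp (- w x)" by (simp flip: exp_add)
      with elim show ?case by (simp add: power_mult_distrib sq)
    qed
  qed (use fm v_meas w_meas in measurable)
  finally show ?thesis using 1 by (simp add: W12_norm_def l2norm_power2 integral_nonneg)
qed

text \<open>Equivalence of the two Sobolev norms, through which completeness is transferred.\<close>

lemma ex_norm_bound:
  obtains K where "K > 0"
    "\<And>f. f \<in> W12 M m \<Longrightarrow> W12_norm M' m' f \<le> K * W12_norm M m f"
    "\<And>f. f \<in> W12 M m \<Longrightarrow> W12_norm M m f \<le> K * W12_norm M' m' f"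
proof -
  \<comment> \<open>One constant that bounds both weights of the norm and their reciprocals.\<close>
  define K where "K = exp (\<bar>V\<bar> / 2 + \<bar>C\<bar>)"
  have K: "K > 0" by (simp add: K_def)
  have vm: "(\<lambda>x. exp (v x / 2)) \<in> borel_measurable m" "(\<lambda>x. exp (v x / 2 - w x)) \<in> borel_measurable m"
    "(\<lambda>x. exp (- v x / 2)) \<in> borel_measurable m" "(\<lambda>x. exp (w x - v x / 2)) \<in> borel_measurable m"
    using v_meas w_meas by measurable
  have vb: "\<bar>exp (v x / 2)\<bar> \<le> K" "\<bar>exp (v x / 2 - w x)\<bar> \<le> K" "\<bar>exp (- v x / 2)\<bar> \<le> K" "\<bar>exp (w x - v x / 2)\<bar> \<le> K"
    if "x \<in> space m" for x
    using v_bdd[of x] w_bdd[of x] that unfolding K_def space_eq by auto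
  have N: "a\<^sup>2 + b\<^sup>2 \<le> K\<^sup>2 * (c\<^sup>2 + d\<^sup>2)" if "a \<le> \<bar>K\<bar> * c" "b \<le> \<bar>K\<bar> * d" "0 \<le> a" "0 \<le> b" for a b c d
    using power_mono[OF that(1,3), of 2] power_mono[OF that(2,4), of 2] by (simp add: power_mult_distrib distrib_left)
  have nn: "0 \<le> W12_norm M m f" "0 \<le> W12_norm M' m' f" for f
    by (simp_all add: W12_norm_def integral_nonneg)
  have root: "a \<le> K * b" if "a\<^sup>2 \<le> K\<^sup>2 * b\<^sup>2" "0 \<le> b" for a b
    by (rule power2_le_imp_le) (use that K in \<open>simp_all add: power_mult_distrib\<close>)
  show thesis
  proof (rule that[OF K])
    fix f assume f: "f \<in> W12 M m"
    note L = W12_L2[OF f] grad_L2[OF f]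
    have "(W12_norm M' m' f)\<^sup>2 \<le> K\<^sup>2 * (W12_norm M m f)\<^sup>2"
      unfolding W12_norm_conformal_power2[OF f] W12_norm_power2
      by (rule N[OF L2_bounded_mult(2)[OF L(1) vm(1) vb(1)] L2_bounded_mult(2)[OF L(2) vm(2) vb(2)]]) auto
    then show "W12_norm M' m' f \<le> K * W12_norm M m f" using nn by (intro root)
    have i1: "(\<lambda>x. exp (- v x / 2) * (exp (v x / 2) * f x)) = f"
      and i2: "(\<lambda>x. exp (w x - v x / 2) * (exp (v x / 2 - w x) * grad f x)) = grad f"
      by (simp_all add: fun_eq_iff mult.assoc[symmetric] flip: exp_add)
    have "(W12_norm M m f)\<^sup>2 \<le> K\<^sup>2 * (W12_norm M' m' f)\<^sup>2"
      unfolding W12_norm_conformal_power2[OF f] W12_norm_power2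
      by (rule N[OF L2_bounded_mult(2)[OF L2_bounded_mult(1)[OF L(1) vm(1) vb(1)] vm(3) vb(3), unfolded i1]
            L2_bounded_mult(2)[OF L2_bounded_mult(1)[OF L(2) vm(2) vb(2)] vm(4) vb(4), unfolded i2]]) auto
    then show "W12_norm M m f \<le> K * W12_norm M' m' f" using nn by (intro root)
  qed
qed

text \<open>An inner product gives the parallelogram identity for the full norm. The part without
  gradients satisfies it on its own and can be subtracted.\<close>

lemma infinitesimally_hilbertian_energy:
  assumes "infinitesimally_hilbertian M m" and f: "f \<in> W12 M m" and g: "g \<in> W12 M m"
  shows "(l2norm m (grad (\<lambda>x. f x + g x)))\<^sup>2 + (l2norm m (grad (\<lambda>x. f x - g x)))\<^sup>2 =
    2 * (l2norm m (grad f))\<^sup>2 + 2 * (l2norm m (grad g))\<^sup>2"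
proof -
  obtain B :: "('a \<Rightarrow> real) \<Rightarrow> ('a \<Rightarrow> real) \<Rightarrow> real" where
    sym: "\<forall>f\<in>W12 M m. \<forall>g\<in>W12 M m. B f g = B g f" and
    add: "\<forall>f\<in>W12 M m. \<forall>g\<in>W12 M m. \<forall>h\<in>W12 M m. B (\<lambda>x. f x + g x) h = B f h + B g h" and
    mult: "\<forall>c. \<forall>f\<in>W12 M m. \<forall>g\<in>W12 M m. B (\<lambda>x. c * f x) g = c * B f g" and
    pos: "\<forall>f\<in>W12 M m. B f f \<ge> 0 \<and> W12_norm M m f = sqrt (B f f)"
    using assms(1) unfolding infinitesimally_hilbertian_def hilbert_space_on_def by blast
  have N: "(W12_norm M m h)\<^sup>2 = B h h" if "h \<in> W12 M m" for h using pos that by simp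
  have sq: "B (\<lambda>x. f x + g x) (\<lambda>x. f x + g x) = B f f + 2 * B f g + B g g" if "f \<in> W12 M m" "g \<in> W12 M m" for f g
  proof -
    note s = W12_add[OF that]
    have "B (\<lambda>x. f x + g x) (\<lambda>x. f x + g x) = B f (\<lambda>x. f x + g x) + B g (\<lambda>x. f x + g x)" using add that s by blast
    also have "B f (\<lambda>x. f x + g x) = B (\<lambda>x. f x + g x) f" using sym that s by blast
    also have "\<dots> = B f f + B g f" using add that by blast
    also have "B g (\<lambda>x. f x + g x) = B (\<lambda>x. f x + g x) g" using sym that s by blast
    also have "\<dots> = B f g + B g g" using add that by blast
    also have "B g f = B f g" using sym that by blast
    finally show ?thesis by simp
  qed
  let ?g = "\<lambda>x. (-1) * g x"
  have g': "?g \<in> W12 M m" by (rule W12_cmult[OF g])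
  have m1: "B f ?g = - B f g"
  proof -
    have "B f ?g = B ?g f" using sym f g' by blast
    also have "\<dots> = (-1) * B g f" using mult f g by blast
    also have "B g f = B f g" using sym f g by blast
    finally show ?thesis by simp
  qed
  have m2: "B ?g ?g = B g g"
  proof -
    have "B ?g ?g = (-1) * B g ?g" using mult g g' by blast
    also have "B g ?g = B ?g g" using sym g g' by blast
    also have "B ?g g = (-1) * B g g" using mult g by blast
    finally show ?thesis by simp
  qed
  have e: "(\<lambda>x. f x + ?g x) = (\<lambda>x. f x - g x)" by simp
  have "(W12_norm M m (\<lambda>x. f x + g x))\<^sup>2 + (W12_norm M m (\<lambda>x. f x - g x))\<^sup>2 = 2 * (W12_norm M m f)\<^sup>2 + 2 * (W12_norm M m g)\<^sup>2"
    using sq[OF f g] sq[OF f g', unfolded e m1 m2] N[OF W12_add[OF f g]] N[OF W12_diff[OF f g]] N[OF f] N[OF g] by simp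
  then show ?thesis
    using l2norm_parallelogram[OF W12_L2[OF f] W12_L2[OF g]] unfolding W12_norm_power2 by simp
qed

text \<open>The pointwise identity survives multiplication by the weight of the gradient, so the new
  norm satisfies the parallelogram identity and comes from an inner product; completeness follows
  from equivalence of the norms.\<close>

lemma infinitesimally_hilbertian_conformal:
  assumes H: "infinitesimally_hilbertian M m"
  shows "infinitesimally_hilbertian M' m'"
proof -
  let ?V = "W12 M m" and ?N = "W12_norm M m" and ?N' = "W12_norm M' m'"
  have zero: "(\<lambda>x. 0) \<in> ?V"
    using H unfolding infinitesimally_hilbertian_def hilbert_space_on_def by (elim conjE)
  have complete: "\<forall>F :: nat \<Rightarrow> 'a \<Rightarrow> real. (\<forall>n. F n \<in> ?V) \<and> (\<forall>e>0. \<exists>K. \<forall>i\<ge>K. \<forall>j\<ge>K. ?N (\<lambda>x. F i x - F j x) < e) \<longrightarrow>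
        (\<exists>f\<in>?V. (\<lambda>n. ?N (\<lambda>x. F n x - f x)) \<longlonglongrightarrow> 0)"
    using H unfolding infinitesimally_hilbertian_def hilbert_space_on_def by (elim conjE)
  have nn: "0 \<le> ?N f" "0 \<le> ?N' f" for f by (simp_all add: W12_norm_def integral_nonneg)
  define \<rho> where "\<rho> x = exp (v x / 2)" for x
  define \<sigma> where "\<sigma> x = exp (v x / 2 - w x)" for x
  have m: "\<rho> \<in> borel_measurable m" "\<sigma> \<in> borel_measurable m"
    unfolding \<rho>_def[abs_def] \<sigma>_def[abs_def] using v_meas w_meas by measurable
  have b: "\<bar>\<rho> x\<bar> \<le> exp (V / 2)" "\<bar>\<sigma> x\<bar> \<le> exp (V / 2 + C)" if "x \<in> space m" for x
    using v_bdd[of x] w_bdd[of x] that unfolding \<rho>_def \<sigma>_def space_eq by auto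
  have \<rho>L: "(\<lambda>x. \<rho> x * h x) \<in> L2 m" and \<sigma>L: "(\<lambda>x. \<sigma> x * h x) \<in> L2 m" if "h \<in> L2 m" for h
    by (rule L2_bounded_mult(1)[OF that m(1) b(1)], simp, rule L2_bounded_mult(1)[OF that m(2) b(2)], simp)
  have N': "(?N' f)\<^sup>2 = (l2norm m (\<lambda>x. \<rho> x * f x))\<^sup>2 + (l2norm m (\<lambda>x. \<sigma> x * grad f x))\<^sup>2" if "f \<in> ?V" for f
    unfolding \<rho>_def \<sigma>_def by (rule W12_norm_conformal_power2[OF that])
  have hom: "(?N' (\<lambda>x. c * f x))\<^sup>2 = c\<^sup>2 * (?N' f)\<^sup>2" if f: "f \<in> ?V" for c f
  proof -
    have 1: "l2norm m (\<lambda>x. \<rho> x * (c * f x)) = \<bar>c\<bar> * l2norm m (\<lambda>x. \<rho> x * f x)"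
      unfolding mult.left_commute[of _ c] by (rule l2norm_cmult)
    have "l2norm m (\<lambda>x. \<sigma> x * grad (\<lambda>x. c * f x) x) = l2norm m (\<lambda>x. \<bar>c\<bar> * (\<sigma> x * grad f x))"
    proof (rule L2_cong_AE(2)[OF L2_cmult[OF \<sigma>L[OF grad_L2[OF f]]] L2_measurable[OF \<sigma>L[OF grad_L2[OF W12_cmult[OF f]]]]])
      show "AE x in m. \<bar>c\<bar> * (\<sigma> x * grad f x) = \<sigma> x * grad (\<lambda>x. c * f x) x"
        using grad_cmult[OF f, of c] by eventually_elim simp
    qed
    then have 2: "l2norm m (\<lambda>x. \<sigma> x * grad (\<lambda>x. c * f x) x) = \<bar>c\<bar> * l2norm m (\<lambda>x. \<sigma> x * grad f x)"
      by (simp add: l2norm_cmult)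
    show ?thesis unfolding N'[OF W12_cmult[OF f]] N'[OF f] 1 2 by (simp add: power_mult_distrib distrib_left)
  qed
  have para: "(?N' (\<lambda>x. f x + g x))\<^sup>2 + (?N' (\<lambda>x. f x - g x))\<^sup>2 = 2 * (?N' f)\<^sup>2 + 2 * (?N' g)\<^sup>2"
    if f: "f \<in> ?V" and g: "g \<in> ?V" for f g
  proof -
    let ?s = "\<lambda>x. \<sigma> x * grad (\<lambda>x. f x + g x) x" and ?t = "\<lambda>x. \<sigma> x * grad (\<lambda>x. f x - g x) x"
    \<comment> \<open>The factor \<open>sqrt 2\<close> writes twice the squares on the right as
      plain squares, the form that \<open>l2norm_sum_squares_cong\<close> compares.\<close>
    let ?a = "\<lambda>x. sqrt 2 * (\<sigma> x * grad f x)" and ?b = "\<lambda>x. sqrt 2 * (\<sigma> x * grad g x)"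
    have pp: "AE x in m. (grad (\<lambda>x. f x + g x) x)\<^sup>2 + (grad (\<lambda>x. f x - g x) x)\<^sup>2 = 2 * (grad f x)\<^sup>2 + 2 * (grad g x)\<^sup>2"
      by (rule pointwise_parallelogram[OF infinitesimally_hilbertian_energy[OF H] f g])
    have "(l2norm m ?s)\<^sup>2 + (l2norm m ?t)\<^sup>2 = (l2norm m ?a)\<^sup>2 + (l2norm m ?b)\<^sup>2"
    proof (rule l2norm_sum_squares_cong)
      show "AE x in m. (?s x)\<^sup>2 + (?t x)\<^sup>2 = (?a x)\<^sup>2 + (?b x)\<^sup>2"
        using pp
      proof eventually_elim
        case (elim x)
        have "(?s x)\<^sup>2 + (?t x)\<^sup>2 = (\<sigma> x)\<^sup>2 * ((grad (\<lambda>x. f x + g x) x)\<^sup>2 + (grad (\<lambda>x. f x - g x) x)\<^sup>2)"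
          by (simp only: power_mult_distrib distrib_left)
        moreover have "(?a x)\<^sup>2 + (?b x)\<^sup>2 = (\<sigma> x)\<^sup>2 * (2 * (grad f x)\<^sup>2 + 2 * (grad g x)\<^sup>2)"
          by (simp add: power_mult_distrib distrib_left)
        ultimately show ?case by (simp only: elim)
      qed
    qed (intro L2_cmult \<sigma>L grad_L2 W12_add W12_diff f g)+
    moreover have "(l2norm m (\<lambda>x. \<rho> x * (f x + g x)))\<^sup>2 + (l2norm m (\<lambda>x. \<rho> x * (f x - g x)))\<^sup>2 =
      2 * (l2norm m (\<lambda>x. \<rho> x * f x))\<^sup>2 + 2 * (l2norm m (\<lambda>x. \<rho> x * g x))\<^sup>2"
      using l2norm_parallelogram[OF \<rho>L[OF W12_L2[OF f]] \<rho>L[OF W12_L2[OF g]]]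
      by (simp only: distrib_left right_diff_distrib)
    ultimately show ?thesis
      unfolding N'[OF W12_add[OF f g]] N'[OF W12_diff[OF f g]] N'[OF f] N'[OF g]
      by (simp add: l2norm_cmult power_mult_distrib)
  qed
  have "\<exists>B. (\<forall>f\<in>?V. \<forall>g\<in>?V. B f g = B g f) \<and>
        (\<forall>f\<in>?V. \<forall>g\<in>?V. \<forall>h\<in>?V. B (\<lambda>x. f x + g x) h = B f h + B g h) \<and>
        (\<forall>c. \<forall>f\<in>?V. \<forall>g\<in>?V. B (\<lambda>x. c * f x) g = c * B f g) \<and>
        (\<forall>f\<in>?V. B f f = (?N' f)\<^sup>2)"
    by (rule jordan_von_neumann[of ?V "\<lambda>f. (?N' f)\<^sup>2"]) (simp_all add: W12_add W12_cmult hom para)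
  then obtain B where B: "\<forall>f\<in>?V. \<forall>g\<in>?V. B f g = B g f"
        "\<forall>f\<in>?V. \<forall>g\<in>?V. \<forall>h\<in>?V. B (\<lambda>x. f x + g x) h = B f h + B g h"
        "\<forall>c. \<forall>f\<in>?V. \<forall>g\<in>?V. B (\<lambda>x. c * f x) g = c * B f g"
        "\<forall>f\<in>?V. B f f = (?N' f)\<^sup>2" by blast
  have B': "\<forall>f\<in>?V. B f f \<ge> 0 \<and> ?N' f = sqrt (B f f)" using B(4) nn by simp
  obtain K where K: "K > 0" "\<And>f. f \<in> ?V \<Longrightarrow> ?N' f \<le> K * ?N f" "\<And>f. f \<in> ?V \<Longrightarrow> ?N f \<le> K * ?N' f"
    by (rule ex_norm_bound) (rule that)
  have "\<exists>f\<in>?V. (\<lambda>n. ?N' (\<lambda>x. F n x - f x)) \<longlonglongrightarrow> 0"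
    if F: "\<forall>n. F n \<in> ?V" and Cauchy: "\<forall>e>0. \<exists>K. \<forall>i\<ge>K. \<forall>j\<ge>K. ?N' (\<lambda>x. F i x - F j x) < e" for F :: "nat \<Rightarrow> 'a \<Rightarrow> real"
  proof -
    have "\<exists>n. \<forall>i\<ge>n. \<forall>j\<ge>n. ?N (\<lambda>x. F i x - F j x) < e" if e: "e > 0" for e
    proof -
      have "e / K > 0" using e K(1) by simp
      then obtain n where n: "\<forall>i\<ge>n. \<forall>j\<ge>n. ?N' (\<lambda>x. F i x - F j x) < e / K" using Cauchy by blast
      have "?N (\<lambda>x. F i x - F j x) < e" if "i \<ge> n" "j \<ge> n" for i j
      proof -
        have "?N (\<lambda>x. F i x - F j x) \<le> K * ?N' (\<lambda>x. F i x - F j x)" by (rule K(3)[OF W12_diff]) (use F in auto)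
        also have "?N' (\<lambda>x. F i x - F j x) < e / K" using n that by blast
        then have "K * ?N' (\<lambda>x. F i x - F j x) < e" using K(1) by (simp add: pos_less_divide_eq mult.commute)
        finally show ?thesis .
      qed
      then show ?thesis by blast
    qed
    then obtain f where f: "f \<in> ?V" "(\<lambda>n. ?N (\<lambda>x. F n x - f x)) \<longlonglongrightarrow> 0" using complete F by blast
    have "(\<lambda>n. ?N' (\<lambda>x. F n x - f x)) \<longlonglongrightarrow> 0"
    proof (rule Lim_null_comparison[OF _ tendsto_mult_right_zero[OF f(2), of K]])
      have "?N' (\<lambda>x. F n x - f x) \<le> K * ?N (\<lambda>x. F n x - f x)" for n by (rule K(2)[OF W12_diff]) (use F f in auto)
      then show "\<forall>\<^sub>F n in sequentially. norm (?N' (\<lambda>x. F n x - f x)) \<le> K * ?N (\<lambda>x. F n x - f x)"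
        using nn by simp
    qed
    with f(1) show ?thesis by blast
  qed
  then have "hilbert_space_on ?V ?N'"
    unfolding hilbert_space_on_def using zero W12_add W12_cmult B(1-3) B' by (intro conjI exI[of _ B]) blast+
  then show ?thesis unfolding infinitesimally_hilbertian_def W12_conformal .
qed

end

theorem proposition3p3:
  fixes M :: "'a metric" and m :: "'a measure" and v w :: "'a \<Rightarrow> real"
  assumes "metric_measure_space M m"
    and "continuous_map (mtopology_of M) euclideanreal v" and "bounded (v ` mspace M)"
    and "continuous_map (mtopology_of M) euclideanreal w" and "bounded (w ` mspace M)"
  shows "W12 M m = W12 (conformal_metric M w) (conformal_measure m v) \<and>
    (\<forall>f\<in>W12 M m. AE x in m.
       min_weak_upper_gradient (conformal_metric M w) (conformal_measure m v) f x =
         exp (- w x) * min_weak_upper_gradient M m f x) \<and>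
    (infinitesimally_hilbertian M m \<longrightarrow>
       infinitesimally_hilbertian (conformal_metric M w) (conformal_measure m v))"
proof -
  obtain V where V: "\<forall>x\<in>mspace M. \<bar>v x\<bar> \<le> V" using assms(3) by (auto simp: bounded_iff)
  obtain C where C: "\<forall>x\<in>mspace M. \<bar>w x\<bar> \<le> C" using assms(5) by (auto simp: bounded_iff)
  interpret metric_measure_space M m by (rule assms(1))
  interpret conformal_transformation M m w C v V
    by unfold_locales (use assms V C geodesic space_eq sets_eq_borel in auto)
  show ?thesis
    using W12_conformal grad_conformal infinitesimally_hilbertian_conformal by blast
qed

end
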